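(* The image of the algebra homomorphism $U(\mathfrak{so}(n,\mathbb{C}))\to\mathfrak{O}$ determined by $X_{ij}\mapsto O_{ij}$ coincides with $\mathfrak{O}_{\overline 0}=\mathfrak{O}\cap(\mathcal{W}\otimes\mathcal{C}_{\overline0})$, the even part of the total angular momentum algebra.
   Context: $\mathcal{W}$ is the Weyl algebra over $\mathbb{C}$ with generators $x_1,\dots,x_n,y_1,\dots,y_n$ and relations $[y_i,x_j]=\delta_{ij}$, $[x_i,x_j]=[y_i,y_j]=0$. $\mathcal{C}=\mathcal{C}_{\overline0}\oplus\mathcal{C}_{\overline1}$ is the Clifford algebra over $\mathbb{C}$ with generators $e_1,\dots,e_n$ (odd) and relations $e_ie_j+e_je_i=2\delta_{ij}$. The Weyl-Clifford algebra is $\mathcal{W}\otimes\mathcal{C}$ (ordinary tensor product of algebras), $\mathbb{Z}_2$-graded via $\mathcal{C}$. The total angular momentum algebra (TAMA) $\mathfrak{O}$ is the set of elements of $\mathcal{W}\otimes\mathcal{C}$ whose graded commutator with each of $\partial_{\underline x}=\sum_jy_j\otimes e_j$ and $\underline x=\sum_jx_j\otimes e_j$ vanishes (equivalently, the graded centraliser of the Lie superalgebra $\mathfrak{spo}(2|1)$ they generate). $\mathfrak{so}(n,\mathbb{C})$ is the Lie algebra of skew-symmetric complex $n\times n$ matrices, $X_{ij}=E_{ij}-E_{ji}$ with $E_{ij}$ the elementary matrices, and $O_{ij}=x_iy_j-x_jy_i+\frac12e_ie_j$ for $i\ne j$. The elements $O_{ij}$ lie in $\mathfrak{O}$, and $X_{ij}\mapsto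 O_{ij}$ is a Lie algebra homomorphism, so it extends to $U(\mathfrak{so}(n,\mathbb{C}))$. *)

theory Defs
  imports "HOL-Analysis.Analysis" "HOL-Library.Poly_Mapping"
begin

section \<open>Complex vector spaces, algebras and Lie algebras\<close>

class scaleC =
  fixes scaleC :: "complex \<Rightarrow> 'a \<Rightarrow> 'a" (infixr "*\<^sub>C" 75)

class complex_vector = scaleC + ab_group_add +
  assumes scaleC_add_right: "c *\<^sub>C (x + y) = c *\<^sub>C x + c *\<^sub>C y"
    and scaleC_add_left: "(c + d) *\<^sub>C x = c *\<^sub>C x + d *\<^sub>C x"
    and scaleC_scaleC: "c *\<^sub>C d *\<^sub>C x = (c * d) *\<^sub>C x"
    and scaleC_one: "1 *\<^sub>C x = x"

global_interpretation complex_vector: vector_space "scaleC :: complex \<Rightarrow> 'a \<Rightarrow> 'a::complex_vector"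
  defines cspan = complex_vector.span
  by unfold_locales (simp_all add: scaleC_add_right scaleC_add_left scaleC_scaleC scaleC_one)

text \<open>
  The library class \<^class>\<open>ring_1\<close> assumes \<open>0 \<noteq> 1\<close>, which an arbitrary quotient need not satisfy.
\<close>

class complex_algebra_1 = complex_vector + ring + monoid_mult +
  assumes mult_scaleC_left: "(c *\<^sub>C x) * y = c *\<^sub>C (x * y)"
    and mult_scaleC_right: "x * (c *\<^sub>C y) = c *\<^sub>C (x * y)"

definition algebra_hom :: "('a::complex_algebra_1 \<Rightarrow> 'b::complex_algebra_1) \<Rightarrow> bool" where
  "algebra_hom f \<longleftrightarrow>
     (\<forall>x y. f (x + y) = f x + f y) \<and> (\<forall>c x. f (c *\<^sub>C x) = c *\<^sub>C f x) \<and>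
     (\<forall>x y. f (x * y) = f x * f y) \<and> f 1 = 1"

class complex_lie_algebra = complex_vector +
  fixes lie_bracket :: "'a \<Rightarrow> 'a \<Rightarrow> 'a"
  assumes lie_bracket_add_left: "lie_bracket (x + y) z = lie_bracket x z + lie_bracket y z"
    and lie_bracket_add_right: "lie_bracket z (x + y) = lie_bracket z x + lie_bracket z y"
    and lie_bracket_scaleC_left: "lie_bracket (c *\<^sub>C x) y = c *\<^sub>C lie_bracket x y"
    and lie_bracket_scaleC_right: "lie_bracket x (c *\<^sub>C y) = c *\<^sub>C lie_bracket x y"
    and lie_bracket_self: "lie_bracket x x = 0"
    and jacobi: "lie_bracket x (lie_bracket y z) + lie_bracket y (lie_bracket z x)
                   + lie_bracket z (lie_bracket x y) = 0"

section \<open>Algebras given by generators and relations\<close>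

text \<open>
  The product of \<^typ>\<open>'m \<Rightarrow>\<^sub>0 complex\<close> is convolution with respect to the operation \<open>+\<close>
  on \<open>'m\<close>.  Words are therefore made into an additively written monoid under concatenation, so that
  finitely supported functions on words form the free algebra.
\<close>

datatype 'g word = Word "'g list"

instantiation word :: (type) monoid_add
begin

definition zero_word :: "'a word" where "zero_word = Word []"

fun plus_word :: "'a word \<Rightarrow> 'a word \<Rightarrow> 'a word" where
  "plus_word (Word u) (Word v) = Word (u @ v)"

instance
proof
  fix a b c :: "'a word"
  show "a + b + c = a + (b + c)" by (cases a; cases b; cases c) simp
  show "0 + a = a" by (cases a) (simp add: zero_word_def)
  show "a + 0 = a" by (cases a) (simp add: zero_word_def)
qed

end

type_synonym 'g free_algebra = "'g word \<Rightarrow>\<^sub>0 complex"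

definition free_gen :: "'g \<Rightarrow> 'g free_algebra" where
  "free_gen g = Poly_Mapping.single (Word [g]) 1"

text \<open>The scalar \<open>c\<close> of the free algebra is \<open>c\<close> times the empty word.\<close>

abbreviation scalar :: "complex \<Rightarrow> 'm::monoid_add \<Rightarrow>\<^sub>0 complex" where
  "scalar c \<equiv> Poly_Mapping.single 0 c"

inductive_set two_sided_ideal :: "'r::ring_1 set \<Rightarrow> 'r set" for S where
  gen: "s \<in> S \<Longrightarrow> s \<in> two_sided_ideal S"
| zero: "0 \<in> two_sided_ideal S"
| add: "x \<in> two_sided_ideal S \<Longrightarrow> y \<in> two_sided_ideal S \<Longrightarrow> x + y \<in> two_sided_ideal S"
| mult_left: "x \<in> two_sided_ideal S \<Longrightarrow> r * x \<in> two_sided_ideal S"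
| mult_right: "x \<in> two_sided_ideal S \<Longrightarrow> x * r \<in> two_sided_ideal S"

text \<open>
  A type of generators of this class carries a set of relators, i.e. of elements of the free
  algebra that are set to zero in the presented algebra.
\<close>

class algebra_presentation =
  fixes relators :: "('a word \<Rightarrow>\<^sub>0 complex) set"

definition presented_eq :: "'g::algebra_presentation free_algebra \<Rightarrow> 'g free_algebra \<Rightarrow> bool" where
  "presented_eq a b \<longleftrightarrow> a - b \<in> two_sided_ideal relators"

lemma two_sided_ideal_uminus: "x \<in> two_sided_ideal S \<Longrightarrow> - x \<in> two_sided_ideal S"
  using two_sided_ideal.mult_left[of x S "- 1"] by simp

lemma equivp_presented_eq: "equivp presented_eq"
proof (rule equivpI)
  show "reflp presented_eq"
    by (simp add: reflp_def presented_eq_def two_sided_ideal.zero)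
  show "symp presented_eq"
    unfolding symp_def presented_eq_def by (metis minus_diff_eq two_sided_ideal_uminus)
  show "transp presented_eq"
    unfolding transp_def presented_eq_def
  proof (intro allI impI)
    fix x y z :: "'g::algebra_presentation free_algebra"
    assume "x - y \<in> two_sided_ideal relators" "y - z \<in> two_sided_ideal relators"
    from two_sided_ideal.add[OF this] show "x - z \<in> two_sided_ideal relators" by simp
  qed
qed

quotient_type (overloaded) 'g presented = "'g::algebra_presentation free_algebra" / presented_eq
  by (rule equivp_presented_eq)

lemma poly_mapping_single_induct [case_names zero add single]:
  fixes f :: "'m \<Rightarrow>\<^sub>0 complex"
  assumes "P 0" "\<And>f g. P f \<Longrightarrow> P g \<Longrightarrow> P (f + g)" "\<And>k c. P (Poly_Mapping.single k c)"
  shows "P f"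
proof (induction f rule: update_induct)
  case const
  show ?case by fact
next
  case (update f a b)
  have "Poly_Mapping.update a b f = f + Poly_Mapping.single a b"
    using update(1)
    by (intro poly_mapping_eqI)
       (auto simp: Poly_Mapping.lookup_update lookup_add lookup_single in_keys_iff when_def)
  then show ?case using update(3) assms by metis
qed

lemma scalar_central:
  fixes f :: "'m::monoid_add \<Rightarrow>\<^sub>0 complex"
  shows "scalar c * f = f * scalar c"
  by (induction f rule: poly_mapping_single_induct)
     (simp_all add: distrib_left distrib_right mult_single mult.commute)

instantiation presented :: (algebra_presentation) complex_algebra_1
begin

lift_definition zero_presented :: "'a presented" is 0 .

lift_definition one_presented :: "'a presented" is 1 .

lift_definition plus_presented :: "'a presented \<Rightarrow> 'a presented \<Rightarrow> 'a presented" is "(+)"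
  unfolding presented_eq_def by (metis add_diff_add two_sided_ideal.add)

lift_definition uminus_presented :: "'a presented \<Rightarrow> 'a presented" is uminus
  unfolding presented_eq_def by (metis minus_diff_minus two_sided_ideal_uminus)

lift_definition minus_presented :: "'a presented \<Rightarrow> 'a presented \<Rightarrow> 'a presented" is "(-)"
proof -
  fix a a' b b' :: "'a free_algebra"
  assume "presented_eq a a'" "presented_eq b b'"
  then have "(a - a') + - (b - b') \<in> two_sided_ideal relators"
    unfolding presented_eq_def by (intro two_sided_ideal.add two_sided_ideal_uminus)
  moreover have "(a - a') + - (b - b') = (a - b) - (a' - b')" by simp
  ultimately show "presented_eq (a - b) (a' - b')" unfolding presented_eq_def by metis
qed

lift_definition times_presented :: "'a presented \<Rightarrow> 'a presented \<Rightarrow> 'a presented" is "(*)"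
proof -
  fix a a' b b' :: "'a free_algebra"
  assume "presented_eq a a'" "presented_eq b b'"
  then have "(a - a') * b + a' * (b - b') \<in> two_sided_ideal relators"
    unfolding presented_eq_def
    by (intro two_sided_ideal.add two_sided_ideal.mult_left two_sided_ideal.mult_right)
  moreover have "(a - a') * b + a' * (b - b') = a * b - a' * b'" by (simp add: algebra_simps)
  ultimately show "presented_eq (a * b) (a' * b')" unfolding presented_eq_def by metis
qed

lift_definition scaleC_presented :: "complex \<Rightarrow> 'a presented \<Rightarrow> 'a presented"
  is "\<lambda>c f. scalar c * f"
  unfolding presented_eq_def by (metis right_diff_distrib two_sided_ideal.mult_left)

lemma presented_eqI: "a = b \<Longrightarrow> presented_eq a b"
  by (simp add: presented_eq_def two_sided_ideal.zero)

instance
proof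
  fix a b d :: "'a presented" and c e :: complex
  show "a + b + d = a + (b + d)" by transfer (rule presented_eqI, simp add: algebra_simps)
  show "a + b = b + a" by transfer (rule presented_eqI, simp add: algebra_simps)
  show "0 + a = a" by transfer (rule presented_eqI, simp)
  show "- a + a = 0" by transfer (rule presented_eqI, simp)
  show "a - b = a + - b" by transfer (rule presented_eqI, simp)
  show "a * b * d = a * (b * d)" by transfer (rule presented_eqI, simp add: mult.assoc)
  show "1 * a = a" by transfer (rule presented_eqI, simp)
  show "a * 1 = a" by transfer (rule presented_eqI, simp)
  show "(a + b) * d = a * d + b * d" by transfer (rule presented_eqI, simp add: algebra_simps)
  show "a * (b + d) = a * b + a * d" by transfer (rule presented_eqI, simp add: algebra_simps)
  show "c *\<^sub>C (a + b) = c *\<^sub>C a + c *\<^sub>C b"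
    by transfer (rule presented_eqI, simp add: algebra_simps)
  show "(c + e) *\<^sub>C a = c *\<^sub>C a + e *\<^sub>C a"
    by transfer (rule presented_eqI, simp add: algebra_simps single_add)
  show "c *\<^sub>C e *\<^sub>C a = (c * e) *\<^sub>C a"
    by transfer (rule presented_eqI, simp add: mult.assoc[symmetric] mult_single)
  show "1 *\<^sub>C a = a" by transfer (rule presented_eqI, simp)
  show "(c *\<^sub>C a) * b = c *\<^sub>C (a * b)" by transfer (rule presented_eqI, simp add: mult.assoc)
  show "a * (c *\<^sub>C b) = c *\<^sub>C (a * b)"
    by transfer (rule presented_eqI, metis mult.assoc scalar_central)
qed

end

lift_definition gen :: "'g::algebra_presentation \<Rightarrow> 'g presented" is free_gen .

section \<open>Tensor products of algebras\<close>

text \<open>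
  The tensor product is the free vector space on pairs modulo the subspace spanned by the bilinearity
  relations.  Its product \<open>(a \<otimes> b) (a' \<otimes> b') = a a' \<otimes> b b'\<close> is inherited from the
  convolution product; hence pairs are an additively written monoid under componentwise multiplication.
\<close>

datatype ('a, 'b) tpair = TPair 'a 'b

instantiation tpair :: (monoid_mult, monoid_mult) monoid_add
begin

definition zero_tpair :: "('a, 'b) tpair" where "zero_tpair = TPair 1 1"

fun plus_tpair :: "('a, 'b) tpair \<Rightarrow> ('a, 'b) tpair \<Rightarrow> ('a, 'b) tpair" where
  "plus_tpair (TPair a b) (TPair a' b') = TPair (a * a') (b * b')"

instance
proof
  fix p q r :: "('a, 'b) tpair"
  show "p + q + r = p + (q + r)" by (cases p; cases q; cases r) (simp add: mult.assoc)
  show "0 + p = p" by (cases p) (simp add: zero_tpair_def)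
  show "p + 0 = p" by (cases p) (simp add: zero_tpair_def)
qed

end

definition free_pair :: "'a \<Rightarrow> 'b \<Rightarrow> ('a, 'b) tpair \<Rightarrow>\<^sub>0 complex" where
  "free_pair a b = Poly_Mapping.single (TPair a b) 1"

definition scale_pairs ::
    "complex \<Rightarrow> (('a, 'b) tpair \<Rightarrow>\<^sub>0 complex) \<Rightarrow> ('a, 'b) tpair \<Rightarrow>\<^sub>0 complex" where
  "scale_pairs c = Poly_Mapping.map ((*) c)"

definition bilinear_relators ::
    "(('a::complex_vector, 'b::complex_vector) tpair \<Rightarrow>\<^sub>0 complex) set" where
  "bilinear_relators =
     {free_pair (a + a') b - free_pair a b - free_pair a' b | a a' b. True} \<union>
     {free_pair a (b + b') - free_pair a b - free_pair a b' | a b b'. True} \<union>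
     {free_pair (c *\<^sub>C a) b - scale_pairs c (free_pair a b) | c a b. True} \<union>
     {free_pair a (c *\<^sub>C b) - scale_pairs c (free_pair a b) | c a b. True}"

definition bilinear_null ::
    "(('a::complex_vector, 'b::complex_vector) tpair \<Rightarrow>\<^sub>0 complex) set" where
  "bilinear_null = module.span scale_pairs bilinear_relators"

definition tensor_eq ::
    "(('a::complex_vector, 'b::complex_vector) tpair \<Rightarrow>\<^sub>0 complex) \<Rightarrow>
     (('a, 'b) tpair \<Rightarrow>\<^sub>0 complex) \<Rightarrow> bool" where
  "tensor_eq f g \<longleftrightarrow> f - g \<in> bilinear_null"

lemma lookup_scale_pairs: "Poly_Mapping.lookup (scale_pairs c f) k = c * Poly_Mapping.lookup f k"
  unfolding scale_pairs_def by (transfer, simp add: when_def)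

interpretation pairs: vector_space "scale_pairs :: complex \<Rightarrow> (('a, 'b) tpair \<Rightarrow>\<^sub>0 complex) \<Rightarrow> _"
  by unfold_locales
     (auto intro!: poly_mapping_eqI simp: lookup_scale_pairs lookup_add algebra_simps)

lemma scale_pairs_conv_mult:
  "scale_pairs c (f :: ('a::monoid_mult, 'b::monoid_mult) tpair \<Rightarrow>\<^sub>0 complex) = scalar c * f"
  unfolding scale_pairs_def by (rule mult_map_scale_conv_mult)

lemma equivp_tensor_eq:
  "equivp (tensor_eq :: (('a::complex_vector, 'b::complex_vector) tpair \<Rightarrow>\<^sub>0 complex) \<Rightarrow> _)"
proof (rule equivpI)
  show "reflp tensor_eq"
    by (simp add: reflp_def tensor_eq_def bilinear_null_def pairs.span_zero)
  show "symp tensor_eq"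
    unfolding symp_def tensor_eq_def bilinear_null_def by (metis minus_diff_eq pairs.span_neg)
  show "transp (tensor_eq :: (('a, 'b) tpair \<Rightarrow>\<^sub>0 complex) \<Rightarrow> _)"
  proof (rule transpI)
    fix x y z :: "('a, 'b) tpair \<Rightarrow>\<^sub>0 complex"
    assume "tensor_eq x y" "tensor_eq y z"
    then have "(x - y) + (y - z) \<in> bilinear_null"
      unfolding tensor_eq_def bilinear_null_def by (rule pairs.span_add)
    then show "tensor_eq x z" by (simp add: tensor_eq_def)
  qed
qed

quotient_type (overloaded) ('a, 'b) tensor =
    "('a::complex_vector, 'b::complex_vector) tpair \<Rightarrow>\<^sub>0 complex" / tensor_eq
  by (rule equivp_tensor_eq)

lift_definition tensor :: "'a::complex_vector \<Rightarrow> 'b::complex_vector \<Rightarrow> ('a, 'b) tensor"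
  (infixr "\<otimes>" 72) is free_pair .

lemma bilinear_null_mult:
  fixes f g :: "('a::complex_algebra_1, 'b::complex_algebra_1) tpair \<Rightarrow>\<^sub>0 complex"
  assumes "f \<in> bilinear_null"
  shows "g * f \<in> bilinear_null" and "f * g \<in> bilinear_null"
proof -
  have single_conv: "Poly_Mapping.single (TPair a b) c = scale_pairs c (free_pair a b)"
    for a :: 'a and b :: 'b and c
    by (auto simp: free_pair_def lookup_scale_pairs lookup_single when_def
        intro!: poly_mapping_eqI)
  have mult_gen: "free_pair a b * free_pair a' b' = free_pair (a * a') (b * b')"
    for a a' :: 'a and b b' :: 'b
    by (simp add: free_pair_def mult_single)
  have scale_left: "scale_pairs c u * v = scale_pairs c (u * v)"
    and scale_right: "u * scale_pairs c v = scale_pairs c (u * v)"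
    for c and u v :: "('a, 'b) tpair \<Rightarrow>\<^sub>0 complex"
    unfolding scale_pairs_conv_mult by (simp add: mult.assoc, metis mult.assoc scalar_central)
  have gen: "free_pair a b * r \<in> bilinear_relators \<and> r * free_pair a b \<in> bilinear_relators"
    if "r \<in> bilinear_relators" for a :: 'a and b :: 'b and r
    using that unfolding bilinear_relators_def
    apply (elim UnE CollectE exE conjE; hypsubst)
       apply (simp_all only: left_diff_distrib right_diff_distrib mult_gen distrib_left distrib_right
        mult_scaleC_left mult_scaleC_right scale_left scale_right)
       apply blast+
    done
  have step: "g * r \<in> bilinear_null \<and> r * g \<in> bilinear_null" if "r \<in> bilinear_relators"
    for r and g :: "('a, 'b) tpair \<Rightarrow>\<^sub>0 complex"
  proof (induction g rule: poly_mapping_single_induct)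
    case zero
    then show ?case by (simp add: bilinear_null_def pairs.span_zero)
  next
    case (add f g)
    then show ?case by (simp add: bilinear_null_def distrib_left distrib_right pairs.span_add)
  next
    case (single k c)
    obtain a b where k: "k = TPair a b" by (cases k)
    show ?case
      unfolding k single_conv scale_left scale_right bilinear_null_def
      using gen[OF that] by (blast intro: pairs.span_scale pairs.span_base)
  qed
  from assms have "g * f \<in> bilinear_null \<and> f * g \<in> bilinear_null"
    unfolding bilinear_null_def
  proof (induction rule: pairs.span_induct_alt)
    case base
    then show ?case by (simp add: pairs.span_zero)
  next
    case (step c x y)
    then show ?case
      using \<open>\<And>r g. r \<in> bilinear_relators \<Longrightarrow> g * r \<in> bilinear_null \<and> r * g \<in> bilinear_null\<close>[of x g]
      by (auto simp: bilinear_null_def distrib_left distrib_right scale_left scale_right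
          intro!: pairs.span_add pairs.span_scale)
  qed
  then show "g * f \<in> bilinear_null" "f * g \<in> bilinear_null" by auto
qed

instantiation tensor :: (complex_algebra_1, complex_algebra_1) complex_algebra_1
begin

lift_definition zero_tensor :: "('a, 'b) tensor" is 0 .

lift_definition one_tensor :: "('a, 'b) tensor" is 1 .

lift_definition plus_tensor :: "('a, 'b) tensor \<Rightarrow> ('a, 'b) tensor \<Rightarrow> ('a, 'b) tensor" is "(+)"
  unfolding tensor_eq_def bilinear_null_def by (metis add_diff_add pairs.span_add)

lift_definition uminus_tensor :: "('a, 'b) tensor \<Rightarrow> ('a, 'b) tensor" is uminus
  unfolding tensor_eq_def bilinear_null_def by (metis minus_diff_minus pairs.span_neg)

lift_definition minus_tensor :: "('a, 'b) tensor \<Rightarrow> ('a, 'b) tensor \<Rightarrow> ('a, 'b) tensor" is "(-)"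
proof -
  fix a a' b b' :: "('a, 'b) tpair \<Rightarrow>\<^sub>0 complex"
  assume "tensor_eq a a'" "tensor_eq b b'"
  then have "(a - a') - (b - b') \<in> bilinear_null"
    unfolding tensor_eq_def bilinear_null_def by (rule pairs.span_diff)
  moreover have "(a - a') - (b - b') = (a - b) - (a' - b')" by simp
  ultimately show "tensor_eq (a - b) (a' - b')" unfolding tensor_eq_def by metis
qed

lift_definition times_tensor :: "('a, 'b) tensor \<Rightarrow> ('a, 'b) tensor \<Rightarrow> ('a, 'b) tensor" is "(*)"
proof -
  fix a a' b b' :: "('a, 'b) tpair \<Rightarrow>\<^sub>0 complex"
  assume "tensor_eq a a'" "tensor_eq b b'"
  then have "(a - a') * b \<in> bilinear_null" "a' * (b - b') \<in> bilinear_null"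
    unfolding tensor_eq_def by (auto intro: bilinear_null_mult)
  then have "(a - a') * b + a' * (b - b') \<in> bilinear_null"
    unfolding bilinear_null_def by (rule pairs.span_add)
  moreover have "(a - a') * b + a' * (b - b') = a * b - a' * b'" by (simp add: algebra_simps)
  ultimately show "tensor_eq (a * b) (a' * b')" unfolding tensor_eq_def by metis
qed

lift_definition scaleC_tensor :: "complex \<Rightarrow> ('a, 'b) tensor \<Rightarrow> ('a, 'b) tensor" is scale_pairs
  unfolding tensor_eq_def bilinear_null_def
  by (metis pairs.scale_right_diff_distrib pairs.span_scale)

lemma tensor_eqI: "f = g \<Longrightarrow> tensor_eq f g"
  by (simp add: tensor_eq_def bilinear_null_def pairs.span_zero)

instance
proof
  fix a b d :: "('a, 'b) tensor" and c e :: complex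
  show "a + b + d = a + (b + d)" by transfer (rule tensor_eqI, simp add: algebra_simps)
  show "a + b = b + a" by transfer (rule tensor_eqI, simp add: algebra_simps)
  show "0 + a = a" by transfer (rule tensor_eqI, simp)
  show "- a + a = 0" by transfer (rule tensor_eqI, simp)
  show "a - b = a + - b" by transfer (rule tensor_eqI, simp)
  show "a * b * d = a * (b * d)" by transfer (rule tensor_eqI, simp add: mult.assoc)
  show "1 * a = a" by transfer (rule tensor_eqI, simp)
  show "a * 1 = a" by transfer (rule tensor_eqI, simp)
  show "(a + b) * d = a * d + b * d" by transfer (rule tensor_eqI, simp add: algebra_simps)
  show "a * (b + d) = a * b + a * d" by transfer (rule tensor_eqI, simp add: algebra_simps)
  show "c *\<^sub>C (a + b) = c *\<^sub>C a + c *\<^sub>C b"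
    by transfer (rule tensor_eqI, simp add: pairs.scale_right_distrib)
  show "(c + e) *\<^sub>C a = c *\<^sub>C a + e *\<^sub>C a"
    by transfer (rule tensor_eqI, simp add: pairs.scale_left_distrib)
  show "c *\<^sub>C e *\<^sub>C a = (c * e) *\<^sub>C a" by transfer (rule tensor_eqI, simp)
  show "1 *\<^sub>C a = a" by transfer (rule tensor_eqI, simp)
  show "(c *\<^sub>C a) * b = c *\<^sub>C (a * b)"
    by transfer (rule tensor_eqI, simp add: scale_pairs_conv_mult mult.assoc)
  show "a * (c *\<^sub>C b) = c *\<^sub>C (a * b)"
    by transfer (rule tensor_eqI, simp only: scale_pairs_conv_mult, metis mult.assoc scalar_central)
qed

end

lemma one_tensor: "1 = 1 \<otimes> 1"
  by transfer (rule tensor_eqI, simp add: free_pair_def zero_tpair_def[symmetric])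

lemma tensor_mult_tensor: "(a \<otimes> b) * (a' \<otimes> b') = (a * a') \<otimes> (b * b')"
  by transfer (rule tensor_eqI, simp add: free_pair_def mult_single)

section \<open>Weyl algebra, Clifford algebra and Weyl-Clifford algebra\<close>

text \<open>The index set \<open>{1, \<dots>, n}\<close> is a finite type \<open>'n\<close>.\<close>

datatype 'n weyl_gen = GenX 'n | GenY 'n

instantiation weyl_gen :: (type) algebra_presentation
begin

definition relators_weyl_gen :: "'a weyl_gen free_algebra set" where
  "relators_weyl_gen =
     (let x = (\<lambda>i. free_gen (GenX i)); y = (\<lambda>i. free_gen (GenY i)) in
       {y i * x j - x j * y i - (if i = j then 1 else 0) | i j. True} \<union>
       {x i * x j - x j * x i | i j. True} \<union>
       {y i * y j - y j * y i | i j. True})"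

instance ..

end

datatype 'n clifford_gen = GenE 'n

instantiation clifford_gen :: (type) algebra_presentation
begin

definition relators_clifford_gen :: "'a clifford_gen free_algebra set" where
  "relators_clifford_gen =
     (let e = (\<lambda>i. free_gen (GenE i)) in
       {e i * e j + e j * e i - (if i = j then 2 else 0) | i j. True})"

instance ..

end

type_synonym 'n weyl = "'n weyl_gen presented"
type_synonym 'n clifford = "'n clifford_gen presented"
type_synonym 'n weyl_clifford = "('n weyl, 'n clifford) tensor"

definition wx :: "'n \<Rightarrow> 'n weyl" where "wx i = gen (GenX i)"
definition wy :: "'n \<Rightarrow> 'n weyl" where "wy i = gen (GenY i)"
definition ce :: "'n \<Rightarrow> 'n clifford" where "ce i = gen (GenE i)"

lemma presented_relator:
  assumes "f - g \<in> (relators :: 'g::algebra_presentation free_algebra set)"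
  shows "abs_presented f = abs_presented g"
  using assms by (simp add: presented.abs_eq_iff presented_eq_def two_sided_ideal.gen)

lemma weyl_relation: "wy i * wx j - wx j * wy i = (if i = j then 1 else 0)"
proof -
  have "abs_presented (free_gen (GenY i) * free_gen (GenX j) - free_gen (GenX j) * free_gen (GenY i))
      = abs_presented (if i = j then 1 else 0)"
    by (rule presented_relator) (auto simp: relators_weyl_gen_def Let_def)
  then show ?thesis
    by (auto simp: wx_def wy_def gen_def times_presented.abs_eq minus_presented.abs_eq
        one_presented_def zero_presented_def split: if_splits)
qed

lemma clifford_relation: "ce i * ce j + ce j * ce i = (if i = j then 1 + 1 else 0)"
proof -
  have "abs_presented (free_gen (GenE i) * free_gen (GenE j) + free_gen (GenE j) * free_gen (GenE i))
      = abs_presented (if i = j then 1 + 1 else 0)"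
    by (rule presented_relator) (auto simp: relators_clifford_gen_def Let_def)
  then show ?thesis
    by (auto simp: ce_def gen_def times_presented.abs_eq plus_presented.abs_eq
        one_presented_def zero_presented_def split: if_splits)
qed

definition clifford_even :: "'n clifford set" where
  "clifford_even = cspan {prod_list (map ce is) | is. even (length is)}"

definition clifford_odd :: "'n clifford set" where
  "clifford_odd = cspan {prod_list (map ce is) | is. odd (length is)}"

definition wc_even :: "'n weyl_clifford set" where
  "wc_even = cspan {w \<otimes> c | w c. c \<in> clifford_even}"

definition wc_odd :: "'n weyl_clifford set" where
  "wc_odd = cspan {w \<otimes> c | w c. c \<in> clifford_odd}"

section \<open>The total angular momentum algebra\<close>

text \<open>
  The components of \<open>a\<close> with respect to the decomposition of the Weyl-Clifford algebra as the direct
  sum of \<^const>\<open>wc_even\<close> and \<^const>\<open>wc_odd\<close>.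
\<close>

definition even_part :: "'n weyl_clifford \<Rightarrow> 'n weyl_clifford" where
  "even_part a = (THE a0. a0 \<in> wc_even \<and> a - a0 \<in> wc_odd)"

definition odd_part :: "'n weyl_clifford \<Rightarrow> 'n weyl_clifford" where
  "odd_part a = a - even_part a"

text \<open>
  The bilinear extension of \<open>[a, b] = a b - (-1)\<^bsup>|a||b|\<^esup> b a\<close> for homogeneous \<open>a\<close>, \<open>b\<close>.
\<close>

definition graded_commutator :: "'n weyl_clifford \<Rightarrow> 'n weyl_clifford \<Rightarrow> 'n weyl_clifford" where
  "graded_commutator a b =
     (let a0 = even_part a; a1 = odd_part a; b0 = even_part b; b1 = odd_part b in
       (a0 * b0 - b0 * a0) + (a0 * b1 - b1 * a0) + (a1 * b0 - b0 * a1) + (a1 * b1 + b1 * a1))"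

definition dirac_operator :: "'n::finite weyl_clifford" where
  "dirac_operator = (\<Sum>j\<in>UNIV. wy j \<otimes> ce j)"

definition vector_variable :: "'n::finite weyl_clifford" where
  "vector_variable = (\<Sum>j\<in>UNIV. wx j \<otimes> ce j)"

definition TAMA :: "'n::finite weyl_clifford set" where
  "TAMA = {a. graded_commutator a dirac_operator = 0 \<and> graded_commutator a vector_variable = 0}"

definition TAMA_even :: "'n::finite weyl_clifford set" where
  "TAMA_even = TAMA \<inter> wc_even"

definition O_elem :: "'n \<Rightarrow> 'n \<Rightarrow> 'n weyl_clifford" where
  "O_elem i j = (wx i * wy j - wx j * wy i) \<otimes> 1 + (1/2) *\<^sub>C (1 \<otimes> (ce i * ce j))"

section \<open>The orthogonal Lie algebra and universal enveloping algebras\<close>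

typedef 'n so = "{A :: complex^'n^'n::finite. transpose A = - A}"
  by (rule exI[of _ 0]) (simp add: transpose_def vec_eq_iff)

setup_lifting type_definition_so

lemma transpose_linear:
  fixes A B :: "complex^'n^'m"
  shows "transpose (0 :: complex^'n^'m) = 0"
    and "transpose (A + B) = transpose A + transpose B"
    and "transpose (A - B) = transpose A - transpose B"
    and "transpose (- A) = - transpose A"
    and "transpose (\<chi> i j. c * A $ i $ j) = (\<chi> i j. c * transpose A $ i $ j)"
  by (simp_all add: transpose_def vec_eq_iff)

instantiation so :: (finite) complex_lie_algebra
begin

lift_definition zero_so :: "'a so" is 0
  by (simp add: transpose_linear)

lift_definition plus_so :: "'a so \<Rightarrow> 'a so \<Rightarrow> 'a so" is "(+)"
  by (simp add: transpose_linear)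

lift_definition minus_so :: "'a so \<Rightarrow> 'a so \<Rightarrow> 'a so" is "(-)"
  by (simp add: transpose_linear)

lift_definition uminus_so :: "'a so \<Rightarrow> 'a so" is uminus
  by (simp add: transpose_linear)

lift_definition scaleC_so :: "complex \<Rightarrow> 'a so \<Rightarrow> 'a so" is "\<lambda>c A. \<chi> i j. c * A $ i $ j"
  by (simp add: transpose_linear) (simp add: vec_eq_iff)

lift_definition lie_bracket_so :: "'a so \<Rightarrow> 'a so \<Rightarrow> 'a so" is "\<lambda>A B. A ** B - B ** A"
proof -
  fix A B :: "complex^'a^'a"
  assume A: "transpose A = - A" and B: "transpose B = - B"
  have "transpose (A ** B) = B ** A" and "transpose (B ** A) = A ** B"
    by (simp_all add: matrix_transpose_mul A B) (simp_all add: matrix_matrix_mult_def vec_eq_iff)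
  then show "transpose (A ** B - B ** A) = - (A ** B - B ** A)"
    by (simp add: transpose_linear)
qed

instance
proof
  fix a b d :: "'a so" and c e :: complex
  have sc: "(\<chi> i j. c * A $ i $ j) ** B = (\<chi> i j. c * (A ** B) $ i $ j)"
    "B ** (\<chi> i j. c * A $ i $ j) = (\<chi> i j. c * (B ** A) $ i $ j)"
    for c and A B :: "complex^'a^'a"
    by (simp_all add: matrix_matrix_mult_def vec_eq_iff sum_distrib_left algebra_simps)
  have dl: "(A - B) ** C = A ** C - B ** C" "C ** (A - B) = C ** A - C ** B"
    "(A + B) ** C = A ** C + B ** C" "C ** (A + B) = C ** A + C ** B"
    for A B C :: "complex^'a^'a"
    by (simp_all add: matrix_matrix_mult_def vec_eq_iff algebra_simps sum.distrib sum_subtractf)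
  show "a + b + d = a + (b + d)" by transfer simp
  show "a + b = b + a" by transfer simp
  show "0 + a = a" by transfer simp
  show "- a + a = 0" by transfer simp
  show "a - b = a + - b" by transfer simp
  show "c *\<^sub>C (a + b) = c *\<^sub>C a + c *\<^sub>C b" by transfer (simp add: vec_eq_iff algebra_simps)
  show "(c + e) *\<^sub>C a = c *\<^sub>C a + e *\<^sub>C a" by transfer (simp add: vec_eq_iff algebra_simps)
  show "c *\<^sub>C e *\<^sub>C a = (c * e) *\<^sub>C a" by transfer (simp add: vec_eq_iff algebra_simps)
  show "1 *\<^sub>C a = a" by transfer (simp add: vec_eq_iff)
  show "lie_bracket (a + b) d = lie_bracket a d + lie_bracket b d" by transfer (simp add: dl)
  show "lie_bracket d (a + b) = lie_bracket d a + lie_bracket d b" by transfer (simp add: dl)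
  show "lie_bracket (c *\<^sub>C a) b = c *\<^sub>C lie_bracket a b"
    by transfer (simp add: sc, simp add: vec_eq_iff algebra_simps)
  show "lie_bracket a (c *\<^sub>C b) = c *\<^sub>C lie_bracket a b"
    by transfer (simp add: sc, simp add: vec_eq_iff algebra_simps)
  show "lie_bracket a a = 0" by transfer simp
  show "lie_bracket a (lie_bracket b d) + lie_bracket b (lie_bracket d a)
          + lie_bracket d (lie_bracket a b) = 0"
    by transfer (simp add: dl matrix_mul_assoc)
qed

end

lift_definition so_X :: "'n::finite \<Rightarrow> 'n \<Rightarrow> 'n so"
  is "\<lambda>i j. \<chi> k l. (if k = i \<and> l = j then 1 else 0) - (if k = j \<and> l = i then 1 else 0)"
  by (simp add: transpose_def vec_eq_iff conj_commute)

datatype 'g uea_gen = UGen 'g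

instantiation uea_gen :: (complex_lie_algebra) algebra_presentation
begin

definition relators_uea_gen :: "'a uea_gen free_algebra set" where
  "relators_uea_gen =
     (let u = (\<lambda>X. free_gen (UGen X)) in
       {u (X + Y) - u X - u Y | X Y. True} \<union>
       {u (c *\<^sub>C X) - scalar c * u X | c X. True} \<union>
       {u X * u Y - u Y * u X - u (lie_bracket X Y) | X Y. True})"

instance ..

end

type_synonym 'g uea = "'g uea_gen presented"

definition uea_incl :: "'g::complex_lie_algebra \<Rightarrow> 'g uea" where
  "uea_incl X = gen (UGen X)"

end

theory Submission
  imports Defs
begin

text \<open>
  The subject is an invariant theory problem. The algebra \<open>W \<otimes> C\<close> is made a module over itself:
  left and right multiplication by the generators combine into operators
  \<open>X\<^sub>i = (x\<^sub>i a + a x\<^sub>i) / 2\<close>, \<open>PX\<^sub>i = [y\<^sub>i, a]\<close> and so on, with fermionic analogues \<open>T\<^sub>i, PT\<^sub>i\<close>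
  built from \<open>e\<^sub>i\<close> and the grading. These satisfy the relations of multiplication and
  differentiation in commuting variables \<open>x\<^sub>i, y\<^sub>i\<close> and anticommuting variables \<open>\<theta>\<^sub>i\<close>, and they
  generate everything from the vacuum \<open>1\<close>. So \<open>W \<otimes> C\<close> behaves like the space of superpolynomials
  in \<open>x, y, \<theta>\<close> (this is the symmetric, or Moyal, ordering), and the eigenvalues of Euler operators
  tell homogeneous components apart. The commutators of an even element with the Dirac operator
  and with the vector variable become the first-order operators \<open>2 \<Sum> y\<^sub>j \<partial>/\<partial>\<theta>\<^sub>j + \<Sum> \<theta>\<^sub>j \<partial>/\<partial>x\<^sub>j\<close>
  and \<open>2 \<Sum> x\<^sub>j \<partial>/\<partial>\<theta>\<^sub>j - \<Sum> \<theta>\<^sub>j \<partial>/\<partial>y\<^sub>j\<close>, which preserve the total degree, and the elements \<open>O\<^sub>i\<^sub>j\<close>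
  have the leading symbols \<open>p\<^sub>i\<^sub>j = x\<^sub>i y\<^sub>j - x\<^sub>j y\<^sub>i + \<theta>\<^sub>i \<theta>\<^sub>j / 2\<close>.

  The heart is a first fundamental theorem for \<open>osp(1|2)\<close>: every even superpolynomial that is
  killed by both operators is a polynomial in the \<open>p\<^sub>i\<^sub>j\<close> (\<open>homogeneous_invariant_moment_poly\<close>).
  Let \<open>f\<close> be such an invariant of total degree \<open>d\<close>, and let \<open>f\<^sub>j\<close> be its component of lowest
  degree \<open>j\<close> in \<open>\<theta>\<close>. The two equations give
  \<open>(d + j) f\<^sub>j = - 4 (\<Sum> x\<^sub>i \<partial>/\<partial>\<theta>\<^sub>i) (\<Sum> y\<^sub>i \<partial>/\<partial>\<theta>\<^sub>i) f\<^bsub>j+2\<^esub>\<close>. The squares of the two operators are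
  in \<open>sl\<^sub>2\<close>, so each component is \<open>sl\<^sub>2\<close>-invariant, and by the classical theorem for \<open>sl\<^sub>2\<close>, which
  the Capelli identity yields by induction on the degree, \<open>f\<^bsub>j+2\<^esub>\<close> is a combination of monomials
  in \<open>\<theta>\<close> with coefficients polynomial in the \<open>x\<^sub>i y\<^sub>j - x\<^sub>j y\<^sub>i\<close>. Finally, for a monomial \<open>u\<close> of
  even degree in \<open>\<theta>\<close>, the Pfaffian of the corresponding submatrix of \<open>p\<close> is a combination of \<open>u\<close>
  and \<open>(\<Sum> x\<^sub>i \<partial>/\<partial>\<theta>\<^sub>i) (\<Sum> y\<^sub>i \<partial>/\<partial>\<theta>\<^sub>i) u\<close> (\<open>pfaffian_moment_poly\<close>). Hence some polynomial in the
  \<open>p\<^sub>i\<^sub>j\<close> has the same lowest component as \<open>f\<close>; it is subtracted, and \<open>j\<close> has grown by two.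

  To return from symbols to \<open>W \<otimes> C\<close>: for \<open>i \<noteq> j\<close> the average of left and right multiplication by
  \<open>O\<^sub>i\<^sub>j\<close> is multiplication by \<open>p\<^sub>i\<^sub>j\<close> plus an operator that lowers the degree by two and
  preserves invariants, so induction on the degree expresses every even invariant through products
  of the \<open>O\<^sub>i\<^sub>j\<close>. The remaining part, that \<open>X\<^sub>i\<^sub>j \<mapsto> O\<^sub>i\<^sub>j\<close> defines a homomorphism into the even
  part of the algebra, follows from the fact that \<open>so(n)\<close> acts by \<open>[O(A), z\<^sub>k] = \<Sum>\<^sub>i A\<^sub>i\<^sub>k z\<^sub>i\<close> in
  the same way on the \<open>x\<close>, the \<open>y\<close> and the \<open>e\<close>.
\<close>

section \<open>Linear maps on complex vector spaces\<close>

lemma scaleC_two: "2 *\<^sub>C (x::'a::complex_vector) = x + x"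
  using scaleC_add_left[of 1 1 x] by (simp add: scaleC_one)

lemma double_zero: "x + x = 0 \<Longrightarrow> x = (0::'a::complex_vector)"
  by (metis complex_vector.scale_eq_0_iff scaleC_two zero_neq_numeral)

lemma scaleC_halves: "(1/2) *\<^sub>C x + (1/2) *\<^sub>C x = (x::'a::complex_vector)"
  by (simp flip: scaleC_two)

lemma scaleC_quarters: "(1/4) *\<^sub>C x + (1/4) *\<^sub>C x = (1/2) *\<^sub>C (x::'a::complex_vector)"
  by (simp flip: scaleC_two)

definition clinear :: "('a::complex_vector \<Rightarrow> 'b::complex_vector) \<Rightarrow> bool" where
  "clinear f \<longleftrightarrow> (\<forall>x y. f (x + y) = f x + f y) \<and> (\<forall>c x. f (c *\<^sub>C x) = c *\<^sub>C f x)"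

lemma clinear_add: "clinear f \<Longrightarrow> f (x + y) = f x + f y"
  and clinear_scale: "clinear f \<Longrightarrow> f (c *\<^sub>C x) = c *\<^sub>C f x"
  by (auto simp: clinear_def)

lemma clinear_zero: "clinear f \<Longrightarrow> f 0 = 0"
  using clinear_scale[of f 0 0] by simp

lemma clinear_uminus: "clinear f \<Longrightarrow> f (- x) = - f x"
  using clinear_scale[of f "- 1" x] by simp

lemma clinear_diff: "clinear f \<Longrightarrow> f (x - y) = f x - f y"
  using clinear_add[of f x "- y"] clinear_uminus[of f y] by simp

lemma clinear_sum: "clinear f \<Longrightarrow> f (sum g I) = (\<Sum>i\<in>I. f (g i))"
  by (induction I rule: infinite_finite_induct) (auto simp: clinear_zero clinear_add)

lemma clinear_scaleC: "clinear (\<lambda>f. c *\<^sub>C f)"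
  by (simp add: clinear_def complex_vector.scale_right_distrib complex_vector.scale_left_commute)

text \<open>Applying \<open>E - a\<close> removes the summand with eigenvalue \<open>a\<close> and rescales the others.\<close>

lemma eigenvectors_independent:
  fixes h :: "nat \<Rightarrow> 'a::complex_vector"
  assumes "clinear E" "finite I" "\<And>d. d \<in> I \<Longrightarrow> E (h d) = of_nat d *\<^sub>C h d" "sum h I = 0" "d \<in> I"
  shows "h d = 0"
  using assms(2-5)
proof (induction I arbitrary: h d rule: finite_induct)
  case empty
  then show ?case by simp
next
  case (insert a I)
  have "0 = E (sum h (insert a I)) - of_nat a *\<^sub>C sum h (insert a I)"
    using insert.prems(2) by (simp add: clinear_zero[OF assms(1)])
  also have "\<dots> = (\<Sum>d\<in>I. (of_nat d - of_nat a) *\<^sub>C h d)"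
    using insert.hyps insert.prems(1)
    by (simp add: clinear_sum[OF assms(1)] clinear_add[OF assms(1)] complex_vector.scale_sum_right
        complex_vector.scale_left_diff_distrib sum_subtractf complex_vector.scale_right_distrib)
  finally have s: "(\<Sum>d\<in>I. (of_nat d - of_nat a) *\<^sub>C h d) = 0" ..
  have z: "h d = 0" if "d \<in> I" for d
  proof -
    have "(of_nat d - of_nat a) *\<^sub>C h d = 0"
      by (rule insert.IH[OF _ s that])
         (simp add: insert.prems(1) clinear_scale[OF assms(1)] complex_vector.scale_left_commute)
    moreover have "d \<noteq> a" using that insert.hyps by auto
    ultimately show ?thesis by simp
  qed
  then have "h a = 0" using insert.prems(2) insert.hyps by simp
  with z insert.prems(3) show ?case by auto
qed

section \<open>A Fock space with two bosons and one fermion per index\<close>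

text \<open>
  \<open>X, Y, T\<close> are multiplications by commuting variables \<open>x\<^sub>i, y\<^sub>i\<close> and anticommuting variables
  \<open>\<theta>\<^sub>i\<close>; \<open>PX, PY, PT\<close> are the partial derivatives; \<open>par\<close> is the parity in \<open>\<theta>\<close>. The last assumption
  says that the operators \<open>X - PY / 2\<close>, \<open>Y + PX / 2\<close> and \<open>T + PT\<close> generate the whole space from
  the vacuum. It has this form because these combinations are the left multiplications in the
  algebra to which the locale is applied.
\<close>

locale superfock =
  fixes X Y T PX PY PT :: "'n::finite \<Rightarrow> 's::complex_vector \<Rightarrow> 's"
    and par :: "'s \<Rightarrow> 's" and vac :: 's
  assumes lin: "clinear (X i)" "clinear (Y i)" "clinear (T i)"
      "clinear (PX i)" "clinear (PY i)" "clinear (PT i)" "clinear par"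
    and ccr: "PX i (X j f) = X j (PX i f) + (if i = j then f else 0)"
      "PY i (Y j f) = Y j (PY i f) + (if i = j then f else 0)"
      "PT i (T j f) = (if i = j then f else 0) - T j (PT i f)"
    and mixed: "PX i (Y j f) = Y j (PX i f)" "PX i (T j f) = T j (PX i f)"
      "PY i (X j f) = X j (PY i f)" "PY i (T j f) = T j (PY i f)"
      "PT i (X j f) = X j (PT i f)" "PT i (Y j f) = Y j (PT i f)"
      "Y i (X j f) = X j (Y i f)" "T i (X j f) = X j (T i f)" "T i (Y j f) = Y j (T i f)"
      "PY i (PX j f) = PX j (PY i f)" "PT i (PX j f) = PX j (PT i f)"
      "PT i (PY j f) = PY j (PT i f)"
    and comm: "X i (X j f) = X j (X i f)" "Y i (Y j f) = Y j (Y i f)"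
      "PX i (PX j f) = PX j (PX i f)" "PY i (PY j f) = PY j (PY i f)"
    and anti_T: "T i (T j f) = - T j (T i f)"
    and anti_PT: "PT i (PT j f) = - PT j (PT i f)"
    and par: "par (X i f) = X i (par f)" "par (Y i f) = Y i (par f)" "par (T i f) = - T i (par f)"
      "par vac = vac"
    and vac: "PX i vac = 0" "PY i vac = 0" "PT i vac = 0"
    and cyclic: "P vac \<Longrightarrow> (\<And>f g. P f \<Longrightarrow> P g \<Longrightarrow> P (f + g)) \<Longrightarrow> (\<And>c f. P f \<Longrightarrow> P (c *\<^sub>C f)) \<Longrightarrow>
      (\<And>i f. P f \<Longrightarrow> P (X i f + (- 1/2) *\<^sub>C PY i f)) \<Longrightarrow> (\<And>i f. P f \<Longrightarrow> P (Y i f + (1/2) *\<^sub>C PX i f)) \<Longrightarrow>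
      (\<And>i f. P f \<Longrightarrow> P (T i f + PT i f)) \<Longrightarrow> P f"
begin

lemmas lin_simps =
  lin[THEN clinear_add] lin[THEN clinear_scale] lin[THEN clinear_zero] lin[THEN clinear_uminus]
  lin[THEN clinear_diff] lin[THEN clinear_sum]

lemmas relations = ccr mixed

text \<open>
  These nine operators span the copy of \<open>gl(2|1)\<close> that commutes with linear substitutions of the
  index; \<open>sl2_yx\<close>, \<open>sl2_xy\<close> and \<open>euler_x - euler_y\<close> span its \<open>sl\<^sub>2\<close>.
\<close>

definition "contract_y f = (\<Sum>j\<in>UNIV. Y j (PT j f))"
definition "contract_x f = (\<Sum>j\<in>UNIV. X j (PT j f))"
definition "polar_x f = (\<Sum>j\<in>UNIV. T j (PX j f))"
definition "polar_y f = (\<Sum>j\<in>UNIV. T j (PY j f))"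
definition "sl2_yx f = (\<Sum>j\<in>UNIV. Y j (PX j f))"
definition "sl2_xy f = (\<Sum>j\<in>UNIV. X j (PY j f))"
definition "euler_x f = (\<Sum>j\<in>UNIV. X j (PX j f))"
definition "euler_y f = (\<Sum>j\<in>UNIV. Y j (PY j f))"
definition "euler_T f = (\<Sum>j\<in>UNIV. T j (PT j f))"

lemmas op_defs = contract_y_def
  contract_x_def polar_x_def polar_y_def sl2_yx_def sl2_xy_def euler_x_def euler_y_def euler_T_def

lemma lin_ops: "clinear contract_y" "clinear contract_x" "clinear polar_x" "clinear polar_y"
  "clinear sl2_yx" "clinear sl2_xy"
  "clinear euler_x" "clinear euler_y" "clinear euler_T"
  by (simp_all add: clinear_def op_defs lin_simps sum.distrib complex_vector.scale_sum_right)

lemmas lin_ops_simps =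
  lin_ops[THEN clinear_add] lin_ops[THEN clinear_scale] lin_ops[THEN clinear_zero]
    lin_ops[THEN clinear_uminus]
  lin_ops[THEN clinear_diff] lin_ops[THEN clinear_sum]

lemma if_zero: "clinear F \<Longrightarrow> F (if P then f else 0) = (if P then F f else 0)"
  by (simp add: clinear_zero)

lemmas if_simps = lin[THEN if_zero]

text \<open>
  Commutators with the basic operators. They let all later computations treat the nine operators
  as derivations, without opening double sums.
\<close>

lemma contract_y_relations: "contract_y (X i f) = X i (contract_y f)"
  "contract_y (Y i f) = Y i (contract_y f)" "contract_y (T i f) = Y i f - T i (contract_y f)"
  "contract_y (PX i f) = PX i (contract_y f)" "contract_y (PY i f) = PY i (contract_y f) - PT i f"
  "contract_y (PT i f) = - PT i (contract_y f)"
  by (simp_all add: contract_y_def lin_simps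
    relations comm if_simps sum.distrib sum_subtractf sum_negf
      anti_PT[of _ i])

lemma contract_x_relations: "contract_x (X i f) = X i (contract_x f)"
  "contract_x (Y i f) = Y i (contract_x f)" "contract_x (T i f) = X i f - T i (contract_x f)"
  "contract_x (PX i f) = PX i (contract_x f) - PT i f" "contract_x (PY i f) = PY i (contract_x f)"
  "contract_x (PT i f) = - PT i (contract_x f)"
  by (simp_all add: contract_x_def lin_simps
    relations comm if_simps sum.distrib sum_subtractf sum_negf
      anti_PT[of _ i])

lemma polar_x_relations: "polar_x (X i f) = X i (polar_x f) + T i f"
  "polar_x (Y i f) = Y i (polar_x f)" "polar_x (T i f) = - T i (polar_x f)"
  "polar_x (PX i f) = PX i (polar_x f)" "polar_x (PY i f) = PY i (polar_x f)"
  "polar_x (PT i f) = PX i f - PT i (polar_x f)"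
  by (simp_all add: polar_x_def lin_simps relations comm if_simps sum.distrib sum_subtractf sum_negf
      anti_T[of _ i])

lemma polar_y_relations: "polar_y (X i f) = X i (polar_y f)"
  "polar_y (Y i f) = Y i (polar_y f) + T i f" "polar_y (T i f) = - T i (polar_y f)"
  "polar_y (PX i f) = PX i (polar_y f)" "polar_y (PY i f) = PY i (polar_y f)"
  "polar_y (PT i f) = PY i f - PT i (polar_y f)"
  by (simp_all add: polar_y_def lin_simps relations comm if_simps sum.distrib sum_subtractf sum_negf
      anti_T[of _ i])

lemma sl2_yx_relations: "sl2_yx (X i f) = X i (sl2_yx f) + Y i f" "sl2_yx (Y i f) = Y i (sl2_yx f)"
  "sl2_yx (T i f) = T i (sl2_yx f)"
  "sl2_yx (PX i f) = PX i (sl2_yx f)" "sl2_yx (PY i f) = PY i (sl2_yx f) - PX i f"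
  "sl2_yx (PT i f) = PT i (sl2_yx f)"
  by (simp_all add: sl2_yx_def lin_simps relations comm if_simps sum.distrib sum_subtractf sum_negf)

lemma sl2_xy_relations: "sl2_xy (X i f) = X i (sl2_xy f)" "sl2_xy (Y i f) = Y i (sl2_xy f) + X i f"
  "sl2_xy (T i f) = T i (sl2_xy f)"
  "sl2_xy (PX i f) = PX i (sl2_xy f) - PY i f" "sl2_xy (PY i f) = PY i (sl2_xy f)"
  "sl2_xy (PT i f) = PT i (sl2_xy f)"
  by (simp_all add: sl2_xy_def lin_simps relations comm if_simps sum.distrib sum_subtractf sum_negf)

lemma euler_x_relations: "euler_x (X i f) = X i (euler_x f) + X i f"
  "euler_x (Y i f) = Y i (euler_x f)" "euler_x (T i f) = T i (euler_x f)"
  "euler_x (PX i f) = PX i (euler_x f) - PX i f" "euler_x (PY i f) = PY i (euler_x f)"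
  "euler_x (PT i f) = PT i (euler_x f)"
  by (simp_all add: euler_x_def lin_simps
    relations comm if_simps sum.distrib sum_subtractf sum_negf)

lemma euler_y_relations: "euler_y (X i f) = X i (euler_y f)"
  "euler_y (Y i f) = Y i (euler_y f) + Y i f" "euler_y (T i f) = T i (euler_y f)"
  "euler_y (PX i f) = PX i (euler_y f)" "euler_y (PY i f) = PY i (euler_y f) - PY i f"
  "euler_y (PT i f) = PT i (euler_y f)"
  by (simp_all add: euler_y_def lin_simps
    relations comm if_simps sum.distrib sum_subtractf sum_negf)

lemma euler_T_relations: "euler_T (X i f) = X i (euler_T f)" "euler_T (Y i f) = Y i (euler_T f)"
  "euler_T (T i f) = T i (euler_T f) + T i f"
  "euler_T (PX i f) = PX i (euler_T f)" "euler_T (PY i f) = PY i (euler_T f)"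
  "euler_T (PT i f) = PT i (euler_T f) - PT i f"
  by (simp_all add: euler_T_def lin_simps relations comm if_simps sum.distrib sum_subtractf sum_negf
      anti_T[of _ i] anti_PT[of _ i])

text \<open>
  Each operator anticommutes with the summands' odd factor and commutes with the even one, so
  moving it through its own definition yields the negative of its square.
\<close>

lemma ladder_squares: "contract_y (contract_y f) = 0" "contract_x (contract_x f) = 0"
  "polar_x (polar_x f) = 0" "polar_y (polar_y f) = 0"
proof -
  have "contract_y (contract_y f) = - contract_y (contract_y f)"
    by (subst (2) contract_y_def, simp add: lin_ops_simps contract_y_relations lin_simps sum_negf)
      (simp add: contract_y_def)
  moreover have "contract_x (contract_x f) = - contract_x (contract_x f)"
    by (subst (2) contract_x_def, simp add: lin_ops_simps contract_x_relations lin_simps sum_negf)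
      (simp add: contract_x_def)
  moreover have "polar_x (polar_x f) = - polar_x (polar_x f)"
    by (subst (2) polar_x_def, simp add: lin_ops_simps polar_x_relations lin_simps sum_negf)
      (simp add: polar_x_def)
  moreover have "polar_y (polar_y f) = - polar_y (polar_y f)"
    by (subst (2) polar_y_def, simp add: lin_ops_simps polar_y_relations lin_simps sum_negf)
      (simp add: polar_y_def)
  ultimately show "contract_y (contract_y f) = 0" "contract_x (contract_x f) = 0"
    "polar_x (polar_x f) = 0" "polar_y (polar_y f) = 0"
    by (metis add.right_inverse double_zero)+
qed

lemma ladder_anticommutators:
  "contract_y (contract_x f) = - contract_x (contract_y f)"
  "polar_x (polar_y f) = - polar_y (polar_x f)"
  "contract_y (polar_x f) = sl2_yx f - polar_x (contract_y f)"
  "contract_x (polar_y f) = sl2_xy f - polar_y (contract_x f)"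
  "contract_x (polar_x f) = euler_x f + euler_T f - polar_x (contract_x f)"
  "contract_y (polar_y f) = euler_y f + euler_T f - polar_y (contract_y f)"
proof -
  show "contract_y (contract_x f) = - contract_x (contract_y f)" unfolding contract_x_def
    by (simp add: lin_ops_simps lin_simps contract_y_relations sum_negf)
  show "polar_x (polar_y f) = - polar_y (polar_x f)" unfolding polar_y_def
    by (simp add: lin_ops_simps lin_simps polar_x_relations sum_negf)
  show "contract_y (polar_x f) = sl2_yx f - polar_x (contract_y f)" unfolding polar_x_def sl2_yx_def
    by (simp add: lin_ops_simps lin_simps contract_y_relations sum_subtractf)
  show "contract_x (polar_y f) = sl2_xy f - polar_y (contract_x f)" unfolding polar_y_def sl2_xy_def
    by (simp add: lin_ops_simps lin_simps contract_x_relations sum_subtractf)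
  show "contract_x (polar_x f) = euler_x f + euler_T f - polar_x (contract_x f)"
    unfolding polar_x_def euler_x_def euler_T_def
    by (simp add: lin_ops_simps lin_simps
      contract_x_relations sum_subtractf sum.distrib algebra_simps)
  show "contract_y (polar_y f) = euler_y f + euler_T f - polar_y (contract_y f)"
    unfolding polar_y_def euler_y_def euler_T_def
    by (simp add: lin_ops_simps lin_simps
      contract_y_relations sum_subtractf sum.distrib algebra_simps)
qed

text \<open>
  The commutators with the Dirac operator and with the vector variable on even elements. The
  factor 2 arises because left minus right multiplication by \<open>y\<^sub>j e\<^sub>j\<close> doubles the symbol part
  \<open>Y\<^sub>j PT\<^sub>j\<close>.
\<close>

definition "ad_dirac f = 2 *\<^sub>C contract_y f + polar_x f"
definition "ad_vector f = 2 *\<^sub>C contract_x f - polar_y f"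

lemma lin_ad: "clinear ad_dirac" "clinear ad_vector"
  by (auto simp: clinear_def ad_dirac_def ad_vector_def lin_ops_simps
    complex_vector.scale_right_distrib
      complex_vector.scale_right_diff_distrib complex_vector.scale_left_commute)

text \<open>An invariant of the two odd operators is thereby an invariant of \<open>sl\<^sub>2\<close>.\<close>

lemma osp_relations:
  "ad_dirac (ad_dirac f) = 2 *\<^sub>C sl2_yx f" "ad_vector (ad_vector f) = - 2 *\<^sub>C sl2_xy f"
  "ad_dirac (ad_vector f) + ad_vector (ad_dirac f) = 2 *\<^sub>C (euler_x f - euler_y f)"
  by (simp_all add: ad_dirac_def ad_vector_def
    lin_ops_simps ladder_squares ladder_anticommutators scaleC_two
      complex_vector.scale_right_distrib complex_vector.scale_right_diff_distrib)

text \<open>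
  \<open>moment i j\<close> is multiplication by the leading symbol of \<open>O\<^sub>i\<^sub>j\<close>; its part without \<open>\<theta>\<close> is a
  Pluecker coordinate of the pair \<open>x, y\<close>.
\<close>

definition "plucker i j f = X i (Y j f) - X j (Y i f)"
definition "moment i j f = plucker i j f + (1/2) *\<^sub>C T i (T j f)"

lemma lin_moment: "clinear (plucker i j)" "clinear (moment i j)"
  by (auto simp: clinear_def plucker_def moment_def lin_simps complex_vector.scale_right_distrib
      complex_vector.scale_right_diff_distrib complex_vector.scale_left_commute)

lemma ad_moment: "ad_dirac (moment i j f) = moment i j (ad_dirac f)"
  "ad_vector (moment i j f) = moment i j (ad_vector f)"
  by (simp_all add: ad_dirac_def ad_vector_def moment_def plucker_def lin_ops_simps lin_simps
    contract_y_relations contract_x_relations polar_x_relations polar_y_relations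
    complex_vector.scale_right_distrib complex_vector.scale_right_diff_distrib
      relations anti_T[of j i] algebra_simps)

section \<open>The bigrading\<close>

text \<open>
  \<open>bideg d k\<close> is the span of words of total length \<open>d\<close> in \<open>X, Y, T\<close> with \<open>k\<close> letters \<open>T\<close>. Counting
  the total degree, instead of the number of bosons, makes it the quantity preserved by \<open>ad_dirac\<close>
  and \<open>ad_vector\<close>.
\<close>

inductive bideg :: "nat \<Rightarrow> nat \<Rightarrow> 's \<Rightarrow> bool" where
  bideg_zero: "bideg d k 0"
| bideg_add: "bideg d k f \<Longrightarrow> bideg d k g \<Longrightarrow> bideg d k (f + g)"
| bideg_scale: "bideg d k f \<Longrightarrow> bideg d k (c *\<^sub>C f)"
| bideg_vac: "bideg 0 0 vac"
| bideg_X: "bideg d k f \<Longrightarrow> bideg (Suc d) k (X i f)"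
| bideg_Y: "bideg d k f \<Longrightarrow> bideg (Suc d) k (Y i f)"
| bideg_T: "bideg d k f \<Longrightarrow> bideg (Suc d) (Suc k) (T i f)"

lemma bideg_uminus: "bideg d k f \<Longrightarrow> bideg d k (- f)"
  using bideg_scale[of d k f "- 1"] by simp

lemma bideg_diff: "bideg d k f \<Longrightarrow> bideg d k g \<Longrightarrow> bideg d k (f - g)"
  using bideg_add[of d k f "- g"] bideg_uminus by simp

lemma bideg_sum: "(\<And>i. i \<in> I \<Longrightarrow> bideg d k (f i)) \<Longrightarrow> bideg d k (sum f I)"
  by (induction I rule: infinite_finite_induct) (auto intro: bideg_zero bideg_add)

lemma bideg_trivial: "bideg d k f \<Longrightarrow> d < k \<Longrightarrow> f = 0"
  by (induction rule: bideg.induct) (auto simp: lin_simps)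

lemma bideg_zero_zero: "bideg d k f \<Longrightarrow> d = 0 \<Longrightarrow> \<exists>c. f = c *\<^sub>C vac"
proof (induction rule: bideg.induct)
  case (bideg_zero d k) show ?case by (rule exI[of _ 0]) simp
next
  case (bideg_add d k f g) then show ?case by (metis complex_vector.scale_left_distrib)
next
  case (bideg_scale d k f c) then show ?case by (metis scaleC_scaleC)
next
  case bideg_vac show ?case by (rule exI[of _ 1]) simp
qed simp_all

text \<open>
  The Euler operators have \<open>d\<close> and \<open>k\<close> as eigenvalues on \<open>bideg d k\<close>. Vectors with distinct
  eigenvalues are independent, so this separates homogeneous components.
\<close>

definition "euler f = euler_x f + euler_y f + euler_T f"

lemma lin_euler: "clinear euler"
  by (simp add: clinear_def euler_def lin_ops_simps
    complex_vector.scale_right_distrib algebra_simps)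

lemma euler_relations: "euler (X i f) = X i (euler f) + X i f"
  "euler (Y i f) = Y i (euler f) + Y i f" "euler (T i f) = T i (euler f) + T i f"
  by (simp_all add: euler_def euler_x_relations
    euler_y_relations euler_T_relations lin_simps algebra_simps)

lemma bideg_eigen:
  "bideg d k f \<Longrightarrow> euler_T f = of_nat k *\<^sub>C f \<and> euler f = of_nat d *\<^sub>C f \<and> par f = (- 1) ^ k *\<^sub>C f"
proof (induction rule: bideg.induct)
  case bideg_vac
  show ?case by (simp add: euler_def euler_T_def euler_x_def euler_y_def vac lin_simps par)
qed (simp_all add: lin_euler[THEN clinear_zero] lin_euler[THEN clinear_add]
  lin_euler[THEN clinear_scale]
    lin_ops_simps lin_simps euler_T_relations euler_relations par
      complex_vector.scale_right_distrib complex_vector.scale_left_distrib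
    mult.commute add.commute)

text \<open>
  Derivatives vanish where there is nothing left to differentiate. These boundary cases are stated
  apart because subtraction on natural numbers truncates.
\<close>

lemma annihilate_bottom:
  "bideg d k f \<Longrightarrow> d \<le> k \<Longrightarrow> PX i f = 0 \<and> PY i f = 0"
proof (induction rule: bideg.induct)
  case (bideg_X d k f j)
  then have "f = 0" using bideg_trivial by auto
  then show ?case by (simp add: lin_simps)
next
  case (bideg_Y d k f j)
  then have "f = 0" using bideg_trivial by auto
  then show ?case by (simp add: lin_simps)
qed (simp_all add: lin_simps vac relations)

lemma annihilate_bottom_PT: "bideg d k f \<Longrightarrow> k = 0 \<Longrightarrow> PT i f = 0"
  by (induction rule: bideg.induct) (simp_all add: lin_simps vac relations)

lemma bideg_PXY: "bideg d' k f \<Longrightarrow> d' = Suc d \<Longrightarrow> bideg d k (PX i f) \<and> bideg d k (PY i f)"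
proof (induction arbitrary: d rule: bideg.induct)
  case (bideg_X d' k f j)
  have "bideg d k (X j (PX i f)) \<and> bideg d k (X j (PY i f))"
  proof (cases d')
    case 0
    then show ?thesis
      using annihilate_bottom[OF bideg_X.hyps] by (simp add: lin_simps bideg.bideg_zero)
  next
    case (Suc e)
    then show ?thesis using bideg_X.IH[of e] bideg_X.prems by (auto intro: bideg.bideg_X)
  qed
  then show ?case using bideg_X by (auto simp: relations intro: bideg.intros)
next
  case (bideg_Y d' k f j)
  have "bideg d k (Y j (PX i f)) \<and> bideg d k (Y j (PY i f))"
  proof (cases d')
    case 0
    then show ?thesis
      using annihilate_bottom[OF bideg_Y.hyps] by (simp add: lin_simps bideg.bideg_zero)
  next
    case (Suc e)
    then show ?thesis using bideg_Y.IH[of e] bideg_Y.prems by (auto intro: bideg.bideg_Y)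
  qed
  then show ?case using bideg_Y by (auto simp: relations intro: bideg.intros)
next
  case (bideg_T d' k f j)
  have "bideg d (Suc k) (T j (PX i f)) \<and> bideg d (Suc k) (T j (PY i f))"
  proof (cases d')
    case 0
    then show ?thesis
      using annihilate_bottom[OF bideg_T.hyps] by (simp add: lin_simps bideg.bideg_zero)
  next
    case (Suc e)
    then show ?thesis using bideg_T.IH[of e] bideg_T.prems by (auto intro: bideg.bideg_T)
  qed
  then show ?case by (auto simp: relations)
qed (auto simp: lin_simps intro: bideg.intros)

lemma bideg_PT: "bideg d' k' f \<Longrightarrow> d' = Suc d \<Longrightarrow> k' = Suc k \<Longrightarrow> bideg d k (PT i f)"
proof (induction arbitrary: d k rule: bideg.induct)
  case (bideg_X d' k' f j)
  have "bideg d k (X j (PT i f))"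
  proof (cases d')
    case 0
    then show ?thesis using bideg_trivial[OF bideg_X.hyps] bideg_X.prems
      by (simp add: lin_simps bideg.bideg_zero)
  next
    case (Suc e)
    then show ?thesis using bideg_X.IH[of e k] bideg_X.prems by (auto intro: bideg.bideg_X)
  qed
  then show ?case by (auto simp: relations)
next
  case (bideg_Y d' k' f j)
  have "bideg d k (Y j (PT i f))"
  proof (cases d')
    case 0
    then show ?thesis using bideg_trivial[OF bideg_Y.hyps] bideg_Y.prems
      by (simp add: lin_simps bideg.bideg_zero)
  next
    case (Suc e)
    then show ?thesis using bideg_Y.IH[of e k] bideg_Y.prems by (auto intro: bideg.bideg_Y)
  qed
  then show ?case by (auto simp: relations)
next
  case (bideg_T d' k' f j)
  have "bideg d k (T j (PT i f))"
  proof (cases k')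
    case 0
    then show ?thesis
      using annihilate_bottom_PT[OF bideg_T.hyps] by (simp add: lin_simps bideg.bideg_zero)
  next
    case (Suc e)
    show ?thesis
    proof (cases d')
      case 0
      then show ?thesis using bideg_trivial[OF bideg_T.hyps] Suc
        by (simp add: lin_simps bideg.bideg_zero)
    next
      case (Suc l)
      then show ?thesis using bideg_T.IH[of l e] bideg_T.prems \<open>k' = Suc e\<close>
        by (auto intro: bideg.bideg_T)
    qed
  qed
  then show ?case using bideg_T
    by (auto simp: relations intro: bideg.intros bideg_diff bideg_uminus)
qed (auto simp: lin_simps intro: bideg.intros)

lemma bideg_quadratic:
  assumes "bideg d k f"
  shows "bideg d k (X i (PX j f))" "bideg d k (X i (PY j f))" "bideg d k (Y i (PX j f))"
    "bideg d k (Y i (PY j f))"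
    "bideg d (Suc k) (T i (PX j f))" "bideg d (Suc k) (T i (PY j f))"
proof -
  have "bideg d k (X i (PX j f)) \<and> bideg d k (X i (PY j f)) \<and> bideg d k (Y i (PX j f))
    \<and> bideg d k (Y i (PY j f)) \<and>
    bideg d (Suc k) (T i (PX j f)) \<and> bideg d (Suc k) (T i (PY j f))"
  proof (cases d)
    case 0
    then show ?thesis using annihilate_bottom[OF assms] by (simp add: lin_simps bideg_zero)
  next
    case (Suc e)
    then show ?thesis using bideg_PXY[OF assms, of e] by (simp add: bideg_X bideg_Y bideg_T)
  qed
  then show "bideg d k (X i (PX j f))" "bideg d k (X i (PY j f))" "bideg d k (Y i (PX j f))"
    "bideg d k (Y i (PY j f))"
    "bideg d (Suc k) (T i (PX j f))" "bideg d (Suc k) (T i (PY j f))" by auto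
qed

lemma bideg_lower:
  assumes "bideg d (Suc k) f"
  shows "bideg d k (X i (PT j f))" "bideg d k (Y i (PT j f))"
proof -
  have "bideg d k (X i (PT j f)) \<and> bideg d k (Y i (PT j f))"
  proof (cases d)
    case 0
    then show ?thesis using bideg_trivial[OF assms] by (simp add: lin_simps bideg_zero)
  next
    case (Suc e)
    then show ?thesis using bideg_PT[OF assms, of e k] by (simp add: bideg_X bideg_Y)
  qed
  then show "bideg d k (X i (PT j f))" "bideg d k (Y i (PT j f))" by auto
qed

lemma bideg_ladder:
  "bideg d (Suc k) f \<Longrightarrow> bideg d k (contract_y f)" "bideg d (Suc k) f \<Longrightarrow> bideg d k (contract_x f)"
  "bideg d k f \<Longrightarrow> bideg d (Suc k) (polar_x f)" "bideg d k f \<Longrightarrow> bideg d (Suc k) (polar_y f)"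
  "bideg d k f \<Longrightarrow> bideg d k (sl2_yx f)" "bideg d k f \<Longrightarrow> bideg d k (sl2_xy f)"
  "bideg d k f \<Longrightarrow> bideg d k (euler_x f)" "bideg d k f \<Longrightarrow> bideg d k (euler_y f)"
  by (auto simp: op_defs intro!: bideg_sum bideg_lower bideg_quadratic)

lemma ladder_bottom: "bideg d 0 f \<Longrightarrow> contract_y f = 0" "bideg d 0 f \<Longrightarrow> contract_x f = 0"
  by (auto simp: contract_y_def contract_x_def annihilate_bottom_PT lin_simps)

lemma bideg_plucker: "bideg d k f \<Longrightarrow> bideg (d + 2) k (plucker i j f)"
  by (auto simp: plucker_def intro!: bideg_diff bideg.intros)

section \<open>The first fundamental theorem for sl(2)\<close>

text \<open>
  The elements obtained from monomials in \<open>\<theta>\<close> (the base, where the total degree equals the degree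
  in \<open>\<theta>\<close>) by multiplication with Pluecker coordinates: the bracket algebra of \<open>x, y\<close> with
  coefficients in the exterior algebra.
\<close>

inductive bracket :: "nat \<Rightarrow> nat \<Rightarrow> 's \<Rightarrow> bool" where
  bracket_zero: "bracket d k 0"
| bracket_add: "bracket d k f \<Longrightarrow> bracket d k g \<Longrightarrow> bracket d k (f + g)"
| bracket_scale: "bracket d k f \<Longrightarrow> bracket d k (c *\<^sub>C f)"
| bracket_base: "bideg k k f \<Longrightarrow> bracket k k f"
| bracket_plucker: "bracket d k f \<Longrightarrow> bracket (d + 2) k (plucker i j f)"

lemma bracket_sum: "(\<And>i. i \<in> I \<Longrightarrow> bracket d k (f i)) \<Longrightarrow> bracket d k (sum f I)"
  by (induction I rule: infinite_finite_induct) (auto intro: bracket_zero bracket_add)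

lemma bracket_bideg: "bracket d k f \<Longrightarrow> bideg d k f"
  by (induction rule: bracket.induct)
    (simp_all only: bideg_zero bideg_add bideg_scale bideg_plucker)

text \<open>Cayley's \<open>\<Omega>\<close>-operator on the columns \<open>i, j\<close>.\<close>

definition "cayley i j f = PX i (PY j f) - PX j (PY i f)"

lemma cayley_sl2: "sl2_yx (cayley i j f) = cayley i j (sl2_yx f)"
  "sl2_xy (cayley i j f) = cayley i j (sl2_xy f)"
  "euler_x (cayley i j f) = cayley i j (euler_x f) - cayley i j f"
  "euler_y (cayley i j f) = cayley i j (euler_y f) - cayley i j f"
  by (simp_all add: cayley_def sl2_yx_relations sl2_xy_relations euler_x_relations
    euler_y_relations lin_ops_simps lin_simps comm relations)

text \<open>
  The Capelli identity for two vectors. The term \<open>euler_x\<close> is the correction from moving \<open>PY\<^sub>i\<close>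
  past \<open>Y\<^sub>j\<close> when the operators are put into normal order.
\<close>

lemma capelli:
  "(\<Sum>i\<in>UNIV. \<Sum>j\<in>UNIV. plucker i j (cayley i j f))
  = 2 *\<^sub>C (euler_x (euler_y f) + euler_x f - sl2_xy (sl2_yx f))"
proof -
  let ?S = "\<Sum>i\<in>UNIV. \<Sum>j\<in>UNIV. X i (Y j (cayley i j f))"
  have cayley_flip: "cayley j i f = - cayley i j f" for i j by (simp add: cayley_def)
  have "(\<Sum>i\<in>UNIV. \<Sum>j\<in>UNIV. X j (Y i (cayley i j f))) = (\<Sum>i\<in>UNIV. \<Sum>j\<in>UNIV. X i (Y j (cayley j i f)))"
    by (rule sum.swap)
  also have "\<dots> = (\<Sum>i\<in>UNIV. \<Sum>j\<in>UNIV. - X i (Y j (cayley i j f)))"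
    by (intro sum.cong refl) (subst cayley_flip, simp add: lin_simps)
  also have "\<dots> = - ?S" by (simp add: sum_negf)
  finally have 1: "(\<Sum>i\<in>UNIV. \<Sum>j\<in>UNIV. plucker i j (cayley i j f)) = 2 *\<^sub>C ?S"
    by (simp add: plucker_def sum_subtractf scaleC_two)
  have 2: "euler_x (euler_y f) = (\<Sum>i\<in>UNIV. \<Sum>j\<in>UNIV. X i (Y j (PX i (PY j f))))"
    by (simp add: euler_x_def euler_y_def lin_simps relations)
  have 3: "sl2_xy (sl2_yx f) = (\<Sum>i\<in>UNIV. \<Sum>j\<in>UNIV. X i (Y j (PX j (PY i f)))) + euler_x f"
    by (simp add: sl2_xy_def sl2_yx_def euler_x_def lin_simps relations if_simps sum.distrib)
  show ?thesis unfolding 1 2 3 by (simp add: cayley_def lin_simps sum_subtractf)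
qed

text \<open>
  On an \<open>sl\<^sub>2\<close>-invariant of degree \<open>m\<close> in each of \<open>x\<close> and \<open>y\<close> the right-hand side of the Capelli
  identity is \<open>2 m (m + 1)\<close> times the invariant, which is nonzero for positive degree. So the
  invariant is a combination of Pluecker coordinates times its images under the \<open>\<Omega>\<close>-operators, and
  these are invariants of lower degree.
\<close>

lemma sl2_invariants_bracket:
  "bideg d k g \<Longrightarrow> sl2_yx g = 0 \<Longrightarrow> euler_x g = euler_y g \<Longrightarrow> sl2_xy g = 0 \<Longrightarrow> bracket d k g"
proof (induction d arbitrary: g rule: less_induct)
  case (less d)
  consider "d < k" | "d = k" | "d > k" by linarith
  then show ?case
  proof cases
    case 1
    then show ?thesis using bideg_trivial[OF less.prems(1)] by (simp add: bracket_zero)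
  next
    case 2
    then show ?thesis using less.prems(1) by (auto intro: bracket_base)
  next
    case 3
    \<comment> \<open>The common degree in \<open>x\<close> and in \<open>y\<close>, taken as a complex number because \<open>d - k\<close> might be odd.\<close>
    define m :: complex where "m = of_nat (d - k) / 2"
    have m: "m \<noteq> 0" "m + 1 \<noteq> 0"
    proof -
      show "m \<noteq> 0" using 3 by (simp add: m_def)
      have "Re (m + 1) > 0" by (simp add: m_def)
      then show "m + 1 \<noteq> 0" by force
    qed
    have T_deg: "euler_T g = of_nat k *\<^sub>C g" and total: "euler_x g + euler_y g + euler_T g
      = of_nat d *\<^sub>C g"
      using bideg_eigen[OF less.prems(1)] unfolding euler_def by blast+
    have "euler_x g + euler_y g = of_nat (d - k) *\<^sub>C g"
      using total[unfolded T_deg] 3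
      by (simp add: of_nat_diff complex_vector.scale_left_diff_distrib eq_diff_eq)
    then have twice: "2 *\<^sub>C euler_x g = (2 * m) *\<^sub>C g" using less.prems(3)
      by (simp add: m_def scaleC_two)
    have x_deg: "euler_x g = m *\<^sub>C g"
      using arg_cong[OF twice, of "\<lambda>z. (1/2) *\<^sub>C z"] by simp
    have cayley_zero: "cayley i j 0 = 0" for i j by (simp add: cayley_def lin_simps)
    have in_bracket: "bracket d k (plucker i j (cayley i j g))" for i j
    proof (cases "d \<ge> 2")
      case True
      then obtain e where e: "d = Suc (Suc e)" by (metis add_2_eq_Suc le_Suc_ex)
      have "bideg e k (cayley i j g)"
        unfolding cayley_def
        using bideg_PXY[OF less.prems(1) e] bideg_PXY by (blast intro: bideg_diff)
      then have "bracket e k (cayley i j g)"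
        using e less.prems cayley_zero by (intro less.IH) (auto simp: cayley_sl2)
      then show ?thesis using bracket_plucker[of e k "cayley i j g" i j] e by simp
    next
      case False
      \<comment> \<open>In degree one a second-order operator vanishes, and so does the invariant.\<close>
      then have e: "d = Suc 0" "k = 0" using 3 by auto
      then have "bideg 0 0 (PY i g)" for i using bideg_PXY[OF less.prems(1)] by auto
      then have "cayley i j g = 0" using annihilate_bottom[of 0 0] by (auto simp: cayley_def)
      then show ?thesis by (simp add: plucker_def lin_simps bracket_zero)
    qed
    have y_deg: "euler_y g = m *\<^sub>C g" using x_deg less.prems(3) by simp
    have "euler_x (euler_y g) + euler_x g - sl2_xy (sl2_yx g) = (m * (m + 1)) *\<^sub>C g"
      unfolding y_deg less.prems(2)
      by (simp add: lin_ops_simps x_deg distrib_left complex_vector.scale_left_distrib)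
    then have "(\<Sum>i\<in>UNIV. \<Sum>j\<in>UNIV. plucker i j (cayley i j g)) = (2 * (m * (m + 1))) *\<^sub>C g"
      unfolding capelli by simp
    then have "(1 / (2 * (m * (m + 1)))) *\<^sub>C (\<Sum>i\<in>UNIV. \<Sum>j\<in>UNIV. plucker i j (cayley i j g)) = g"
      using m by simp
    moreover have "bracket d k ((1 / (2 * (m * (m + 1)))) *\<^sub>C (\<Sum>i\<in>UNIV. \<Sum>j\<in>UNIV. plucker i j (cayley i j g)))"
      by (intro bracket_scale bracket_sum in_bracket)
    ultimately show ?thesis by simp
  qed
qed

section \<open>Polynomials in the moments\<close>

inductive moment_poly :: "nat \<Rightarrow> 's \<Rightarrow> bool" where
  moment_poly_zero: "moment_poly d 0"
| moment_poly_add: "moment_poly d f \<Longrightarrow> moment_poly d g \<Longrightarrow> moment_poly d (f + g)"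
| moment_poly_scale: "moment_poly d f \<Longrightarrow> moment_poly d (c *\<^sub>C f)"
| moment_poly_vac: "moment_poly 0 vac"
| moment_poly_moment: "moment_poly d f \<Longrightarrow> moment_poly (Suc (Suc d)) (moment i j f)"

lemma moment_poly_sum: "(\<And>i. i \<in> I \<Longrightarrow> moment_poly d (f i)) \<Longrightarrow> moment_poly d (sum f I)"
  by (induction I rule: infinite_finite_induct) (auto intro: moment_poly_zero moment_poly_add)

lemmas lin_ad_simps = lin_ad[THEN clinear_add] lin_ad[THEN clinear_scale] lin_ad[THEN clinear_zero]
  lin_ad[THEN clinear_diff] lin_ad[THEN clinear_sum]
lemmas lin_moment_simps = lin_moment[THEN clinear_add] lin_moment[THEN clinear_scale]
  lin_moment[THEN clinear_zero]
  lin_moment[THEN clinear_diff] lin_moment[THEN clinear_sum]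

lemma par_moment: "par (moment i j f) = moment i j (par f)"
  by (simp add: moment_def plucker_def lin_simps par)

lemma ad_vac: "ad_dirac vac = 0" "ad_vector vac = 0"
  by (simp_all add: ad_dirac_def ad_vector_def op_defs vac lin_simps)

lemma moment_poly_invariant: "moment_poly d f \<Longrightarrow> ad_dirac f = 0 \<and> ad_vector f = 0 \<and> par f = f"
  by (induction rule: moment_poly.induct)
    (auto simp: lin_ad_simps lin_simps lin_moment_simps ad_moment par_moment par ad_vac)

text \<open>
  The sums of components of total degree \<open>d\<close> whose degrees in \<open>\<theta>\<close> are \<open>j, j + 2, j + 4, \<dots>\<close>. Steps
  of two suffice since only even elements are considered, and both \<open>ad_dirac\<close> and \<open>ad_vector\<close>
  change the degree in \<open>\<theta>\<close> by one.
\<close>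

inductive tail :: "nat \<Rightarrow> nat \<Rightarrow> 's \<Rightarrow> bool" for d j where
  tail_base: "bideg d (j + 2 * r) f \<Longrightarrow> tail d j f"
| tail_add: "tail d j f \<Longrightarrow> tail d j g \<Longrightarrow> tail d j (f + g)"

lemma tail_bideg: "bideg d j f \<Longrightarrow> tail d j f"
  using tail_base[of d j 0 f] by simp

lemma tail_zero: "tail d j 0"
  by (rule tail_bideg) (rule bideg_zero)

lemma tail_map:
  assumes "clinear F" "\<And>r f. bideg d (j + 2 * r) f \<Longrightarrow> bideg d' (j' + 2 * r) (F f)" "tail d j f"
  shows "tail d' j' (F f)"
  using assms(3)
  by induction (auto simp: clinear_add[OF assms(1)] intro: tail_base tail_add assms(2))

lemma tail_scale: "tail d j f \<Longrightarrow> tail d j (c *\<^sub>C f)"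
  by (rule tail_map[OF clinear_scaleC]) (auto intro: bideg_scale)

lemma tail_mono: "tail d (j + 2) f \<Longrightarrow> tail d j f"
proof (induction rule: tail.induct)
  case (tail_base r f)
  then show ?case using tail.tail_base[of d j "Suc r" f] by simp
qed (rule tail.tail_add)

lemma tail_split: "tail d j f \<Longrightarrow> \<exists>g h. bideg d j g \<and> tail d (j + 2) h \<and> f = g + h"
proof (induction rule: tail.induct)
  case (tail_base r f)
  show ?case
  proof (cases r)
    case 0
    then show ?thesis using tail_base by (intro exI[of _ f] exI[of _ 0]) (simp add: tail_zero)
  next
    case (Suc s)
    then show ?thesis using tail_base tail.tail_base[of d "j + 2" s f]
      by (intro exI[of _ 0] exI[of _ f]) (simp add: bideg_zero)
  qed
next
  case (tail_add f f')
  then obtain g h g' h' where "bideg d j g" "tail d (j + 2) h" "f = g + h" "bideg d j g'"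
    "tail d (j + 2) h'" "f' = g' + h'"
    by blast
  then show ?case
    by (intro exI[of _ "g + g'"] exI[of _ "h + h'"]) (auto intro: bideg_add tail.tail_add)
qed

lemma tail_trivial: "tail d j f \<Longrightarrow> d < j \<Longrightarrow> f = 0"
  by (induction rule: tail.induct) (auto dest: bideg_trivial)

text \<open>
  A component of low degree in \<open>\<theta>\<close> cannot cancel against a tail: subtracting \<open>c\<close> times the
  identity from \<open>euler_T\<close> kills the first component of the tail and only rescales \<open>w\<close>.
\<close>

lemma tail_independent:
  "bideg d b w \<Longrightarrow> tail d c u \<Longrightarrow> w + u = 0 \<Longrightarrow> b < c \<Longrightarrow> w = 0"
proof (induction "d + 1 - c" arbitrary: w u c rule: less_induct)
  case less
  show ?case
  proof (cases "d < c")
    case True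
    then show ?thesis using tail_trivial[OF less.prems(2)] less.prems(3) by simp
  next
    case False
    obtain g h where gh: "bideg d c g" "tail d (c + 2) h" "u = g + h"
      using tail_split[OF less.prems(2)] by blast
    define F where "F v = euler_T v - of_nat c *\<^sub>C v" for v
    have F: "clinear F"
      by (simp add: clinear_def F_def lin_ops_simps algebra_simps complex_vector.scale_right_distrib
          complex_vector.scale_right_diff_distrib)
    have "euler_T w = of_nat b *\<^sub>C w" "euler_T g = of_nat c *\<^sub>C g"
      using bideg_eigen[OF less.prems(1)] bideg_eigen[OF gh(1)] by blast+
    then have "F w = (of_nat b - of_nat c) *\<^sub>C w" "F g = 0"
      by (simp_all only: F_def complex_vector.scale_left_diff_distrib diff_self)
    moreover have "F w + (F g + F h) = 0"
      using clinear_zero[OF F] unfolding less.prems(3)[unfolded gh(3), symmetric]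
      by (simp only: clinear_add[OF F])
    ultimately have z: "(of_nat b - of_nat c) *\<^sub>C w + F h = 0" by simp
    have Fh: "tail d (c + 2) (F h)"
      by (rule tail_map[OF F _ gh(2)]) (simp add: F_def bideg_eigen bideg_scale bideg_diff)
    have "(of_nat b - of_nat c) *\<^sub>C w = 0"
      using less.prems(4) False by (intro less.hyps[OF _ bideg_scale[OF less.prems(1)] Fh z]) auto
    then show ?thesis using less.prems(4) by simp
  qed
qed

text \<open>
  For an operator that is the sum of a part \<open>F\<close> lowering and a part \<open>G\<close> raising the degree in \<open>\<theta>\<close>
  by one, the components of degrees \<open>j - 1\<close> and \<open>j + 1\<close> of an equation \<open>F f + G f = 0\<close>.
\<close>

lemma lowest_components:
  assumes F: "clinear F" "\<And>k f. bideg d (Suc k) f \<Longrightarrow> bideg d k (F f)" "\<And>f. bideg d 0 f \<Longrightarrow> F f = 0"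
    and G: "clinear G" "\<And>k f. bideg d k f \<Longrightarrow> bideg d (Suc k) (G f)"
    and f: "bideg d j f0" "bideg d (j + 2) f2" "tail d (j + 4) u"
      "F (f0 + f2 + u) + G (f0 + f2 + u) = 0"
  shows "F f0 = 0" "G f0 + F f2 = 0"
proof -
  have u: "tail d (j + 3) (F u)" "tail d (j + 5) (G u)"
    using f(3) by (auto intro!: tail_map[OF F(1)] tail_map[OF G(1)] F(2) G(2) simp: numeral_eq_Suc)
  have f2: "bideg d (j + 1) (F f2)" "bideg d (j + 3) (G f2)" and f0: "bideg d (j + 1) (G f0)"
    using F(2)[of "j + 1" f2] G(2)[OF f(2)] G(2)[OF f(1)] f(2) by (simp_all add: numeral_eq_Suc)
  have rest: "tail d (j + 3) (G f2 + (F u + G u))"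
    using f2(2) u tail_mono[of d "j + 3" "G u"]
    by (auto intro!: tail_add intro: tail_bideg simp: numeral_eq_Suc)
  have sum: "F f0 + ((G f0 + F f2) + (G f2 + (F u + G u))) = 0"
    using f(4) by (simp add: clinear_add[OF F(1)] clinear_add[OF G(1)] algebra_simps)
  show z: "F f0 = 0"
  proof (cases j)
    case 0
    then show ?thesis using F(3) f(1) by simp
  next
    case (Suc i)
    have "tail d (i + 2) (G f0 + F f2)" using tail_bideg[OF bideg_add[OF f0 f2(1)]] Suc by simp
    moreover have "tail d (i + 2) (G f2 + (F u + G u))"
      by (rule tail_mono) (use rest Suc in \<open>simp add: numeral_eq_Suc\<close>)
    ultimately have "tail d (i + 2) ((G f0 + F f2) + (G f2 + (F u + G u)))" by (rule tail_add)
    moreover have "bideg d i (F f0)" using F(2) f(1) Suc by simp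
    ultimately show ?thesis using tail_independent[OF _ _ sum] by simp
  qed
  show "G f0 + F f2 = 0"
    using tail_independent[OF bideg_add[OF f0 f2(1)] rest] sum z by simp
qed

lemma commuting_component:
  assumes "clinear F" "\<And>k f. bideg d k f \<Longrightarrow> bideg d k (F f)" "bideg d j g" "tail d (j + 2) u"
    "F (g + u) = 0"
  shows "F g = 0"
proof -
  have "tail d (j + 2) (F u)" by (rule tail_map[OF assms(1) assms(2) assms(4)])
  from tail_independent[OF assms(2)[OF assms(3)] this] show ?thesis
    using assms(5) by (simp add: clinear_add[OF assms(1)])
qed

lemma euler_T_contract: "euler_T (contract_y f) = contract_y (euler_T f) - contract_y f"
  "euler_T (contract_x f) = contract_x (euler_T f) - contract_x f"
  by (simp_all add: contract_y_def contract_x_def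
    lin_ops_simps euler_T_relations lin_simps sum_subtractf)

text \<open>
  The row expansion of a Pfaffian, written with derivatives in place of signed sums over the
  remaining indices.
\<close>

lemma sum_moment_PT: "(\<Sum>j\<in>UNIV. moment i j (PT j w))
  = X i (contract_y w) - Y i (contract_x w) + (1/2) *\<^sub>C T i (euler_T w)"
  by (simp add: moment_def plucker_def contract_y_def
    contract_x_def euler_T_def lin_simps sum.distrib sum_subtractf mixed
      complex_vector.scale_sum_right)

text \<open>
  In degree \<open>k\<close> put \<open>\<psi>\<^sub>k u = (k - 1) u - 2 contract_x (contract_y u)\<close>, which is up to a scalar the
  Pfaffian of the \<open>p\<^sub>i\<^sub>j\<close> on the indices of the monomial \<open>u\<close>: since \<open>x\<^sub>i y\<^sub>j - x\<^sub>j y\<^sub>i\<close> has rank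
  two, only the terms with at most one such factor survive. The claim is the expansion of \<open>\<psi>\<^bsub>k+2\<^esub>\<close>
  along the row \<open>i\<close>.
\<close>

lemma pfaffian_expansion:
  assumes "euler_T u = (of_nat k + 1) *\<^sub>C u"
  shows "(\<Sum>j\<in>UNIV. moment i j ((of_nat k - 1) *\<^sub>C PT j u - 2 *\<^sub>C contract_x (contract_y (PT j u))))
     = ((of_nat k - 1) / 2) *\<^sub>C ((of_nat k + 1) *\<^sub>C T i u - 2 *\<^sub>C contract_x (contract_y (T i u)))"
proof -
  let ?w = "contract_x (contract_y u)"
  have w: "contract_y ?w = 0" "contract_x ?w = 0" "euler_T ?w = (of_nat k - 1) *\<^sub>C ?w"
    by (simp_all add: ladder_anticommutators ladder_squares lin_ops_simps euler_T_contract assms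
        complex_vector.scale_left_distrib complex_vector.scale_left_diff_distrib)
  have "contract_x (contract_y (PT j u)) = PT j ?w" for j
    by (simp add: contract_y_relations contract_x_relations lin_ops_simps)
  then have "(\<Sum>j\<in>UNIV. moment i j ((of_nat k - 1) *\<^sub>C PT j u - 2 *\<^sub>C contract_x (contract_y (PT j u))))
      = (of_nat k - 1) *\<^sub>C (\<Sum>j\<in>UNIV. moment i j (PT j u)) - 2 *\<^sub>C (\<Sum>j\<in>UNIV. moment i j (PT j ?w))"
    by (simp add: lin_moment_simps sum_subtractf complex_vector.scale_sum_right)
  also have "\<dots>
    = (of_nat k - 1) *\<^sub>C (X i (contract_y u) - Y i (contract_x u) + ((of_nat k + 1) / 2) *\<^sub>C T i u)
      - (of_nat k - 1) *\<^sub>C T i ?w"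
    unfolding sum_moment_PT w assms by (simp add: lin_simps)
  finally have "(\<Sum>j\<in>UNIV. moment i j ((of_nat k - 1) *\<^sub>C PT j u - 2 *\<^sub>C contract_x (contract_y (PT j u))))
      = (of_nat k - 1) *\<^sub>C (X i (contract_y u) - Y i (contract_x u) + ((of_nat k + 1) / 2) *\<^sub>C T i u)
      - (of_nat k - 1) *\<^sub>C T i ?w" .
  then show ?thesis
    by (simp add: contract_y_relations contract_x_relations lin_ops_simps
      complex_vector.scale_right_distrib
        complex_vector.scale_right_diff_distrib diff_divide_distrib)
qed

text \<open>
  The expansion expresses \<open>\<psi>\<close> in degree \<open>2 r + 2\<close> through \<open>\<psi>\<close> in degree \<open>2 r\<close>, because by Euler's
  identity \<open>u\<close> is a combination of the \<open>T\<^sub>i (PT\<^sub>i u)\<close>. The degree must be even, for otherwise the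
  factor \<open>k - 1\<close> vanishes at \<open>k = 1\<close>.
\<close>

lemma pfaffian_moment_poly:
  "bideg (2 * r) (2 * r) u
  \<Longrightarrow> moment_poly (2 * r) ((of_nat (2 * r) - 1) *\<^sub>C u - 2 *\<^sub>C contract_x (contract_y u))"
proof (induction r arbitrary: u)
  case 0
  then obtain c where c: "u = c *\<^sub>C vac" using bideg_zero_zero by fastforce
  have "contract_x (contract_y u) = 0" using 0 ladder_bottom by (simp add: lin_ops_simps)
  then show ?case using moment_poly_scale[OF moment_poly_vac, of "- c"] by (simp add: c)
next
  case (Suc r)
  define \<psi> where "\<psi> u = (of_nat (2 * r) + 1) *\<^sub>C u - 2 *\<^sub>C contract_x (contract_y u)" for u
  have lin_\<psi>: "clinear \<psi>"
    by (simp add: clinear_def \<psi>_def lin_ops_simps complex_vector.scale_right_distrib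
        complex_vector.scale_right_diff_distrib complex_vector.scale_left_commute algebra_simps)
  have "moment_poly (2 * Suc r) (\<psi> (T i v))" if v: "bideg (2 * r + 1) (2 * r + 1) v" for v i
  proof -
    have "euler_T v = (of_nat (2 * r) + 1) *\<^sub>C v" using bideg_eigen[OF v] by (simp add: add.commute)
    note e = pfaffian_expansion[OF this, of i, folded \<psi>_def]
    have "bideg (2 * r) (2 * r) (PT j v)" for j using bideg_PT[OF v] by simp
    then have c: "moment_poly (2 * Suc r) (((of_nat (2 * r) - 1) / 2) *\<^sub>C \<psi> (T i v))"
      unfolding e[symmetric] using Suc.IH by (auto intro!: moment_poly_sum moment_poly_moment)
    have "(of_nat (2 * r) :: complex) \<noteq> of_nat 1"
      unfolding of_nat_eq_iff by presburger
    then have "(of_nat (2 * r) :: complex) - 1 \<noteq> 0" by simp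
    then show ?thesis
      using moment_poly_scale[OF c, of "2 / (of_nat (2 * r) - 1)"] by simp
  qed
  moreover have "bideg (2 * r + 1) (2 * r + 1) (PT i u)" for i
    using bideg_PT[OF Suc.prems] by simp
  ultimately have "moment_poly (2 * Suc r) ((1 / of_nat (2 * Suc r)) *\<^sub>C (\<Sum>i\<in>UNIV. \<psi> (T i (PT i u))))"
    by (intro moment_poly_scale moment_poly_sum) blast
  also have "(1 / of_nat (2 * Suc r)) *\<^sub>C (\<Sum>i\<in>UNIV. \<psi> (T i (PT i u)))
    = \<psi> ((1 / of_nat (2 * Suc r)) *\<^sub>C euler_T u)"
    by (simp add: euler_T_def clinear_sum[OF lin_\<psi>] clinear_scale[OF lin_\<psi>])
  also have "(1 / of_nat (2 * Suc r)) *\<^sub>C euler_T u = u"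
    using bideg_eigen[OF Suc.prems] by (simp del: of_nat_Suc of_nat_mult of_nat_add)
  finally show ?case by (simp add: \<psi>_def algebra_simps)
qed

text \<open>
  Multiplication by \<open>p\<^sub>i\<^sub>j\<close> agrees with multiplication by the Pluecker coordinate up to terms of
  higher degree in \<open>\<theta>\<close>. So products of moments with Pfaffians realise, as lowest components, all
  the \<open>contract_x (contract_y g)\<close> with \<open>g\<close> in the bracket module.
\<close>

lemma lift_lowest_component:
  "bracket d k g \<Longrightarrow> k = j + 2 \<Longrightarrow> even j \<Longrightarrow> \<exists>h. moment_poly d h
  \<and> tail d (j + 2) (h - contract_x (contract_y g))"
proof (induction rule: bracket.induct)
  case (bracket_zero d k)
  show ?case by (intro exI[of _ 0]) (simp add: lin_ops_simps moment_poly_zero tail_zero)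
next
  case (bracket_add d k f g)
  then obtain h h' where h: "moment_poly d h" "tail d (j + 2) (h - contract_x (contract_y f))"
    "moment_poly d h'" "tail d (j + 2) (h' - contract_x (contract_y g))"
    by blast
  have e: "h + h' - contract_x (contract_y (f + g))
    = (h - contract_x (contract_y f)) + (h' - contract_x (contract_y g))"
      by (simp add: lin_ops_simps)
  show ?case
    by (rule exI[of _ "h + h'"], unfold e) (intro conjI moment_poly_add tail_add h)
next
  case (bracket_scale d k f c)
  then obtain h where h: "moment_poly d h" "tail d (j + 2) (h - contract_x (contract_y f))" by blast
  have e: "c *\<^sub>C h - contract_x (contract_y (c *\<^sub>C f)) = c *\<^sub>C (h - contract_x (contract_y f))"
    by (simp add: lin_ops_simps complex_vector.scale_right_diff_distrib)
  show ?case
    by (rule exI[of _ "c *\<^sub>C h"], unfold e) (intro conjI moment_poly_scale tail_scale h)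
next
  case (bracket_base k f)
  then obtain r where r: "k = 2 * r" by (metis dvdE dvd_add dvd_refl)
  let ?h = "(- 1 / 2) *\<^sub>C ((of_nat k - 1) *\<^sub>C f - 2 *\<^sub>C contract_x (contract_y f))"
  have "moment_poly k ?h" using pfaffian_moment_poly[of r f] bracket_base.hyps unfolding r
    by (intro moment_poly_scale)
  moreover have e: "?h - contract_x (contract_y f) = - (((of_nat k - 1) / 2) *\<^sub>C f)"
    by (simp add: complex_vector.scale_right_diff_distrib)
  have "tail k (j + 2) (?h - contract_x (contract_y f))"
    unfolding e using bracket_base by (intro tail_bideg bideg_uminus bideg_scale) simp
  ultimately show ?case by blast
next
  case (bracket_plucker d k g i i')
  then obtain h where h: "moment_poly d h" "tail d (j + 2) (h - contract_x (contract_y g))" by blast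
  define u where "u = h - contract_x (contract_y g)"
  have "bideg d j (contract_x (contract_y g))"
    using bracket_bideg[OF bracket_plucker.hyps] bracket_plucker.prems
    by (auto intro!: bideg_ladder)
  then have 1: "bideg (d + 2) (j + 2) (T i (T i' (contract_x (contract_y g))))"
    by (auto intro!: bideg_T)
  have 2: "tail (d + 2) (j + 2) (moment i i' u)"
  proof -
    have lin_TT: "clinear (\<lambda>f. T i (T i' f))" by (simp add: clinear_def lin_simps)
    have "tail (d + 2) (j + 4) (T i (T i' u))"
      using h(2)
      unfolding u_def[symmetric]
      by (rule tail_map[OF lin_TT, rotated]) (auto simp: numeral_eq_Suc intro!: bideg_T)
    then have "tail (d + 2) (j + 2) (T i (T i' u))"
      using tail_mono[of "d + 2" "j + 2"] by (simp add: numeral_eq_Suc)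
    moreover have "tail (d + 2) (j + 2) (plucker i i' u)"
      using h(2)
      unfolding u_def[symmetric] by (rule tail_map[OF lin_moment(1), rotated]) (rule bideg_plucker)
    ultimately show ?thesis unfolding moment_def by (intro tail_add tail_scale)
  qed
  have "contract_x (contract_y (plucker i i' g)) = plucker i i' (contract_x (contract_y g))"
    by (simp add: plucker_def lin_ops_simps contract_y_relations contract_x_relations)
  then have "moment i i' h - contract_x (contract_y (plucker i i' g))
    = (1/2) *\<^sub>C T i (T i' (contract_x (contract_y g))) + moment i i' u"
    unfolding u_def by (simp add: lin_moment_simps) (simp add: moment_def)
  then have "tail (d + 2) (j + 2) (moment i i' h - contract_x (contract_y (plucker i i' g)))"
    using tail_add[OF tail_scale[OF tail_bideg[OF 1], of "1/2"] 2] by simp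
  then show ?case using moment_poly_moment[OF h(1), of i i'] by auto
qed

section \<open>Invariants of osp(1|2)\<close>

text \<open>
  The first fundamental theorem. The component \<open>f0\<close> of lowest degree in \<open>\<theta>\<close> is determined by the
  next one \<open>f2\<close>, and \<open>f2\<close> is in the bracket module, so \<open>f0\<close> lifts to a polynomial in the moments.
  Subtracting the lift raises the lowest degree, which cannot exceed the total degree.
\<close>

lemma homogeneous_invariant_moment_poly:
  "tail d j f \<Longrightarrow> even j \<Longrightarrow> ad_dirac f = 0 \<Longrightarrow> ad_vector f = 0 \<Longrightarrow> moment_poly d f"
proof (induction "d + 1 - j" arbitrary: j f rule: less_induct)
  case less
  show ?case
  proof (cases "d < j")
    case True
    then show ?thesis using tail_trivial[OF less.prems(1)] by (simp add: moment_poly_zero)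
  next
    case False
    obtain f0 u where f0: "bideg d j f0" "tail d (j + 2) u"
      "f = f0 + u" using tail_split[OF less.prems(1)] by blast
    obtain f2 u' where f2: "bideg d (j + 2) f2" "tail d (j + 2 + 2) u'"
      "u = f2 + u'" using tail_split[OF f0(2)] by blast
    have u': "tail d (j + 4) u'" using f2(2) by (simp add: numeral_eq_Suc)
    have "sl2_yx f = 0" "sl2_xy f = 0"
      using osp_relations(1,2)[of f] less.prems by (simp_all add: lin_ad_simps)
    moreover have "euler_x f - euler_y f = 0"
      using osp_relations(3)[of f] less.prems by (simp add: lin_ad_simps)
    ultimately have sl2: "sl2_yx f = 0" "sl2_xy f = 0" "euler_x f - euler_y f = 0" by auto
    have lin_diff: "clinear (\<lambda>f. euler_x f - euler_y f)"
      by (simp add: clinear_def lin_ops_simps complex_vector.scale_right_diff_distrib)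
    have sl2_component: "sl2_yx g = 0 \<and> sl2_xy g = 0 \<and> euler_x g - euler_y g = 0"
      if "bideg d l g" "tail d (l + 2) v" "sl2_yx (g + v) = 0" "sl2_xy (g + v) = 0"
        "euler_x (g + v) - euler_y (g + v) = 0" for l g v
      using commuting_component[OF lin_ops(5) bideg_ladder(5) that(1,2,3)]
        commuting_component[OF lin_ops(6) bideg_ladder(6) that(1,2,4)]
        commuting_component[OF lin_diff bideg_diff[OF bideg_ladder(7,8)] that(1,2,5)] by simp
    have f0_sl2: "sl2_yx f0 = 0" "sl2_xy f0 = 0" "euler_x f0 - euler_y f0 = 0"
      using sl2_component[OF f0(1,2)] sl2 f0(3) by auto
    then have u_sl2: "sl2_yx u = 0" "sl2_xy u = 0" "euler_x u - euler_y u = 0"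
      using sl2 f0(3) by (simp_all add: lin_ops_simps)
    then have f2_sl2: "sl2_yx f2 = 0" "sl2_xy f2 = 0" "euler_x f2 - euler_y f2 = 0"
      using sl2_component[OF f2(1,2)] f2(3) by auto
    then have "bracket d (j + 2) f2" using sl2_invariants_bracket[OF f2(1)] by simp
    from lift_lowest_component[OF this refl less.prems(2)]
    obtain h where h: "moment_poly d h" "tail d (j + 2) (h - contract_x (contract_y f2))" by blast
    have lin_F: "clinear (\<lambda>f. 2 *\<^sub>C contract_y f)" "clinear (\<lambda>f. 2 *\<^sub>C contract_x f)"
      "clinear (\<lambda>f. - polar_y f)"
      by (simp_all add: clinear_def lin_ops_simps complex_vector.scale_right_distrib)
    \<comment> \<open>The component of degree \<open>j + 1\<close> of the first equation ties \<open>f0\<close> to \<open>f2\<close>.\<close>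
    have polar_eq: "polar_x f0 + 2 *\<^sub>C contract_y f2 = 0"
      by (rule lowest_components(2)[OF lin_F(1) _ _ lin_ops(3) _ f0(1) f2(1) u'])
        (use less.prems f0(3) f2(3) in \<open>auto simp:
          ad_dirac_def add.assoc ladder_bottom intro: bideg_scale bideg_ladder\<close>)
    \<comment> \<open>The component of degree \<open>j - 1\<close> of the second equation.\<close>
    have "2 *\<^sub>C contract_x f0 = 0"
      by (rule lowest_components(1)[OF lin_F(2) _ _ lin_F(3) _ f0(1) f2(1) u'])
        (use less.prems f0(3) f2(3) in \<open>auto simp:
          ad_vector_def add.assoc ladder_bottom intro: bideg_scale bideg_ladder bideg_uminus\<close>)
    then have contract_f0: "contract_x f0 = 0" by simp
    have "euler f0 = of_nat d *\<^sub>C f0" and euler_T_f0: "euler_T f0 = of_nat j *\<^sub>C f0"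
      using bideg_eigen[OF f0(1)] by auto
    then have "2 *\<^sub>C euler_x f0 + of_nat j *\<^sub>C f0 = of_nat d *\<^sub>C f0"
      using f0_sl2 by (simp add: euler_def scaleC_two)
    then have twice_euler_x: "euler_x f0 + euler_x f0 = of_nat d *\<^sub>C f0 - of_nat j *\<^sub>C f0"
      by (simp add: scaleC_two eq_diff_eq)
    have "contract_x (polar_x f0) = euler_x f0 + of_nat j *\<^sub>C f0"
      using ladder_anticommutators(5)[of f0] by (simp add: contract_f0 euler_T_f0 lin_ops_simps)
    then have "2 *\<^sub>C contract_x (polar_x f0)
      = (euler_x f0 + euler_x f0) + (of_nat j *\<^sub>C f0 + of_nat j *\<^sub>C f0)"
      by (simp only: scaleC_two ac_simps)
    \<comment> \<open>Since \<open>contract_x f0 = 0\<close>, applying \<open>contract_x\<close> to \<open>polar_x f0\<close> gives a multiple of \<open>f0\<close>.\<close>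
    then have "2 *\<^sub>C contract_x (polar_x f0) = (of_nat d + of_nat j) *\<^sub>C f0"
      unfolding twice_euler_x by (simp add: complex_vector.scale_left_distrib)
    moreover have "polar_x f0 = - (2 *\<^sub>C contract_y f2)" using polar_eq
      by (simp add: eq_neg_iff_add_eq_0)
    ultimately have f0_eq: "(of_nat d + of_nat j) *\<^sub>C f0 = - 4 *\<^sub>C contract_x (contract_y f2)"
      by (simp add: lin_ops_simps)
    \<comment> \<open>A scalar if \<open>d + j = 0\<close>, otherwise a multiple of \<open>contract_x (contract_y f2)\<close>.\<close>
    have "\<exists>h. moment_poly d h \<and> tail d (j + 2) (h - f0)"
    proof (cases "d + j = 0")
      case True
      then obtain c where "f0 = c *\<^sub>C vac" using bideg_zero_zero[OF f0(1)] by auto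
      then show ?thesis using True moment_poly_scale[OF moment_poly_vac, of c] tail_zero
        by (intro exI[of _ f0]) simp
    next
      case False
      define c :: complex where "c = - 4 / of_nat (d + j)"
      have nz: "(of_nat d + of_nat j :: complex) \<noteq> 0"
        using False by (metis of_nat_add of_nat_eq_0_iff)
      have "f0 = (1 / of_nat (d + j)) *\<^sub>C ((of_nat d + of_nat j) *\<^sub>C f0)"
        using nz by simp
      also have "\<dots> = c *\<^sub>C contract_x (contract_y f2)"
        unfolding f0_eq by (simp add: c_def)
      finally have "c *\<^sub>C h - f0 = c *\<^sub>C (h - contract_x (contract_y f2))"
        by (simp add: complex_vector.scale_right_diff_distrib)
      then show ?thesis using h
        by (intro exI[of _ "c *\<^sub>C h"]) (simp add: moment_poly_scale tail_scale)
    qed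
    then obtain h where h: "moment_poly d h" "tail d (j + 2) (h - f0)" by blast
    have "f - h = (- 1) *\<^sub>C (h - f0) + u" using f0(3) by simp
    then have fh: "tail d (j + 2) (f - h)" using tail_add[OF tail_scale[OF h(2)] f0(2)] by metis
    have "ad_dirac (f - h) = 0" "ad_vector (f - h) = 0"
      using moment_poly_invariant[OF h(1)] less.prems by (simp_all add: lin_ad_simps)
    then have "moment_poly d (f - h)" using less.prems(2) False by (intro less.hyps[OF _ fh]) auto
    from moment_poly_add[OF this h(1)] show ?thesis by simp
  qed
qed

section \<open>Decomposition of even invariants\<close>

inductive spanned :: "'s \<Rightarrow> bool" where
  spanned_bideg: "bideg d k f \<Longrightarrow> spanned f"
| spanned_add: "spanned f \<Longrightarrow> spanned g \<Longrightarrow> spanned (f + g)"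

lemma spanned_map:
  assumes "clinear F" "\<And>d k f. bideg d k f \<Longrightarrow> spanned (F f)" "spanned f"
  shows "spanned (F f)"
  using assms(3) by induction (auto simp: clinear_add[OF assms(1)] intro: spanned_add assms(2))

lemma spanned_all: "spanned f"
proof (rule cyclic[of spanned])
  show "spanned vac" using spanned_bideg bideg_vac by blast
  have zero: "spanned 0" using spanned_bideg[OF bideg_zero] .
  have scale: "spanned (c *\<^sub>C f)" if "spanned f" for c f
    by (rule spanned_map[OF clinear_scaleC _ that]) (rule spanned_bideg[OF bideg_scale])
  have raise: "spanned (X i f)" "spanned (Y i f)" "spanned (T i f)" if "spanned f" for i f
    using spanned_map[OF lin(1)[of i] _ that] spanned_map[OF lin(2)[of i] _ that]
      spanned_map[OF lin(3)[of i] _ that]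
    by (blast intro: spanned_bideg bideg_X bideg_Y bideg_T)+
  have "spanned (PX i f) \<and> spanned (PY i f) \<and> spanned (PT i f)" if f: "bideg d k f" for i d k f
  proof (cases d)
    case 0
    have "PT i f = 0" using bideg_trivial[OF f] annihilate_bottom_PT[OF f] 0
      by (cases k) (auto simp: lin_simps)
    then show ?thesis using annihilate_bottom[OF f] 0 zero by simp
  next
    case (Suc e)
    have "spanned (PX i f)" "spanned (PY i f)" using bideg_PXY[OF f Suc] spanned_bideg by blast+
    moreover have "spanned (PT i f)"
    proof (cases k)
      case 0
      then show ?thesis using annihilate_bottom_PT[OF f] zero by simp
    next
      case (Suc l)
      show ?thesis by (rule spanned_bideg[OF bideg_PT[OF f \<open>d = Suc e\<close> Suc]])
    qed
    ultimately show ?thesis by blast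
  qed
  note lower_H = this
  have lower: "spanned (PX i f)" "spanned (PY i f)" "spanned (PT i f)" if "spanned f" for i f
    using spanned_map[OF lin(4)[of i] _ that] spanned_map[OF lin(5)[of i] _ that]
      spanned_map[OF lin(6)[of i] _ that] lower_H
    by blast+
  show "spanned (X i f + (- 1/2) *\<^sub>C PY i f)" "spanned (Y i f + (1/2) *\<^sub>C PX i f)"
    "spanned (T i f + PT i f)"
    if "spanned f" for i f
    using that by (blast intro: spanned_add scale raise lower)+
qed (auto intro: spanned_add spanned_map[OF clinear_scaleC] spanned_bideg bideg_scale)

text \<open>Adding the parity image doubles the even components and cancels the odd ones.\<close>

lemma even_decomposition_aux: "spanned f \<Longrightarrow> \<exists>I g. finite I \<and> f + par f = sum g I
  \<and> (\<forall>d. tail d 0 (g d))"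
proof (induction rule: spanned.induct)
  case (spanned_bideg d k f)
  have "tail d 0 (f + par f)"
  proof (cases "even k")
    case True
    then obtain r where r: "k = 2 * r" by auto
    moreover have "par f = f" using bideg_eigen[OF spanned_bideg] True by simp
    moreover have "tail d 0 f" using tail_base[of d 0 r f] spanned_bideg r by simp
    ultimately show ?thesis by (simp add: tail_add)
  next
    case False
    then have "par f = - f" using bideg_eigen[OF spanned_bideg] by simp
    then show ?thesis by (simp add: tail_zero)
  qed
  then show ?case
    by (intro exI[of _ "{d}"] exI[of _ "\<lambda>d'. if d' = d then f + par f else 0"])
      (simp add: tail_zero)
next
  case (spanned_add f f')
  then obtain I g I' g' where h: "finite I" "f + par f = sum g I" "\<And>d. tail d 0 (g d)"
    "finite I'" "f' + par f' = sum g' I'" "\<And>d. tail d 0 (g' d)"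
    by blast
  let ?g = "\<lambda>d. (if d \<in> I then g d else 0) + (if d \<in> I' then g' d else 0)"
  have "f + f' + par (f + f') = sum g I + sum g' I'"
    unfolding h(2,5)[symmetric] by (simp add: lin_simps)
  also have "\<dots> = sum ?g (I \<union> I')"
    using h(1,4) by (simp add: sum.distrib sum.If_cases Int_absorb1 Int_absorb2 Un_Int_distrib2)
  finally show ?case
    using h by (intro exI[of _ "I \<union> I'"] exI[of _ ?g]) (auto intro!: tail_add simp: tail_zero)
qed

lemma even_decomposition:
  assumes "par f = f"
  shows "\<exists>I g. finite I \<and> f = sum g I \<and> (\<forall>d. tail d 0 (g d))"
proof -
  obtain I g where g: "finite I" "f + par f = sum g I" "\<And>d. tail d 0 (g d)"
    using even_decomposition_aux[OF spanned_all] by blast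
  have "f = (1/2) *\<^sub>C (f + par f)" by (simp add: assms flip: scaleC_two)
  then show ?thesis using g
    by (intro exI[of _ I] exI[of _ "\<lambda>d. (1/2) *\<^sub>C g d"]) (auto simp:
      complex_vector.scale_sum_right intro: tail_scale)
qed

lemma euler_lower_relations: "euler (PX i f) = PX i (euler f) - PX i f"
  "euler (PY i f) = PY i (euler f) - PY i f"
  "euler (PT i f) = PT i (euler f) - PT i f"
  by (simp_all add: euler_def euler_x_relations
    euler_y_relations euler_T_relations lin_simps algebra_simps)

lemma euler_ad: "euler (ad_dirac f) = ad_dirac (euler f)"
  "euler (ad_vector f) = ad_vector (euler f)"
proof -
  note l = lin_euler[THEN clinear_add] lin_euler[THEN clinear_scale] lin_euler[THEN clinear_diff]
    lin_euler[THEN clinear_sum]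
  have "euler (contract_y f) = contract_y (euler f)" "euler (contract_x f) = contract_x (euler f)"
    "euler (polar_x f) = polar_x (euler f)" "euler (polar_y f) = polar_y (euler f)"
    by (simp_all add: contract_y_def contract_x_def polar_x_def polar_y_def l euler_relations
      euler_lower_relations lin_simps)
  then show "euler (ad_dirac f) = ad_dirac (euler f)" "euler (ad_vector f) = ad_vector (euler f)"
    by (simp_all add: ad_dirac_def ad_vector_def l)
qed

lemma tail_eigen: "tail d j f \<Longrightarrow> euler f = of_nat d *\<^sub>C f"
  by (induction rule: tail.induct)
    (auto simp: bideg_eigen lin_euler[THEN clinear_add] complex_vector.scale_right_distrib)

text \<open>
  Both operators commute with the total Euler operator, so every homogeneous component is itself
  invariant.
\<close>

theorem even_invariant_decomposition:
  assumes "par f = f" "ad_dirac f = 0" "ad_vector f = 0"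
  shows "\<exists>I g. finite I \<and> f = sum g I \<and> (\<forall>d\<in>I. moment_poly d (g d))"
proof -
  obtain I g where g: "finite I" "f = sum g I" "\<And>d. tail d 0 (g d)"
    using even_decomposition[OF assms(1)] by blast
  have inv: "F (g d) = 0" if "clinear F" "\<And>f. euler (F f) = F (euler f)" "F f = 0" "d \<in> I" for F d
    by (rule eigenvectors_independent[OF lin_euler g(1) _ _ that(4), of "\<lambda>d. F (g d)"])
      (use that g(2) in \<open>simp_all add: tail_eigen[OF g(3)] clinear_scale clinear_sum\<close>)
  have "moment_poly d (g d)" if "d \<in> I" for d
    by (rule homogeneous_invariant_moment_poly[OF g(3)])
      (use inv[of ad_dirac, OF lin_ad(1) euler_ad(1)] inv[of ad_vector, OF lin_ad(2) euler_ad(2)]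
        assms that in auto)
  then show ?thesis using g by blast
qed

section \<open>From symbols back to the algebra\<close>

lemma tail_uminus: "tail d j f \<Longrightarrow> tail d j (- f)"
  using tail_scale[of d j f "- 1"] by simp

text \<open>
  The constant-coefficient partner of \<open>moment i j\<close>: the sum of both is the average of left and
  right multiplication by \<open>O\<^sub>i\<^sub>j\<close>.
\<close>

definition "moment_dual i j f = (1/4) *\<^sub>C (PY j (PX i f) - PY i (PX j f)) + (1/2) *\<^sub>C PT i (PT j f)"

lemma lin_moment_dual: "clinear (moment_dual i j)"
  by (auto simp: clinear_def moment_dual_def lin_simps complex_vector.scale_right_distrib
      complex_vector.scale_right_diff_distrib complex_vector.scale_left_commute)

text \<open>
  The derivatives of \<open>x, y, \<theta>\<close> transform dually to the variables, and the form behind the moments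
  is invariant.
\<close>

lemma ad_moment_dual: "ad_dirac (moment_dual i j f) = moment_dual i j (ad_dirac f)"
  "ad_vector (moment_dual i j f) = moment_dual i j (ad_vector f)"
  by (simp_all add: ad_dirac_def ad_vector_def moment_dual_def lin_ops_simps lin_simps
    contract_y_relations contract_x_relations polar_x_relations polar_y_relations
    complex_vector.scale_right_distrib complex_vector.scale_right_diff_distrib
      relations algebra_simps)

lemma bideg_moment_dual: "bideg d (2 * r) f
  \<Longrightarrow> if d < 2 then moment_dual i j f = 0 else tail (d - 2) 0 (moment_dual i j f)"
proof -
  assume f: "bideg d (2 * r) f"
  have PXY: "PX i (PY j f) = 0" if "d < 2" for i j
  proof (cases d)
    case 0
    then show ?thesis using annihilate_bottom[OF f] by (simp add: lin_simps)
  next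
    case (Suc e)
    then show ?thesis using annihilate_bottom[of e "2 * r" "PY j f"] bideg_PXY[OF f Suc] that
      by simp
  qed
  have PT: "PT i (PT j f) = 0" if "d < 2 \<or> r = 0"
  proof (cases r)
    case 0
    then show ?thesis using annihilate_bottom_PT[OF f] by (simp add: lin_simps)
  next
    case (Suc s)
    then show ?thesis using bideg_trivial[OF f] that by (simp add: lin_simps)
  qed
  show ?thesis
  proof (cases "d < 2")
    case True
    then show ?thesis using PXY PT by (simp add: moment_dual_def mixed)
  next
    case False
    then obtain e where e: "d = Suc (Suc e)" by (metis add_2_eq_Suc le_Suc_ex not_less)
    have "tail e 0 (PX i (PY j f))" for i j
      using tail_base[of e 0 r] bideg_PXY[of "Suc e" "2 * r" _ e] bideg_PXY[OF f e] by simp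
    moreover have "tail e 0 (PT i (PT j f))"
    proof (cases r)
      case 0
      then show ?thesis using PT by (simp add: tail_zero)
    next
      case (Suc s)
      then have "bideg (Suc e) (Suc (2 * s)) (PT j f)" using bideg_PT[OF f e] by simp
      then show ?thesis using bideg_PT[OF _ refl refl] tail_base[of e 0 s] by simp
    qed
    ultimately have "tail e 0 (moment_dual i j f)"
      unfolding moment_dual_def mixed(10) diff_conv_add_uminus
      by (intro tail_add tail_scale tail_uminus)
    then show ?thesis using e by simp
  qed
qed

lemma tail_moment_dual: "tail d 0 f
  \<Longrightarrow> if d < 2 then moment_dual i j f = 0 else tail (d - 2) 0 (moment_dual i j f)"
proof (induction rule: tail.induct)
  case (tail_base r f)
  then show ?case using bideg_moment_dual by simp
next
  case (tail_add f g)
  then show ?case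
    by (auto simp: clinear_add[OF lin_moment_dual] intro: tail.tail_add split: if_splits)
qed

lemma tail_moment: "tail d 0 f \<Longrightarrow> tail (Suc (Suc d)) 0 (moment i j f)"
proof (induction rule: tail.induct)
  case (tail_base r f)
  have "tail (Suc (Suc d)) 0 (plucker i j f)" "tail (Suc (Suc d)) 0 (T i (T j f))"
    using tail.tail_base[of "Suc (Suc d)" 0 r] tail.tail_base[of "Suc (Suc d)" 0 "Suc r"]
      bideg_plucker tail_base bideg_T by simp_all
  then show ?case unfolding moment_def by (intro tail_add tail_scale)
qed (simp add: lin_moment_simps tail_add)

lemma moment_poly_tail: "moment_poly d f \<Longrightarrow> tail d 0 f"
  by (induction rule: moment_poly.induct) (auto intro: tail_zero tail_add tail_scale tail_moment tail_bideg bideg_vac)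

text \<open>
  Closure under \<open>moment + moment_dual\<close> suffices to reach all polynomials in the moments: the
  unwanted term \<open>moment_dual i j h\<close> is again an even invariant, so it is a polynomial in the
  moments of lower degree.
\<close>

lemma moment_poly_generated:
  assumes "S vac" "\<And>f g. S f \<Longrightarrow> S g \<Longrightarrow> S (f + g)" "\<And>c f. S f \<Longrightarrow> S (c *\<^sub>C f)"
    and "\<And>i j f. i \<noteq> j \<Longrightarrow> S f \<Longrightarrow> S (moment i j f + moment_dual i j f)" and "moment_poly d f"
  shows "S f"
  using assms(5)
proof (induction d arbitrary: f rule: less_induct)
  case (less d)
  have S0: "S 0" using assms(3)[OF assms(1), of 0] by simp
  from less.prems less.IH show ?case
  proof (induction rule: moment_poly.induct)
    case (moment_poly_moment d h i j)
    have h: "S h" by (rule moment_poly_moment.prems[OF _ moment_poly_moment.hyps]) simp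
    show ?case
    proof (cases "i = j")
      case True
      have "T i (T i h) + T i (T i h) = 0" using anti_T[of i i h] by (metis add.right_inverse)
      then have "T i (T i h) = 0" by (rule double_zero)
      then have "moment i j h = 0" using True by (simp add: moment_def plucker_def)
      then show ?thesis using S0 by simp
    next
      case False
      have "S (moment_dual i j h)"
      proof (cases "d < 2")
        case True
        then show ?thesis
          using tail_moment_dual[OF moment_poly_tail[OF moment_poly_moment.hyps], of i j] S0 by simp
      next
        case False
        then have "tail (d - 2) 0 (moment_dual i j h)"
          using tail_moment_dual[OF moment_poly_tail[OF moment_poly_moment.hyps], of i j] by simp
        then have "moment_poly (d - 2) (moment_dual i j h)"
          using moment_poly_invariant[OF moment_poly_moment.hyps]
          by (intro homogeneous_invariant_moment_poly[OF _ dvd_0_right])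
            (simp_all add: ad_moment_dual clinear_zero[OF lin_moment_dual])
        then show ?thesis by (rule moment_poly_moment.prems[rotated]) simp
      qed
      then have "S ((moment i j h + moment_dual i j h) + (- 1) *\<^sub>C moment_dual i j h)"
        using assms(2-4) h False by blast
      then show ?thesis by simp
    qed
  qed (use assms S0 in \<open>auto intro: moment_poly.intros\<close>)
qed

theorem even_invariants_generated:
  assumes "S vac" "\<And>f g. S f \<Longrightarrow> S g \<Longrightarrow> S (f + g)" "\<And>c f. S f \<Longrightarrow> S (c *\<^sub>C f)"
    and "\<And>i j f. i \<noteq> j \<Longrightarrow> S f \<Longrightarrow> S (moment i j f + moment_dual i j f)"
    and "par f = f" "ad_dirac f = 0" "ad_vector f = 0"
  shows "S f"
proof -
  obtain I g where g: "finite I" "f = sum g I" "\<And>d. d \<in> I \<Longrightarrow> moment_poly d (g d)"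
    using even_invariant_decomposition[OF assms(5-7)] by blast
  have S0: "S 0" using assms(3)[OF assms(1), of 0] by simp
  have "S (g d)" if "d \<in> I" for d
    using moment_poly_generated[of S, OF assms(1-4) g(3)[OF that]] by blast
  with g(1) have "S (sum g I)"
    by (induction I rule: finite_induct) (auto intro: S0 assms(2))
  then show ?thesis using g(2) by simp
qed

end

section \<open>Universal properties of presentations and tensor products\<close>

definition linear_extension :: "('k \<Rightarrow> 'v::complex_vector) \<Rightarrow> ('k \<Rightarrow>\<^sub>0 complex) \<Rightarrow> 'v" where
  "linear_extension g f = (\<Sum>k\<in>Poly_Mapping.keys f. Poly_Mapping.lookup f k *\<^sub>C g k)"

lemma linear_extension_superset:
  assumes "finite S" "Poly_Mapping.keys f \<subseteq> S"
  shows "linear_extension g f = (\<Sum>k\<in>S. Poly_Mapping.lookup f k *\<^sub>C g k)"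
  unfolding linear_extension_def
  by (rule sum.mono_neutral_left) (use assms in \<open>auto simp: in_keys_iff\<close>)

lemma linear_extension_add: "linear_extension g (f + f')
  = linear_extension g f + linear_extension g f'"
proof -
  let ?S = "Poly_Mapping.keys f \<union> Poly_Mapping.keys f'"
  have "finite ?S" "Poly_Mapping.keys (f + f') \<subseteq> ?S" by (simp_all add: Poly_Mapping.keys_add)
  then show ?thesis
    by (simp add: linear_extension_superset[of ?S] lookup_add
      complex_vector.scale_left_distrib sum.distrib)
qed

lemma linear_extension_single: "linear_extension g (Poly_Mapping.single k c) = c *\<^sub>C g k"
  by (simp add: linear_extension_superset[of "{k}"])

lemma linear_extension_zero: "linear_extension g 0 = 0"
  by (simp add: linear_extension_def)

lemma linear_extension_diff: "linear_extension g (f - f')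
  = linear_extension g f - linear_extension g f'"
  using linear_extension_add[of g "f - f'" f'] by simp

lemma algebra_hom_clinear: "algebra_hom f \<Longrightarrow> clinear f"
  by (simp add: algebra_hom_def clinear_def)

lemma algebra_hom_mult: "algebra_hom f \<Longrightarrow> f (x * y) = f x * f y"
  and algebra_hom_one: "algebra_hom f \<Longrightarrow> f 1 = 1"
  by (simp_all add: algebra_hom_def)

fun word_eval :: "('g \<Rightarrow> 'b::monoid_mult) \<Rightarrow> 'g word \<Rightarrow> 'b" where
  "word_eval g (Word gs) = prod_list (map g gs)"

lemma word_eval_plus: "word_eval g (u + v) = word_eval g u * word_eval g v"
  by (cases u; cases v) simp

definition free_extension :: "('g \<Rightarrow> 'b::complex_algebra_1) \<Rightarrow> 'g free_algebra \<Rightarrow> 'b" where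
  "free_extension g = linear_extension (word_eval g)"

lemma free_extension_mult: "free_extension g (a * b) = free_extension g a * free_extension g b"
proof (induction a rule: poly_mapping_single_induct)
  case (single u c)
  show ?case
    by (induction b rule: poly_mapping_single_induct)
      (simp_all add: free_extension_def linear_extension_zero linear_extension_add linear_extension_single
        distrib_left mult_single word_eval_plus mult_scaleC_left mult_scaleC_right mult.commute)
qed (simp_all add: free_extension_def linear_extension_zero linear_extension_add distrib_right)

lemma free_extension_scalar: "free_extension g (scalar c) = c *\<^sub>C 1"
  by (simp add: free_extension_def linear_extension_single zero_word_def)

lemma free_extension_one: "free_extension g 1 = 1"
  using free_extension_scalar[of g 1] by (simp add: scaleC_one)

lemma free_extension_gen: "free_extension g (free_gen x) = g x"
  by (simp add: free_extension_def free_gen_def linear_extension_single)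

lemma free_extension_add: "free_extension g (a + b) = free_extension g a + free_extension g b"
  and free_extension_diff: "free_extension g (a - b) = free_extension g a - free_extension g b"
  and free_extension_zero: "free_extension g 0 = 0"
  by (simp_all add: free_extension_def linear_extension_add linear_extension_diff linear_extension_zero)

lemmas free_extension_simps = free_extension_mult free_extension_scalar free_extension_one
  free_extension_gen free_extension_add free_extension_diff free_extension_zero

lemma presented_universal:
  fixes g :: "'g::algebra_presentation \<Rightarrow> 'b::complex_algebra_1"
  assumes "\<And>r. r \<in> relators \<Longrightarrow> free_extension g r = 0"
  shows "\<exists>\<phi>. algebra_hom \<phi> \<and> (\<forall>x. \<phi> (gen x) = g x)"
proof -
  have ideal: "free_extension g r = 0" if "r \<in> two_sided_ideal relators" for r
    using that by induction (simp_all add: assms free_extension_simps)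
  define \<phi> where "\<phi> a = free_extension g (rep_presented a)" for a
  have abs: "\<phi> (abs_presented f) = free_extension g f" for f
  proof -
    have "presented_eq (rep_presented (abs_presented f)) f"
      by (simp add: Quotient3_rep_abs Quotient3_presented equivp_reflp[OF equivp_presented_eq])
    then have "free_extension g (rep_presented (abs_presented f) - f) = 0"
      unfolding presented_eq_def by (rule ideal)
    then show ?thesis by (simp add: \<phi>_def free_extension_diff)
  qed
  have surj: "\<exists>f. a = abs_presented f" for a :: "'g presented"
    by (metis Quotient3_abs_rep Quotient3_presented)
  have "\<phi> (a + b) = \<phi> a + \<phi> b" "\<phi> (a * b) = \<phi> a * \<phi> b" "\<phi> (c *\<^sub>C a) = c *\<^sub>C \<phi> a" for a b c
    using surj[of a] surj[of b]
    by (auto simp: plus_presented.abs_eq times_presented.abs_eq scaleC_presented.abs_eq abs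
        free_extension_simps mult_scaleC_left)
  moreover have "\<phi> 1 = 1" "\<phi> (gen x) = g x" for x
    by (simp_all add: one_presented_def gen_def abs free_extension_simps)
  ultimately show ?thesis by (auto simp: algebra_hom_def)
qed

lemma presented_induct [case_names one add scale gen]:
  fixes a :: "'g::algebra_presentation presented"
  assumes "P 1" "\<And>a b. P a \<Longrightarrow> P b \<Longrightarrow> P (a + b)" "\<And>c a. P a \<Longrightarrow> P (c *\<^sub>C a)"
    and "\<And>x a. P a \<Longrightarrow> P (gen x * a)"
  shows "P a"
proof -
  have word: "P (abs_presented (Poly_Mapping.single (Word gs) 1))" for gs
  proof (induction gs)
    case Nil
    have "abs_presented (Poly_Mapping.single (Word []) 1) = (1 :: 'g presented)"
      by (simp add: one_presented_def flip: zero_word_def)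
    then show ?case using assms(1) by simp
  next
    case (Cons g gs)
    have "abs_presented (Poly_Mapping.single (Word (g # gs)) 1)
        = gen g * abs_presented (Poly_Mapping.single (Word gs) 1)"
      by (simp add: gen_def times_presented.abs_eq free_gen_def mult_single)
    then show ?case using assms(4) Cons.IH by simp
  qed
  have "P (abs_presented f)" for f
  proof (induction f rule: poly_mapping_single_induct)
    case zero
    have "abs_presented 0 = (0 :: 'g presented)" by (simp add: zero_presented_def)
    also have "\<dots> = 0 *\<^sub>C 1" by simp
    finally show ?case using assms(1,3) by metis
  next
    case (add f g)
    then show ?case using assms(2) by (metis plus_presented.abs_eq)
  next
    case (single w c)
    obtain gs where w: "w = Word gs" by (cases w)
    have "abs_presented (Poly_Mapping.single w c)
      = c *\<^sub>C abs_presented (Poly_Mapping.single (Word gs) 1)"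
      by (simp add: w scaleC_presented.abs_eq mult_single)
    then show ?case using assms(3) word by simp
  qed
  then show ?thesis by (metis Quotient3_abs_rep Quotient3_presented)
qed

lemma bilinear_null_base: "r \<in> bilinear_relators \<Longrightarrow> r \<in> bilinear_null"
  unfolding bilinear_null_def by (rule pairs.span_base)

lemma tensor_add_left: "(a + a') \<otimes> b = a \<otimes> b + a' \<otimes> b"
  for a a' :: "'a::complex_algebra_1" and b :: "'b::complex_algebra_1"
proof transfer
  fix a a' :: 'a and b :: 'b
  show "tensor_eq (free_pair (a + a') b) (free_pair a b + free_pair a' b)"
    unfolding tensor_eq_def diff_diff_eq[symmetric]
    by (rule bilinear_null_base) (unfold bilinear_relators_def, blast)
qed

lemma tensor_add_right: "a \<otimes> (b + b') = a \<otimes> b + a \<otimes> b'"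
  for a :: "'a::complex_algebra_1" and b b' :: "'b::complex_algebra_1"
proof transfer
  fix a :: 'a and b b' :: 'b
  show "tensor_eq (free_pair a (b + b')) (free_pair a b + free_pair a b')"
    unfolding tensor_eq_def diff_diff_eq[symmetric]
    by (rule bilinear_null_base) (unfold bilinear_relators_def, blast)
qed

lemma tensor_scale_left: "(c *\<^sub>C a) \<otimes> b = c *\<^sub>C (a \<otimes> b)"
  for a :: "'a::complex_algebra_1" and b :: "'b::complex_algebra_1"
proof transfer
  fix a :: 'a and b :: 'b and c :: complex
  show "tensor_eq (free_pair (c *\<^sub>C a) b) (scale_pairs c (free_pair a b))"
    unfolding tensor_eq_def by (rule bilinear_null_base) (unfold bilinear_relators_def, blast)
qed

lemma tensor_scale_right: "a \<otimes> (c *\<^sub>C b) = c *\<^sub>C (a \<otimes> b)"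
  for a :: "'a::complex_algebra_1" and b :: "'b::complex_algebra_1"
proof transfer
  fix a :: 'a and b :: 'b and c :: complex
  show "tensor_eq (free_pair a (c *\<^sub>C b)) (scale_pairs c (free_pair a b))"
    unfolding tensor_eq_def by (rule bilinear_null_base) (unfold bilinear_relators_def, blast)
qed

lemma tensor_induct [case_names tensor add]:
  fixes x :: "('a::complex_algebra_1, 'b::complex_algebra_1) tensor"
  assumes "\<And>a b. P (a \<otimes> b)" "\<And>x y. P x \<Longrightarrow> P y \<Longrightarrow> P (x + y)"
  shows "P x"
proof -
  have "P (abs_tensor f)" for f
  proof (induction f rule: poly_mapping_single_induct)
    case zero
    have "abs_tensor 0 = (0 :: ('a, 'b) tensor)" by (simp add: zero_tensor_def)
    also have "\<dots> = 0 *\<^sub>C (1 \<otimes> 1)" by simp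
    also have "\<dots> = (0 *\<^sub>C 1) \<otimes> 1" by (rule tensor_scale_left[symmetric])
    finally show ?case using assms(1) by metis
  next
    case (add f g)
    then show ?case using assms(2) by (metis plus_tensor.abs_eq)
  next
    case (single k c)
    obtain a b where k: "k = TPair a b" by (cases k)
    have "Poly_Mapping.single k c = scale_pairs c (free_pair a b)"
      by (auto simp: k free_pair_def lookup_scale_pairs lookup_single when_def intro!: poly_mapping_eqI)
    then have "abs_tensor (Poly_Mapping.single k c) = (c *\<^sub>C a) \<otimes> b"
      by (simp add: tensor_scale_left) (simp add: tensor_def scaleC_tensor.abs_eq)
    then show ?case using assms(1) by simp
  qed
  then show ?thesis by (metis Quotient3_abs_rep Quotient3_tensor)
qed

lemma tensor_universal:
  fixes \<beta> :: "'a::complex_algebra_1 \<Rightarrow> 'b::complex_algebra_1 \<Rightarrow> 'v::complex_vector"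
  assumes "\<And>b. clinear (\<lambda>a. \<beta> a b)" "\<And>a. clinear (\<beta> a)"
  shows "\<exists>F. clinear F \<and> (\<forall>a b. F (a \<otimes> b) = \<beta> a b)"
proof -
  define L where "L = linear_extension (\<lambda>k. case k of TPair a b \<Rightarrow> \<beta> a b)"
  have L_pair: "L (free_pair a b) = \<beta> a b" for a b
    by (simp add: L_def free_pair_def linear_extension_single scaleC_one)
  have L_lin: "L (f + f') = L f + L f'" "L (f - f') = L f - L f'" "L 0 = 0" for f f'
    by (simp_all add: L_def linear_extension_add linear_extension_diff linear_extension_zero)
  have L_scale: "L (scale_pairs c f) = c *\<^sub>C L f" for c f
  proof (induction f rule: poly_mapping_single_induct)
    case (add f g)
    then show ?case
      by (simp add: pairs.scale_right_distrib L_lin complex_vector.scale_right_distrib)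
  next
    case (single k d)
    have "scale_pairs c (Poly_Mapping.single k d) = Poly_Mapping.single k (c * d)"
      by (auto simp: lookup_scale_pairs lookup_single when_def intro!: poly_mapping_eqI)
    then show ?case by (simp add: L_def linear_extension_single)
  qed (simp add: L_lin)
  have relator: "L r = 0" if "r \<in> bilinear_relators" for r
    using that clinear_add[OF assms(1)] clinear_scale[OF assms(1)]
      clinear_add[OF assms(2)] clinear_scale[OF assms(2)]
    by (auto simp: bilinear_relators_def L_lin L_scale L_pair)
  have null: "L r = 0" if "r \<in> bilinear_null" for r
    using that unfolding bilinear_null_def
    by (induction rule: pairs.span_induct_alt) (simp_all add: L_lin L_scale relator)
  define F where "F x = L (rep_tensor x)" for x
  have abs: "F (abs_tensor f) = L f" for f
  proof -
    have "tensor_eq (rep_tensor (abs_tensor f)) f"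
      by (simp add: Quotient3_rep_abs Quotient3_tensor equivp_reflp[OF equivp_tensor_eq])
    then have "L (rep_tensor (abs_tensor f) - f) = 0"
      unfolding tensor_eq_def by (rule null)
    then show ?thesis by (simp add: F_def L_lin)
  qed
  have surj: "\<exists>f. x = abs_tensor f" for x :: "('a, 'b) tensor"
    by (metis Quotient3_abs_rep Quotient3_tensor)
  have "F (x + y) = F x + F y" "F (c *\<^sub>C x) = c *\<^sub>C F x" for x y c
    using surj[of x] surj[of y]
    by (auto simp: plus_tensor.abs_eq scaleC_tensor.abs_eq abs L_lin L_scale)
  moreover have "F (a \<otimes> b) = \<beta> a b" for a b by (simp add: tensor_def abs L_pair)
  ultimately show ?thesis by (auto simp: clinear_def)
qed

section \<open>The grading of the Weyl-Clifford algebra\<close>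

lemma clifford_involution_exists:
  "\<exists>\<phi> :: 'n clifford \<Rightarrow> 'n clifford. algebra_hom \<phi> \<and> (\<forall>x. \<phi> (gen x) = - gen x)"
proof (rule presented_universal)
  fix r :: "'n clifford_gen free_algebra"
  assume "r \<in> relators"
  then obtain i j where r: "r
    = free_gen (GenE i) * free_gen (GenE j) + free_gen (GenE j) * free_gen (GenE i)
      - (if i = j then 2 else 0)"
    unfolding relators_clifford_gen_def Let_def by blast
  have two: "free_extension (\<lambda>x. - gen x :: 'n clifford) 2 = 1 + 1"
    unfolding one_add_one[symmetric] by (simp only: free_extension_simps)
  show "free_extension (\<lambda>x. - gen x) r = 0"
    using clifford_relation[of i j] by (auto simp: r free_extension_simps two ce_def)
qed

definition clifford_grading :: "'n clifford \<Rightarrow> 'n clifford" where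
  "clifford_grading = (SOME \<phi>. algebra_hom \<phi> \<and> (\<forall>x. \<phi> (gen x) = - gen x))"

lemma clifford_grading: "algebra_hom clifford_grading" "clifford_grading (ce i) = - ce i"
  using someI_ex[OF clifford_involution_exists] unfolding clifford_grading_def[symmetric] ce_def
  by blast+

lemma clifford_grading_involutive: "clifford_grading (clifford_grading c) = c"
proof (induction c rule: presented_induct)
  case (gen x a)
  obtain i where "x = GenE i" by (cases x)
  then have "gen x = ce i" by (simp add: ce_def)
  then show ?case using gen
    by (simp add: algebra_hom_mult[OF clifford_grading(1)] clifford_grading(2)
        clinear_uminus[OF algebra_hom_clinear[OF clifford_grading(1)]])
qed (simp_all add: algebra_hom_one[OF clifford_grading(1)]
    clinear_add[OF algebra_hom_clinear[OF clifford_grading(1)]]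
    clinear_scale[OF algebra_hom_clinear[OF clifford_grading(1)]])

lemma clifford_grading_word:
  "clifford_grading (prod_list (map ce is)) = (- 1) ^ length is *\<^sub>C prod_list (map ce is)"
  by (induction "is") (simp_all add: algebra_hom_one[OF clifford_grading(1)]
      algebra_hom_mult[OF clifford_grading(1)] clifford_grading(2) mult_scaleC_right)

lemma clinear_tensor: "clinear (\<lambda>a. a \<otimes> b)" "clinear (\<lambda>b. a \<otimes> b)"
  for a :: "'a::complex_algebra_1" and b :: "'b::complex_algebra_1"
  by (simp_all add: clinear_def tensor_add_left tensor_add_right tensor_scale_left tensor_scale_right)

lemma grading_exists:
  "\<exists>F :: 'n weyl_clifford \<Rightarrow> 'n weyl_clifford. clinear F
  \<and> (\<forall>w c. F (w \<otimes> c) = w \<otimes> clifford_grading c)"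
  by (rule tensor_universal)
    (simp_all add: clinear_tensor clinear_def tensor_add_left tensor_add_right tensor_scale_left
      tensor_scale_right clinear_add[OF algebra_hom_clinear[OF clifford_grading(1)]]
      clinear_scale[OF algebra_hom_clinear[OF clifford_grading(1)]])

definition grading :: "'n weyl_clifford \<Rightarrow> 'n weyl_clifford" where
  "grading = (SOME F. clinear F \<and> (\<forall>w c. F (w \<otimes> c) = w \<otimes> clifford_grading c))"

lemma grading_linear: "clinear grading" and grading_tensor: "grading (w \<otimes> c)
  = w \<otimes> clifford_grading c"
  using someI_ex[OF grading_exists] unfolding grading_def[symmetric] by blast+

lemma grading_mult: "grading (x * y) = grading x * grading y"
proof (induction x rule: tensor_induct)
  case (tensor w c)
  show ?case
    by (induction y rule: tensor_induct)
      (simp_all add: tensor_mult_tensor grading_tensor algebra_hom_mult[OF clifford_grading(1)]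
        distrib_left clinear_add[OF grading_linear])
qed (simp add: distrib_right clinear_add[OF grading_linear])

lemma grading_involutive: "grading (grading x) = x"
  by (induction x rule: tensor_induct)
    (simp_all add: grading_tensor clifford_grading_involutive clinear_add[OF grading_linear])

lemma grading_one: "grading 1 = 1"
  by (simp add: one_tensor grading_tensor algebra_hom_one[OF clifford_grading(1)])

lemma clifford_even_grading: "c \<in> clifford_even \<Longrightarrow> clifford_grading c = c"
  unfolding clifford_even_def
  by (induction rule: complex_vector.span_induct_alt)
    (auto simp: clifford_grading_word clinear_add[OF algebra_hom_clinear[OF clifford_grading(1)]]
      clinear_scale[OF algebra_hom_clinear[OF clifford_grading(1)]]
      clinear_zero[OF algebra_hom_clinear[OF clifford_grading(1)]])

lemma clifford_odd_grading: "c \<in> clifford_odd \<Longrightarrow> clifford_grading c = - c"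
  unfolding clifford_odd_def
  by (induction rule: complex_vector.span_induct_alt)
    (auto simp: clifford_grading_word clinear_add[OF algebra_hom_clinear[OF clifford_grading(1)]]
      clinear_scale[OF algebra_hom_clinear[OF clifford_grading(1)]]
      clinear_zero[OF algebra_hom_clinear[OF clifford_grading(1)]])

lemma wc_odd_grading: "a \<in> wc_odd \<Longrightarrow> grading a = - a"
  unfolding wc_odd_def
  by (induction rule: complex_vector.span_induct_alt)
    (auto simp: grading_tensor clifford_odd_grading clinear_add[OF grading_linear]
      clinear_scale[OF grading_linear]
      clinear_zero[OF grading_linear] clinear_uminus[OF clinear_tensor(2)])

text \<open>
  In a combination of words this doubles the words of even length and cancels those of odd length.
\<close>

lemma clifford_even_symmetrise: "c + clifford_grading c \<in> clifford_even"
proof -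
  have "c \<in> cspan (range (\<lambda>is. prod_list (map ce is)))"
  proof (induction c rule: presented_induct)
    case one
    show ?case by (rule complex_vector.span_base) (auto intro!: image_eqI[of _ _ "[]"])
  next
    case (gen x a)
    obtain i where x: "gen x = ce i" by (cases x) (auto simp: ce_def)
    from gen show ?case unfolding x
    proof (induction rule: complex_vector.span_induct_alt)
      case (step c w b)
      then obtain js where "w = prod_list (map ce js)" by auto
      then have "ce i * w = prod_list (map ce (i # js))" by simp
      then have "ce i * w \<in> cspan (range (\<lambda>is. prod_list (map ce is)))"
        by (metis complex_vector.span_base rangeI)
      then show ?case using step
        by (simp add: distrib_left mult_scaleC_right complex_vector.span_add
          complex_vector.span_scale)
    qed (simp add: complex_vector.span_zero)
  qed (auto intro: complex_vector.span_add complex_vector.span_scale)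
  then show ?thesis
  proof (induction rule: complex_vector.span_induct_alt)
    case base
    then show ?case
      by (simp add: clinear_zero[OF algebra_hom_clinear[OF clifford_grading(1)]] clifford_even_def
        complex_vector.span_zero)
  next
    case (step d w b)
    then obtain js where w: "w = prod_list (map ce js)" by auto
    have wd: "w + clifford_grading w \<in> clifford_even"
    proof (cases "even (length js)")
      case True
      then have "w \<in> clifford_even" unfolding clifford_even_def w
        by (intro complex_vector.span_base) auto
      then show ?thesis using True
        by (simp add: w clifford_grading_word clifford_even_def complex_vector.span_add)
    next
      case False
      then show ?thesis
        by (simp add: w clifford_grading_word clifford_even_def complex_vector.span_zero)
    qed
    have e: "d *\<^sub>C w + b + clifford_grading (d *\<^sub>C w + b)
        = d *\<^sub>C (w + clifford_grading w) + (b + clifford_grading b)"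
      by (simp add: clinear_add[OF algebra_hom_clinear[OF clifford_grading(1)]]
          clinear_scale[OF algebra_hom_clinear[OF clifford_grading(1)]]
            complex_vector.scale_right_distrib)
    show ?case
      unfolding e clifford_even_def
      by (rule complex_vector.span_add[OF complex_vector.span_scale
            [OF wd[unfolded clifford_even_def]] step(2)[unfolded clifford_even_def]])
  qed
qed

text \<open>
  As the fixed points of an automorphism the even part is visibly a subalgebra, and membership can
  be computed; for the converse, \<open>a\<close> is half of \<open>a + grading a\<close>.
\<close>

lemma wc_even_iff: "a \<in> wc_even \<longleftrightarrow> grading a = a"
proof
  assume "a \<in> wc_even"
  then show "grading a = a" unfolding wc_even_def
    by (induction rule: complex_vector.span_induct_alt)
      (auto simp: grading_tensor clifford_even_grading clinear_add[OF grading_linear]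
        clinear_scale[OF grading_linear] clinear_zero[OF grading_linear])
next
  assume a: "grading a = a"
  have "x + grading x \<in> wc_even" for x :: "'a weyl_clifford"
  proof (induction x rule: tensor_induct)
    case (tensor w c)
    then show ?case unfolding wc_even_def grading_tensor tensor_add_right[symmetric]
      using clifford_even_symmetrise by (intro complex_vector.span_base) blast
  next
    case (add x y)
    have e: "x + y + grading (x + y) = (x + grading x) + (y + grading y)"
      by (simp add: clinear_add[OF grading_linear])
    show ?case unfolding e wc_even_def
      by (rule complex_vector.span_add[OF add[unfolded wc_even_def]])
  qed
  from this[of a] have "(1/2) *\<^sub>C (a + a) \<in> wc_even"
    unfolding a wc_even_def by (rule complex_vector.span_scale)
  then show "a \<in> wc_even" by (simp flip: scaleC_two)
qed

lemma wc_even_odd_disjoint: "a \<in> wc_even \<Longrightarrow> a \<in> wc_odd \<Longrightarrow> a = 0"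
  using wc_odd_grading[of a] by (metis add.right_inverse double_zero wc_even_iff)

lemma wc_zero: "0 \<in> wc_even" "0 \<in> wc_odd"
  by (simp_all add: wc_even_def wc_odd_def complex_vector.span_zero)

text \<open>
  The parts are given by definite description; they are well defined since an element that is both
  even and odd equals its own negative.
\<close>

lemma even_part_even: "a \<in> wc_even \<Longrightarrow> even_part a = a"
  unfolding even_part_def
proof (rule the_equality)
  fix b assume "a \<in> wc_even" "b \<in> wc_even \<and> a - b \<in> wc_odd"
  then show "b = a"
    using wc_even_odd_disjoint[of "a - b"] by (simp add: wc_even_def complex_vector.span_diff)
qed (simp add: wc_zero)

lemma even_part_odd: "a \<in> wc_odd \<Longrightarrow> even_part a = 0"
  unfolding even_part_def
proof (rule the_equality)
  fix b assume a: "a \<in> wc_odd" and b: "b \<in> wc_even \<and> a - b \<in> wc_odd"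
  have "a - (a - b) \<in> wc_odd" unfolding wc_odd_def
    by (rule complex_vector.span_diff[OF a[unfolded wc_odd_def]
      conjunct2[OF b, unfolded wc_odd_def]])
  then have "b \<in> wc_odd" by simp
  then show "b = 0" using wc_even_odd_disjoint b by blast
qed (simp add: wc_zero)

lemma graded_commutator_even_odd: "a \<in> wc_even \<Longrightarrow> b \<in> wc_odd \<Longrightarrow> graded_commutator a b = a * b - b * a"
  by (simp add: graded_commutator_def even_part_even even_part_odd odd_part_def Let_def)

lemma tensor_ce_odd: "w \<otimes> ce j \<in> wc_odd"
proof -
  have "ce j \<in> clifford_odd" unfolding clifford_odd_def
    by (rule complex_vector.span_base) (auto intro!: exI[of _ "[j]"])
  then show ?thesis unfolding wc_odd_def by (intro complex_vector.span_base) blast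
qed

lemma TAMA_even_iff:
  fixes a :: "'n::finite weyl_clifford"
  shows "a \<in> TAMA_even \<longleftrightarrow> grading a = a \<and> a * dirac_operator = dirac_operator * a
    \<and> a * vector_variable = vector_variable * a"
proof -
  have "(dirac_operator :: 'n weyl_clifford) \<in> wc_odd"
    "(vector_variable :: 'n weyl_clifford) \<in> wc_odd"
    unfolding dirac_operator_def vector_variable_def wc_odd_def
    by (intro complex_vector.span_sum tensor_ce_odd[unfolded wc_odd_def])+
  then show ?thesis
    by (auto simp: TAMA_even_def TAMA_def wc_even_iff[symmetric] graded_commutator_even_odd)
qed

section \<open>The Weyl-Clifford algebra as a Fock space\<close>

definition wcx :: "'n \<Rightarrow> 'n weyl_clifford" where "wcx i = wx i \<otimes> 1"
definition wcy :: "'n \<Rightarrow> 'n weyl_clifford" where "wcy i = wy i \<otimes> 1"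
definition wce :: "'n \<Rightarrow> 'n weyl_clifford" where "wce i = 1 \<otimes> ce i"

lemma weyl_commute: "wx i * wx j = wx j * wx i" "wy i * wy j = wy j * wy i"
proof -
  have "abs_presented (free_gen (GenX i) * free_gen (GenX j))
    = abs_presented (free_gen (GenX j) * free_gen (GenX i))"
    "abs_presented (free_gen (GenY i) * free_gen (GenY j))
    = abs_presented (free_gen (GenY j) * free_gen (GenY i))"
    by (rule presented_relator, unfold relators_weyl_gen_def Let_def, blast)+
  then show "wx i * wx j = wx j * wx i" "wy i * wy j = wy j * wy i"
    by (simp_all add: wx_def wy_def gen_def times_presented.abs_eq)
qed

lemma wc_commute: "wcx i * wcx j = wcx j * wcx i" "wcy i * wcy j = wcy j * wcy i"
  "wcx i * wce j = wce j * wcx i" "wcy i * wce j = wce j * wcy i"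
  by (simp_all add: wcx_def wcy_def wce_def tensor_mult_tensor weyl_commute[of i j])

lemma tensor_zero: "0 \<otimes> b = 0" "a \<otimes> 0 = 0"
  for a :: "'a::complex_algebra_1" and b :: "'b::complex_algebra_1"
  using clinear_zero[OF clinear_tensor(1)] clinear_zero[OF clinear_tensor(2)] by auto

lemma wc_weyl_relation: "wcy i * wcx j = wcx j * wcy i + (if i = j then 1 else 0)"
proof -
  have "wy i * wx j = wx j * wy i + (if i = j then 1 else 0)"
    using weyl_relation[of i j] by (simp add: algebra_simps)
  then show ?thesis
    by (simp add: wcx_def wcy_def tensor_mult_tensor tensor_add_left one_tensor tensor_zero)
qed

lemma wc_clifford_relation: "wce i * wce j + wce j * wce i = (if i = j then 1 + 1 else 0)"
  using clifford_relation[of i j]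
  by (simp add: wce_def tensor_mult_tensor tensor_add_right[symmetric]
    one_tensor tensor_zero split: if_splits)

lemma grading_generators: "grading (wcx i) = wcx i" "grading (wcy i) = wcy i"
  "grading (wce i) = - wce i"
  by (simp_all add: wcx_def wcy_def wce_def grading_tensor algebra_hom_one[OF clifford_grading(1)]
      clifford_grading(2) clinear_uminus[OF clinear_tensor(2)])

lemma weyl_clifford_induct:
  fixes a :: "'n weyl_clifford"
  assumes "P 1" "\<And>a b. P a \<Longrightarrow> P b \<Longrightarrow> P (a + b)" "\<And>c a. P a \<Longrightarrow> P (c *\<^sub>C a)"
    and "\<And>i a. P a \<Longrightarrow> P (wcx i * a)" "\<And>i a. P a \<Longrightarrow> P (wcy i * a)" "\<And>i a. P a \<Longrightarrow> P (wce i * a)"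
  shows "P a"
proof (induction a rule: tensor_induct)
  case (tensor w c)
  show ?case
  proof (induction w arbitrary: c rule: presented_induct)
    case one
    show ?case
    proof (induction c rule: presented_induct)
      case one
      show ?case using assms(1) by (simp add: one_tensor)
    next
      case (gen x c)
      obtain i where x: "gen x = ce i" by (cases x) (auto simp: ce_def)
      show ?case using assms(6)[OF gen, of i] by (simp add: x wce_def tensor_mult_tensor)
    qed (simp_all add: tensor_add_right tensor_scale_right assms)
  next
    case (gen x w)
    then show ?case
      using assms(4)[of "w \<otimes> c"] assms(5)[of "w \<otimes> c"]
      by (cases x) (auto simp: wcx_def wcy_def wx_def wy_def tensor_mult_tensor)
  qed (simp_all add: tensor_add_left tensor_scale_left assms)
qed (rule assms)

text \<open>
  Symmetrised multiplication and commutator are the multiplication and derivative operators of the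
  Moyal calculus. For an odd generator the right multiplication is twisted by the grading, so that
  \<open>\<epsilon> = 1\<close> gives a multiplication by an exterior variable and \<open>\<epsilon> = - 1\<close> the derivative in it.
\<close>

definition half_anti :: "'a::complex_algebra_1 \<Rightarrow> 'a \<Rightarrow> 'a" where
  "half_anti u a = (1/2) *\<^sub>C (u * a + a * u)"
definition comm :: "'a::complex_algebra_1 \<Rightarrow> 'a \<Rightarrow> 'a" where
  "comm u a = u * a - a * u"
definition half_twisted :: "complex \<Rightarrow> 'n weyl_clifford \<Rightarrow> 'n weyl_clifford \<Rightarrow> 'n weyl_clifford" where
  "half_twisted \<epsilon> u a = (1/2) *\<^sub>C (u * a + \<epsilon> *\<^sub>C (grading a * u))"

lemmas sc_simps = complex_vector.scale_right_distrib complex_vector.scale_right_diff_distrib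
  mult_scaleC_left mult_scaleC_right distrib_left distrib_right left_diff_distrib right_diff_distrib

lemma half_anti_linear: "clinear (half_anti u)"
  by (simp add: clinear_def half_anti_def sc_simps complex_vector.scale_left_commute mult.commute)

lemma comm_linear: "clinear (comm u)"
  by (simp add: clinear_def comm_def sc_simps)

lemma half_twisted_linear: "clinear (half_twisted \<epsilon> u)"
  by (simp add: clinear_def half_twisted_def sc_simps clinear_add[OF grading_linear]
      clinear_scale[OF grading_linear] mult.commute mult.left_commute)

lemma comm_half_anti:
  assumes "u * v = v * u + c *\<^sub>C 1"
  shows "comm u (half_anti v a) = half_anti v (comm u a) + c *\<^sub>C a"
proof -
  have "comm u (half_anti v a)
    = half_anti v (comm u a) + (1/2) *\<^sub>C ((u * v - v * u) * a + a * (u * v - v * u))"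
    by (simp add: comm_def half_anti_def sc_simps mult.assoc algebra_simps)
  also have "u * v - v * u = c *\<^sub>C 1" using assms by simp
  finally show ?thesis by (simp add: mult_scaleC_left mult_scaleC_right flip: scaleC_two)
qed

lemma comm_comm:
  assumes "u * v = v * u + c *\<^sub>C 1"
  shows "comm u (comm v a) = comm v (comm u a)"
proof -
  have 1: "u * (v * x) = v * (u * x) + c *\<^sub>C x" for x
    using arg_cong[OF assms, of "\<lambda>z. z * x"] by (simp add: sc_simps mult.assoc)
  show ?thesis by (simp add: comm_def sc_simps mult.assoc 1 assms)
qed

lemma half_anti_half_anti:
  assumes "u * v = v * u + c *\<^sub>C 1"
  shows "half_anti u (half_anti v a) = half_anti v (half_anti u a)"
proof -
  have 1: "u * (v * x) = v * (u * x) + c *\<^sub>C x" for x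
    using arg_cong[OF assms, of "\<lambda>z. z * x"] by (simp add: sc_simps mult.assoc)
  show ?thesis by (simp add: half_anti_def sc_simps mult.assoc 1 assms)
qed

lemma half_twisted_commute:
  assumes "u * v = v * u" "grading u = u"
  shows "half_twisted \<epsilon> v (half_anti u a) = half_anti u (half_twisted \<epsilon> v a)"
    "half_twisted \<epsilon> v (comm u a) = comm u (half_twisted \<epsilon> v a)"
proof -
  have 1: "u * (v * x) = v * (u * x)" for x
    using arg_cong[OF assms(1), of "\<lambda>z. z * x"] by (simp add: mult.assoc)
  have 2: "\<epsilon> *\<^sub>C (1/2) *\<^sub>C x = (1/2) *\<^sub>C \<epsilon> *\<^sub>C x" for x :: "'a weyl_clifford"
    by (simp add: mult.commute)
  show "half_twisted \<epsilon> v (half_anti u a) = half_anti u (half_twisted \<epsilon> v a)"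
    "half_twisted \<epsilon> v (comm u a) = comm u (half_twisted \<epsilon> v a)"
    by (simp_all add: half_twisted_def half_anti_def comm_def sc_simps mult.assoc 1 assms
      clinear_add[OF grading_linear] clinear_diff[OF grading_linear]
        clinear_scale[OF grading_linear] grading_mult)
qed

text \<open>
  With \<open>c = 2 \<delta>\<^sub>i\<^sub>j\<close> the sign \<open>\<epsilon> \<eta>\<close> decides: equal signs anticommute, opposite signs give the
  fermionic relation.
\<close>

lemma half_twisted_half_twisted:
  assumes "u * v + v * u = c *\<^sub>C 1" "grading u = - u" "grading v = - v"
  shows "half_twisted \<epsilon> u (half_twisted \<eta> v a) + half_twisted \<eta> v (half_twisted \<epsilon> u a)
     = (c * (1 - \<epsilon> * \<eta>) / 4) *\<^sub>C a"
proof -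
  have "half_twisted \<epsilon> u (half_twisted \<eta> v a) + half_twisted \<eta> v (half_twisted \<epsilon> u a)
    = (1/4) *\<^sub>C ((u * v + v * u) * a - (\<epsilon> * \<eta>) *\<^sub>C (a * (u * v + v * u)))"
    by (simp add: half_twisted_def sc_simps mult.assoc assms(2,3) grading_mult grading_involutive
      clinear_add[OF grading_linear] clinear_scale[OF grading_linear] algebra_simps)
  also have "\<dots> = (1/4) *\<^sub>C (c *\<^sub>C a - (\<epsilon> * \<eta>) *\<^sub>C c *\<^sub>C a)"
    unfolding assms(1) by (simp add: sc_simps)
  also have "\<dots> = ((1/4) * (c - \<epsilon> * \<eta> * c)) *\<^sub>C a"
    by (simp only: scaleC_scaleC complex_vector.scale_left_diff_distrib[symmetric])
  also have "(1/4) * (c - \<epsilon> * \<eta> * c) = c * (1 - \<epsilon> * \<eta>) / 4"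
    by (simp add: right_diff_distrib mult.commute)
  finally show ?thesis .
qed

lemma scale_if: "(if P then 1 else 0) *\<^sub>C x = (if P then x else 0)"
  for x :: "'a::complex_vector"
  by (simp add: scaleC_one)

text \<open>
  The derivative in \<open>y\<^sub>i\<close> is the commutator with \<open>- x\<^sub>i\<close>. Left multiplication by \<open>x\<^sub>i\<close> is
  \<open>X\<^sub>i - PY\<^sub>i / 2\<close>, and similarly for the other generators; hence the vacuum \<open>1\<close> is cyclic.
\<close>

interpretation fock: superfock
  "\<lambda>i. half_anti (wcx i :: 'n::finite weyl_clifford)" "\<lambda>i. half_anti (wcy i)"
  "\<lambda>i. half_twisted 1 (wce i)"
  "\<lambda>i. comm (wcy i)" "\<lambda>i. comm (- wcx i)" "\<lambda>i. half_twisted (- 1) (wce i)" grading 1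
proof
  have w1: "wcy i * wcx j = wcx j * wcy i + (if i = j then 1 else 0) *\<^sub>C 1" for i j :: 'n
    by (simp add: wc_weyl_relation scale_if)
  have w2: "- wcx i * wcy j = wcy j * (- wcx i) + (if i = j then 1 else 0) *\<^sub>C 1" for i j :: 'n
    using wc_weyl_relation[of j i] by (auto simp: scale_if)
  have w3: "wcy i * wcy j = wcy j * wcy i + 0 *\<^sub>C 1" "wcx i * wcx j = wcx j * wcx i + 0 *\<^sub>C 1"
    "(- wcx i) * wcx j = wcx j * (- wcx i) + 0 *\<^sub>C 1"
    "(- wcx i) * (- wcx j) = (- wcx j) * (- wcx i) + 0 *\<^sub>C 1" for i j :: 'n
    using wc_commute(1)[of i j] wc_commute(2)[of i j] by simp_all
  have e: "wce i * wce j + wce j * wce i = (if i = j then 2 else 0) *\<^sub>C 1" for i j :: 'n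
    using wc_clifford_relation[of i j] by (simp add: scaleC_two)
  have g: "grading (wce i) = - wce i" for i :: 'n by (rule grading_generators)
  fix i j :: 'n and f :: "'n weyl_clifford"
  show "clinear (half_anti (wcx i))" "clinear (half_anti (wcy i))"
    "clinear (half_twisted 1 (wce i))"
    "clinear (comm (wcy i))" "clinear (comm (- wcx i))" "clinear (half_twisted (- 1) (wce i))"
    "clinear grading"
    by (rule half_anti_linear comm_linear half_twisted_linear grading_linear)+
  show "comm (wcy i) (half_anti (wcx j) f)
    = half_anti (wcx j) (comm (wcy i) f) + (if i = j then f else 0)"
    using comm_half_anti[OF w1, of i j f] by (simp only: scale_if)
  show "comm (- wcx i) (half_anti (wcy j) f)
    = half_anti (wcy j) (comm (- wcx i) f) + (if i = j then f else 0)"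
    using comm_half_anti[OF w2, of i j f] by (simp only: scale_if)
  show "comm (wcy i) (half_anti (wcy j) f) = half_anti (wcy j) (comm (wcy i) f)"
    using comm_half_anti[OF w3(1), of i j f] by simp
  show "comm (- wcx i) (half_anti (wcx j) f) = half_anti (wcx j) (comm (- wcx i) f)"
    using comm_half_anti[OF w3(3), of i j f] by simp
  show "comm (- wcx i) (comm (wcy j) f) = comm (wcy j) (comm (- wcx i) f)"
    by (rule comm_comm[OF w2])
  show "comm (wcy i) (comm (wcy j) f) = comm (wcy j) (comm (wcy i) f)"
    by (rule comm_comm[OF w3(1)])
  show "comm (- wcx i) (comm (- wcx j) f) = comm (- wcx j) (comm (- wcx i) f)"
    by (rule comm_comm[OF w3(4)])
  show "half_anti (wcy i) (half_anti (wcx j) f) = half_anti (wcx j) (half_anti (wcy i) f)"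
    by (rule half_anti_half_anti[OF w1])
  show "half_anti (wcx i) (half_anti (wcx j) f) = half_anti (wcx j) (half_anti (wcx i) f)"
    by (rule half_anti_half_anti[OF w3(2)])
  show "half_anti (wcy i) (half_anti (wcy j) f) = half_anti (wcy j) (half_anti (wcy i) f)"
    by (rule half_anti_half_anti[OF w3(1)])
  have c: "wcx i * wce j = wce j * wcx i" "wcy i * wce j = wce j * wcy i"
    "- wcx i * wce j = wce j * - wcx i" for i j :: 'n
    using wc_commute(3,4)[of i j] by simp_all
  have gx: "grading (- wcx i) = - wcx i" for i :: 'n
    by (simp add: clinear_uminus[OF grading_linear] grading_generators)
  show "comm (wcy i) (half_twisted 1 (wce j) f) = half_twisted 1 (wce j) (comm (wcy i) f)"
    "comm (- wcx i) (half_twisted 1 (wce j) f) = half_twisted 1 (wce j) (comm (- wcx i) f)"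
    by (rule half_twisted_commute(2)[OF c(2) grading_generators(2), symmetric]
        half_twisted_commute(2)[OF c(3) gx, symmetric])+
  show "half_twisted (- 1) (wce i) (half_anti (wcx j) f)
    = half_anti (wcx j) (half_twisted (- 1) (wce i) f)"
    "half_twisted (- 1) (wce i) (half_anti (wcy j) f)
    = half_anti (wcy j) (half_twisted (- 1) (wce i) f)"
    "half_twisted 1 (wce i) (half_anti (wcx j) f) = half_anti (wcx j) (half_twisted 1 (wce i) f)"
    "half_twisted 1 (wce i) (half_anti (wcy j) f) = half_anti (wcy j) (half_twisted 1 (wce i) f)"
    by (rule half_twisted_commute(1)[OF c(1) grading_generators(1)]
      half_twisted_commute(1)[OF c(2) grading_generators(2)])+
  show "half_twisted (- 1) (wce i) (comm (wcy j) f) = comm (wcy j) (half_twisted (- 1) (wce i) f)"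
    "half_twisted (- 1) (wce i) (comm (- wcx j) f) = comm (- wcx j) (half_twisted (- 1) (wce i) f)"
    by (rule half_twisted_commute(2)[OF c(2) grading_generators(2)]
      half_twisted_commute(2)[OF c(3) gx])+
  show "half_twisted (- 1) (wce i) (half_twisted 1 (wce j) f)
      = (if i = j then f else 0) - half_twisted 1 (wce j) (half_twisted (- 1) (wce i) f)"
    using half_twisted_half_twisted[OF e g g, of "- 1" i 1 j f]
    by (cases "i = j") (simp_all add: eq_diff_eq eq_neg_iff_add_eq_0)
  show "half_twisted 1 (wce i) (half_twisted 1 (wce j) f)
    = - half_twisted 1 (wce j) (half_twisted 1 (wce i) f)"
    using half_twisted_half_twisted[OF e g g, of 1 i 1 j f] by (simp add: eq_neg_iff_add_eq_0)
  show "half_twisted (- 1) (wce i) (half_twisted (- 1) (wce j) f)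
    = - half_twisted (- 1) (wce j) (half_twisted (- 1) (wce i) f)"
    using half_twisted_half_twisted[OF e g g, of "- 1" i "- 1" j f] by
      (simp add: eq_neg_iff_add_eq_0)
  show "grading (half_anti (wcx i) f) = half_anti (wcx i) (grading f)"
    "grading (half_anti (wcy i) f) = half_anti (wcy i) (grading f)"
    "grading (half_twisted 1 (wce i) f) = - half_twisted 1 (wce i) (grading f)"
    by (simp_all add: half_anti_def half_twisted_def grading_mult grading_generators sc_simps
      clinear_add[OF grading_linear] clinear_scale[OF grading_linear])
  show "grading 1 = 1" by (rule grading_one)
  show "comm (wcy i) 1 = 0" "comm (- wcx i) 1 = 0" "half_twisted (- 1) (wce i) 1 = 0"
    by (simp_all add: comm_def half_twisted_def grading_one)
next
  fix P :: "'n weyl_clifford \<Rightarrow> bool" and f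
  assume P: "P 1" "\<And>f g. P f \<Longrightarrow> P g \<Longrightarrow> P (f + g)" "\<And>c f. P f \<Longrightarrow> P (c *\<^sub>C f)"
    "\<And>i f. P f \<Longrightarrow> P (half_anti (wcx i) f + (- 1 / 2) *\<^sub>C comm (- wcx i) f)"
    "\<And>i f. P f \<Longrightarrow> P (half_anti (wcy i) f + (1 / 2) *\<^sub>C comm (wcy i) f)"
    "\<And>i f. P f \<Longrightarrow> P (half_twisted 1 (wce i) f + half_twisted (- 1) (wce i) f)"
  have eqs: "half_anti (wcx i) f + (- 1 / 2) *\<^sub>C comm (- wcx i) f
    = (1/2) *\<^sub>C (wcx i * f) + (1/2) *\<^sub>C (wcx i * f)"
    "half_anti (wcy i) f + (1 / 2) *\<^sub>C comm (wcy i) f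
    = (1/2) *\<^sub>C (wcy i * f) + (1/2) *\<^sub>C (wcy i * f)"
    "half_twisted 1 (wce i) f + half_twisted (- 1) (wce i) f
    = (1/2) *\<^sub>C (wce i * f) + (1/2) *\<^sub>C (wce i * f)" for i f
    by (simp_all add: half_anti_def comm_def half_twisted_def sc_simps)
  show "P f"
    by (rule weyl_clifford_induct[of P, OF P(1-3) P(4-6)[unfolded eqs scaleC_halves]])
qed

section \<open>Commutators and averages as Fock space operators\<close>

lemma half_twisted_commutator:
  assumes "u * e = e * u" "grading u = u" "grading a = a"
  shows "2 *\<^sub>C half_anti u (half_twisted (- 1) e a) + half_twisted 1 e (comm u a)
    = (u * e) * a - a * (u * e)"
proof -
  have 1: "u * (e * x) = e * (u * x)" for x
    using arg_cong[OF assms(1), of "\<lambda>z. z * x"] by (simp add: mult.assoc)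
  have "2 *\<^sub>C half_anti u (half_twisted (- 1) e a) + half_twisted 1 e (comm u a)
      = ((1/2) *\<^sub>C ((u * e) * a) + (1/2) *\<^sub>C ((u * e) * a)) - ((1/2) *\<^sub>C (a * (u * e)) + (1/2) *\<^sub>C (a * (u * e)))"
    by (simp add: half_anti_def half_twisted_def comm_def sc_simps mult.assoc 1 assms grading_mult
        clinear_diff[OF grading_linear] algebra_simps)
  then show ?thesis unfolding scaleC_halves .
qed

lemma dirac_commutator:
  fixes a :: "'n::finite weyl_clifford"
  assumes "grading a = a"
  shows "dirac_operator * a - a * dirac_operator = fock.ad_dirac a"
proof -
  have d: "dirac_operator = (\<Sum>j\<in>UNIV. wcy j * wce j :: 'n weyl_clifford)"
    by (simp add: dirac_operator_def wcy_def wce_def tensor_mult_tensor)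
  then show ?thesis
    unfolding d fock.ad_dirac_def fock.contract_y_def fock.polar_x_def
    by (simp add: sum_distrib_right sum_distrib_left
      complex_vector.scale_sum_right flip: sum_subtractf sum.distrib)
       (simp add: half_twisted_commutator[OF wc_commute(4) grading_generators(2) assms])
qed

lemma vector_variable_commutator:
  fixes a :: "'n::finite weyl_clifford"
  assumes "grading a = a"
  shows "vector_variable * a - a * vector_variable = fock.ad_vector a"
proof -
  have v: "vector_variable = (\<Sum>j\<in>UNIV. wcx j * wce j :: 'n weyl_clifford)"
    by (simp add: vector_variable_def wcx_def wce_def tensor_mult_tensor)
  have "comm (- wcx j) a = - comm (wcx j) a" for j by (simp add: comm_def)
  then have "half_twisted 1 (wce j) (comm (- wcx j) a)
    = - half_twisted 1 (wce j) (comm (wcx j) a)" for j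
    by (simp add: clinear_uminus[OF half_twisted_linear])
  then show ?thesis
    unfolding v fock.ad_vector_def fock.contract_x_def fock.polar_y_def
    by (simp add: sum_distrib_right sum_distrib_left complex_vector.scale_sum_right sum_negf
          flip: sum_subtractf sum.distrib)
       (simp add: half_twisted_commutator[OF wc_commute(3) grading_generators(1) assms])
qed

lemma O_elem_gen: "O_elem i j = wcx i * wcy j - wcx j * wcy i + (1/2) *\<^sub>C (wce i * wce j)"
  by (simp add: O_elem_def wcx_def wcy_def wce_def tensor_mult_tensor clinear_diff[OF clinear_tensor(1)])

lemma half_anti_comm_average:
  "half_anti u (half_anti v a) + (1/4) *\<^sub>C comm u (comm v a) = (1/2) *\<^sub>C (u * v * a + a * v * u)"
proof -
  have "half_anti u (half_anti v a) + (1/4) *\<^sub>C comm u (comm v a)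
     = ((1/4) *\<^sub>C (u * v * a + a * v * u)) + ((1/4) *\<^sub>C (u * v * a + a * v * u))"
    by (simp add: half_anti_def comm_def sc_simps mult.assoc algebra_simps)
  then show ?thesis unfolding scaleC_quarters .
qed

lemma half_twisted_average:
  assumes "grading u = - u" "grading v = - v"
  shows "half_twisted 1 u (half_twisted 1 v a) + half_twisted (- 1) u (half_twisted (- 1) v a)
    = (1/2) *\<^sub>C (u * v * a - a * v * u)"
proof -
  have "half_twisted 1 u (half_twisted 1 v a) + half_twisted (- 1) u (half_twisted (- 1) v a)
    = (1/4) *\<^sub>C (u * v * a - a * v * u) + (1/4) *\<^sub>C (u * v * a - a * v * u)"
    by (simp add: half_twisted_def sc_simps mult.assoc assms grading_mult grading_involutive
      clinear_add[OF grading_linear] clinear_diff[OF grading_linear]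
        clinear_scale[OF grading_linear] algebra_simps)
  then show ?thesis unfolding scaleC_quarters .
qed

text \<open>
  Averaging the left and the right multiplication cancels the terms of first order. Since \<open>i \<noteq> j\<close>,
  all factors of \<open>O\<^sub>i\<^sub>j\<close> commute or anticommute, so no constants appear.
\<close>

lemma O_elem_average:
  assumes "i \<noteq> j"
  shows "fock.moment i j f + fock.moment_dual i j f = (1/2) *\<^sub>C (O_elem i j * f + f * O_elem i j)"
proof -
  have PY: "comm (- wcx k) z = - comm (wcx k) z" for k and z :: "'a weyl_clifford"
    by (simp add: comm_def)
  have "wce i * wce j = - (wce j * wce i)"
    using wc_clifford_relation[of i j] assms by (simp add: eq_neg_iff_add_eq_0)
  then have e: "f * wce j * wce i = - (f * (wce i * wce j))"
    by (simp add: mult.assoc)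
  have w: "wcy j * wcx i = wcx i * wcy j" "wcy i * wcx j = wcx j * wcy i"
    using wc_weyl_relation[of j i] wc_weyl_relation[of i j] assms by auto
  have "fock.moment i j f + fock.moment_dual i j f
     = (half_anti (wcx i) (half_anti (wcy j) f) + (1/4) *\<^sub>C comm (wcx i) (comm (wcy j) f))
      - (half_anti (wcx j) (half_anti (wcy i) f) + (1/4) *\<^sub>C comm (wcx j) (comm (wcy i) f))
      + (1/2) *\<^sub>C (half_twisted 1 (wce i) (half_twisted 1 (wce j) f)
          + half_twisted (- 1) (wce i) (half_twisted (- 1) (wce j) f))"
    by (simp add: fock.moment_def fock.plucker_def fock.moment_dual_def PY
      complex_vector.scale_right_distrib
        complex_vector.scale_right_diff_distrib)
  also have "\<dots> = (1/2) *\<^sub>C (O_elem i j * f + f * O_elem i j)"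
    unfolding half_anti_comm_average half_twisted_average[OF grading_generators(3) grading_generators(3)] e
    by (simp add: O_elem_gen sc_simps mult.assoc w)
  finally show ?thesis .
qed

section \<open>The image of the orthogonal Lie algebra\<close>

text \<open>
  The factor \<open>1/4\<close> accounts for the fact that a skew matrix counts each pair of indices twice
  while \<open>e\<^sub>i e\<^sub>j\<close>, unlike \<open>x\<^sub>i y\<^sub>j\<close>, is already skew in the pair for \<open>i \<noteq> j\<close>.
\<close>

definition quad :: "'n \<Rightarrow> 'n \<Rightarrow> 'n weyl_clifford" where
  "quad i j = wcx i * wcy j + (1/4) *\<^sub>C (wce i * wce j)"

definition so_image :: "'n::finite so \<Rightarrow> 'n weyl_clifford" where
  "so_image A = (\<Sum>i\<in>UNIV. \<Sum>j\<in>UNIV. Rep_so A $ i $ j *\<^sub>C quad i j)"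

lemma Rep_so_skew: "Rep_so A $ i $ j = - Rep_so A $ j $ i"
proof -
  have "transpose (Rep_so A) $ j $ i = (- Rep_so A) $ j $ i" using Rep_so[of A] by simp
  then show ?thesis by (simp add: transpose_def)
qed

lemma so_image_linear: "clinear so_image"
  by (simp add: clinear_def so_image_def plus_so.rep_eq scaleC_so.rep_eq sum.distrib
      complex_vector.scale_left_distrib complex_vector.scale_sum_right)

lemma comm_mult: "comm a (b * d) = comm a b * d + b * comm a d"
  by (simp add: comm_def algebra_simps)

lemma comm_linear_left: "clinear (\<lambda>u. comm u z)"
  by (simp add: clinear_def comm_def sc_simps)

lemma quad_comm:
  "comm (quad i j) (wcx k) = (if j = k then wcx i else 0)"
  "comm (quad i j) (wcy k) = - (if i = k then wcy j else 0)"
  "comm (quad i j) (wce k)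
  = (1/2) *\<^sub>C ((if j = k then wce i else 0) - (if i = k then wce j else 0))"
proof -
  have w: "wcy i * wcx j = wcx j * wcy i + (if i = j then 1 else 0)"
    "wcy i * (wcx j * z) = wcx j * (wcy i * z) + (if i = j then z else 0)" for i j :: 'a and z
  proof -
    show "wcy i * wcx j = wcx j * wcy i + (if i = j then 1 else 0)" by (rule wc_weyl_relation)
    show "wcy i * (wcx j * z) = wcx j * (wcy i * z) + (if i = j then z else 0)"
      unfolding mult.assoc[symmetric] wc_weyl_relation by (simp add: distrib_right)
  qed
  have c: "wce i * wcx j = wcx j * wce i" "wce i * wcy j = wcy j * wce i"
    "wce i * (wcx j * z) = wcx j * (wce i * z)"
    "wce i * (wcy j * z) = wcy j * (wce i * z)" for i j :: 'a and z
    unfolding mult.assoc[symmetric] wc_commute(3,4) by (rule refl)+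
  have "wcx i * (wcx k * wcy j) = wcx k * (wcx i * wcy j)" 
    using arg_cong[OF wc_commute(1)[of i k], of "\<lambda>u. u * wcy j"] by (simp add: mult.assoc)
  then show "comm (quad i j) (wcx k) = (if j = k then wcx i else 0)"
    by (auto simp: comm_def quad_def sc_simps mult.assoc w c)
  have "wcy j * wcy k = wcy k * wcy j" by (rule wc_commute)
  then show "comm (quad i j) (wcy k) = - (if i = k then wcy j else 0)"
    by (auto simp: comm_def quad_def sc_simps mult.assoc w c)
  have "comm (quad i j) (wce k)
    = (1/4) *\<^sub>C (wce i * (wce j * wce k + wce k * wce j) - (wce i * wce k + wce k * wce i) * wce j)"
    by (simp add: comm_def quad_def sc_simps mult.assoc c algebra_simps)
  also have "\<dots> = (1/2) *\<^sub>C ((if j = k then wce i else 0) - (if i = k then wce j else 0))"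
  proof -
    have "u * (1 + 1) = 2 *\<^sub>C u" "(1 + 1) * u = 2 *\<^sub>C u" for u :: "'a weyl_clifford"
      by (simp_all add: distrib_left distrib_right scaleC_two)
    then show ?thesis
      unfolding wc_clifford_relation by (auto simp: complex_vector.scale_right_diff_distrib)
  qed
  finally show "comm (quad i j) (wce k)
    = (1/2) *\<^sub>C ((if j = k then wce i else 0) - (if i = k then wce j else 0))" .
qed

lemma scale_if_zero: "c *\<^sub>C (if P then x else 0) = (if P then c *\<^sub>C x else 0)"
  for x :: "'a::complex_vector"
  by simp

lemma comm_so_image_expand:
  "comm (so_image A) z = (\<Sum>i\<in>UNIV. \<Sum>j\<in>UNIV. Rep_so A $ i $ j *\<^sub>C comm (quad i j) z)"
  by (simp add: so_image_def clinear_sum[OF comm_linear_left] clinear_scale[OF comm_linear_left])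

lemma so_image_rows:
  fixes A :: "'n::finite so" and z :: "'n \<Rightarrow> 'v::complex_vector"
  shows "(\<Sum>i\<in>UNIV. \<Sum>j\<in>UNIV. Rep_so A $ i $ j *\<^sub>C (if j = k then z i else 0)) = (\<Sum>i\<in>UNIV. Rep_so A $ i $ k *\<^sub>C z i)"
    and "(\<Sum>i\<in>UNIV. \<Sum>j\<in>UNIV. Rep_so A $ i $ j *\<^sub>C (if i = k then z j else 0)) = - (\<Sum>i\<in>UNIV. Rep_so A $ i $ k *\<^sub>C z i)"
proof -
  show "(\<Sum>i\<in>UNIV. \<Sum>j\<in>UNIV. Rep_so A $ i $ j *\<^sub>C (if j = k then z i else 0)) = (\<Sum>i\<in>UNIV. Rep_so A $ i $ k *\<^sub>C z i)"
    by (simp add: scale_if_zero)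
  have "(\<Sum>i\<in>UNIV. \<Sum>j\<in>UNIV. Rep_so A $ i $ j *\<^sub>C (if i = k then z j else 0)) = (\<Sum>j\<in>UNIV. Rep_so A $ k $ j *\<^sub>C z j)"
    by (subst sum.swap) (simp add: scale_if_zero)
  also have "\<dots> = - (\<Sum>i\<in>UNIV. Rep_so A $ i $ k *\<^sub>C z i)"
    by (subst Rep_so_skew) (simp add: sum_negf)
  finally show "(\<Sum>i\<in>UNIV. \<Sum>j\<in>UNIV. Rep_so A $ i $ j *\<^sub>C (if i = k then z j else 0)) = - (\<Sum>i\<in>UNIV. Rep_so A $ i $ k *\<^sub>C z i)" .
qed

text \<open>
  The three families of generators transform alike. This alone yields the bracket relation and the
  invariance of the Dirac operator and of the vector variable.
\<close>

lemma comm_so_image: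
  "comm (so_image A) (wcx k) = (\<Sum>i\<in>UNIV. Rep_so A $ i $ k *\<^sub>C wcx i)"
  "comm (so_image A) (wcy k) = (\<Sum>i\<in>UNIV. Rep_so A $ i $ k *\<^sub>C wcy i)"
  "comm (so_image A) (wce k) = (\<Sum>i\<in>UNIV. Rep_so A $ i $ k *\<^sub>C wce i)"
proof -
  show "comm (so_image A) (wcx k) = (\<Sum>i\<in>UNIV. Rep_so A $ i $ k *\<^sub>C wcx i)"
    unfolding comm_so_image_expand quad_comm by (rule so_image_rows)
  show "comm (so_image A) (wcy k) = (\<Sum>i\<in>UNIV. Rep_so A $ i $ k *\<^sub>C wcy i)"
    unfolding comm_so_image_expand quad_comm
      complex_vector.scale_minus_right sum_negf so_image_rows by simp
  have "comm (so_image A) (wce k)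
    = (1/2) *\<^sub>C ((\<Sum>i\<in>UNIV. \<Sum>j\<in>UNIV. Rep_so A $ i $ j *\<^sub>C (if j = k then wce i else 0))
      - (\<Sum>i\<in>UNIV. \<Sum>j\<in>UNIV. Rep_so A $ i $ j *\<^sub>C (if i = k then wce j else 0)))"
    unfolding comm_so_image_expand quad_comm
    by (simp only: complex_vector.scale_left_commute[of _ "1/2"]
      complex_vector.scale_right_diff_distrib
        sum_subtractf complex_vector.scale_sum_right)
  then show "comm (so_image A) (wce k) = (\<Sum>i\<in>UNIV. Rep_so A $ i $ k *\<^sub>C wce i)"
    unfolding so_image_rows by (simp flip: scaleC_two)
qed

lemma comm_so_image_quad:
  "comm (so_image A) (quad i j)
     = (\<Sum>l\<in>UNIV. Rep_so A $ l $ i *\<^sub>C quad l j) + (\<Sum>l\<in>UNIV. Rep_so A $ l $ j *\<^sub>C quad i l)"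
  unfolding quad_def
  by (simp add: clinear_add[OF comm_linear] clinear_scale[OF comm_linear] comm_mult comm_so_image
      sum_distrib_left sum_distrib_right mult_scaleC_left mult_scaleC_right
        complex_vector.scale_right_distrib
      sum.distrib complex_vector.scale_sum_right mult.commute)

lemma so_image_bracket: "so_image (lie_bracket A B) = comm (so_image A) (so_image B)"
proof -
  let ?A = "\<lambda>i j. Rep_so A $ i $ j" and ?B = "\<lambda>i j. Rep_so B $ i $ j"
  have "comm (so_image A) (so_image B)
    = (\<Sum>i\<in>UNIV. \<Sum>j\<in>UNIV. ?B i j *\<^sub>C comm (so_image A) (quad i j))"
    by (subst (2) so_image_def) (simp add: clinear_sum[OF comm_linear]
      clinear_scale[OF comm_linear])
  also have "\<dots> = (\<Sum>i\<in>UNIV. \<Sum>j\<in>UNIV. \<Sum>l\<in>UNIV. (?A l i * ?B i j) *\<^sub>C quad l j)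
      + (\<Sum>i\<in>UNIV. \<Sum>j\<in>UNIV. \<Sum>l\<in>UNIV. (?B i j * ?A l j) *\<^sub>C quad i l)"
    by (simp add: comm_so_image_quad complex_vector.scale_right_distrib
      complex_vector.scale_sum_right sum.distrib
      mult.commute)
  also have "(\<Sum>i\<in>UNIV. \<Sum>j\<in>UNIV. \<Sum>l\<in>UNIV. (?A l i * ?B i j) *\<^sub>C quad l j)
      = (\<Sum>i\<in>UNIV. \<Sum>j\<in>UNIV. \<Sum>l\<in>UNIV. (?A i l * ?B l j) *\<^sub>C quad i j)"
  proof -
    have "(\<Sum>i\<in>UNIV. \<Sum>j\<in>UNIV. \<Sum>l\<in>UNIV. (?A l i * ?B i j) *\<^sub>C quad l j)
        = (\<Sum>i\<in>UNIV. \<Sum>l\<in>UNIV. \<Sum>j\<in>UNIV. (?A l i * ?B i j) *\<^sub>C quad l j)"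
      by (intro sum.cong refl sum.swap)
    also have "\<dots> = (\<Sum>l\<in>UNIV. \<Sum>i\<in>UNIV. \<Sum>j\<in>UNIV. (?A l i * ?B i j) *\<^sub>C quad l j)"
      by (rule sum.swap)
    also have "\<dots> = (\<Sum>l\<in>UNIV. \<Sum>j\<in>UNIV. \<Sum>i\<in>UNIV. (?A l i * ?B i j) *\<^sub>C quad l j)"
      by (intro sum.cong refl sum.swap)
    finally show ?thesis .
  qed
  also have "(\<Sum>i\<in>UNIV. \<Sum>j\<in>UNIV. \<Sum>l\<in>UNIV. (?B i j * ?A l j) *\<^sub>C quad i l)
      = - (\<Sum>i\<in>UNIV. \<Sum>j\<in>UNIV. \<Sum>l\<in>UNIV. (?B i l * ?A l j) *\<^sub>C quad i j)"
  proof -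
    have "(\<Sum>i\<in>UNIV. \<Sum>j\<in>UNIV. \<Sum>l\<in>UNIV. (?B i j * ?A l j) *\<^sub>C quad i l)
        = (\<Sum>i\<in>UNIV. \<Sum>l\<in>UNIV. \<Sum>j\<in>UNIV. (?B i j * ?A l j) *\<^sub>C quad i l)"
      by (intro sum.cong refl sum.swap)
    also have "\<dots> = - (\<Sum>i\<in>UNIV. \<Sum>l\<in>UNIV. \<Sum>j\<in>UNIV. (?B i j * ?A j l) *\<^sub>C quad i l)"
      by (subst Rep_so_skew[of A]) (simp add: sum_negf)
    finally show ?thesis .
  qed
  finally show ?thesis
    by (simp add: so_image_def lie_bracket_so.rep_eq matrix_matrix_mult_def
      complex_vector.scale_left_diff_distrib
      complex_vector.scale_sum_left sum_subtractf)
qed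

text \<open>A skew matrix preserves the pairing of \<open>z\<close> with \<open>e\<close>.\<close>

lemma so_image_commutes:
  fixes A :: "'n::finite so"
  assumes "\<And>k. comm (so_image A) (z k) = (\<Sum>i\<in>UNIV. Rep_so A $ i $ k *\<^sub>C z i)"
  shows "comm (so_image A) (\<Sum>k\<in>UNIV. z k * wce k) = 0"
proof -
  have "comm (so_image A) (\<Sum>k\<in>UNIV. z k * wce k)
     = (\<Sum>k\<in>UNIV. \<Sum>i\<in>UNIV. Rep_so A $ i $ k *\<^sub>C (z i * wce k)) + (\<Sum>k\<in>UNIV. \<Sum>i\<in>UNIV. Rep_so A $ i $ k *\<^sub>C (z k * wce i))"
    by (simp add: clinear_sum[OF comm_linear] comm_mult assms comm_so_image sum.distrib
        sum_distrib_left sum_distrib_right mult_scaleC_left mult_scaleC_right)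
  also have "(\<Sum>k\<in>UNIV. \<Sum>i\<in>UNIV. Rep_so A $ i $ k *\<^sub>C (z i * wce k))
    = (\<Sum>k\<in>UNIV. \<Sum>i\<in>UNIV. Rep_so A $ k $ i *\<^sub>C (z k * wce i))"
    by (rule sum.swap)
  also have "\<dots> = - (\<Sum>k\<in>UNIV. \<Sum>i\<in>UNIV. Rep_so A $ i $ k *\<^sub>C (z k * wce i))"
    by (subst Rep_so_skew) (simp add: sum_negf)
  finally show ?thesis by simp
qed

lemma so_image_TAMA_even: "so_image A \<in> TAMA_even"
proof -
  have "grading (quad i j) = quad i j" for i j :: 'a
    by (simp add: quad_def clinear_add[OF grading_linear] clinear_scale[OF grading_linear]
      grading_mult grading_generators)
  then have "grading (so_image A) = so_image A"
    by (simp add: so_image_def clinear_sum[OF grading_linear] clinear_scale[OF grading_linear])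
  moreover have "dirac_operator = (\<Sum>j\<in>UNIV. wcy j * wce j :: 'a weyl_clifford)"
    "vector_variable = (\<Sum>j\<in>UNIV. wcx j * wce j :: 'a weyl_clifford)"
    by (simp_all add: dirac_operator_def vector_variable_def wcx_def wcy_def wce_def tensor_mult_tensor)
  ultimately show ?thesis
    using so_image_commutes[OF comm_so_image(1), of A] so_image_commutes[OF comm_so_image(2), of A]
    by (simp add: TAMA_even_iff comm_def)
qed

lemma so_X_entry: "Rep_so (so_X i j) $ k $ l
  = (if k = i \<and> l = j then 1 else 0) - (if k = j \<and> l = i then 1 else 0)"
  by (simp add: so_X.rep_eq)

lemma delta_sum:
  fixes F :: "'n::finite \<Rightarrow> 'n \<Rightarrow> 'v::complex_vector"
  shows "(\<Sum>k\<in>UNIV. \<Sum>l\<in>UNIV. (if k = i \<and> l = j then 1 else 0) *\<^sub>C F k l) = F i j"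
proof -
  have "(\<Sum>k\<in>UNIV. \<Sum>l\<in>UNIV. (if k = i \<and> l = j then 1 else 0) *\<^sub>C F k l)
      = (\<Sum>k\<in>UNIV. if k = i then \<Sum>l\<in>UNIV. if l = j then F k l else 0 else 0)"
    by (intro sum.cong refl) (auto simp: scale_if intro!: sum.cong)
  then show ?thesis by simp
qed

lemma so_image_so_X: "i \<noteq> j \<Longrightarrow> so_image (so_X i j) = O_elem i j"
proof -
  assume "i \<noteq> j"
  then have "wce j * wce i = - (wce i * wce j)"
    using wc_clifford_relation[of j i] by (simp add: eq_neg_iff_add_eq_0)
  moreover have "so_image (so_X i j) = quad i j - quad j i"
    by (simp add: so_image_def so_X_entry
      complex_vector.scale_left_diff_distrib sum_subtractf delta_sum)
  moreover have "(1/4) *\<^sub>C z + (1/4) *\<^sub>C z = (1/2) *\<^sub>C z" for z :: "'a weyl_clifford"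
    by (simp flip: scaleC_two)
  ultimately show ?thesis by (simp add: quad_def O_elem_gen algebra_simps)
qed

text \<open>The factor \<open>1/2\<close> corrects for summing over ordered pairs of indices.\<close>

lemma so_X_spanning: "A = (1/2) *\<^sub>C (\<Sum>i\<in>UNIV. \<Sum>j\<in>UNIV. Rep_so A $ i $ j *\<^sub>C so_X i j)"
proof -
  have rep_sum: "Rep_so (sum h I) = (\<Sum>i\<in>I. Rep_so (h i))" for h :: "'b \<Rightarrow> 'a so" and I
    by (induction I rule: infinite_finite_induct) (simp_all add: zero_so.rep_eq plus_so.rep_eq)
  have entry: "Rep_so (\<Sum>i\<in>UNIV. \<Sum>j\<in>UNIV. Rep_so A $ i $ j *\<^sub>C so_X i j) $ k $ l
    = 2 * Rep_so A $ k $ l" for k l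
  proof -
    have "Rep_so (\<Sum>i\<in>UNIV. \<Sum>j\<in>UNIV. Rep_so A $ i $ j *\<^sub>C so_X i j) $ k $ l
       = (\<Sum>i\<in>UNIV. \<Sum>j\<in>UNIV. (if k = i then if l = j then Rep_so A $ i $ j else 0 else 0))
         - (\<Sum>i\<in>UNIV. \<Sum>j\<in>UNIV. (if l = i then if k = j then Rep_so A $ i $ j else 0 else 0))"
      by (simp add: rep_sum scaleC_so.rep_eq so_X_entry flip: sum_subtractf) (auto intro!: sum.cong)
    also have "\<dots>
      = (\<Sum>i\<in>UNIV. if k = i then Rep_so A $ i $ l else 0) - (\<Sum>i\<in>UNIV. if l = i then Rep_so A $ i $ k else 0)"
      by (intro arg_cong2[of _ _ _ _ minus] sum.cong refl) simp_all
    also have "\<dots> = 2 * Rep_so A $ k $ l" using Rep_so_skew[of A l k] by simp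
    finally show ?thesis .
  qed
  show ?thesis
    by (simp add: Rep_so_inject[symmetric] scaleC_so.rep_eq vec_eq_iff entry)
qed

lemma uea_incl_linear: "clinear uea_incl"
proof -
  have "uea_incl (x + y) = uea_incl x + uea_incl y"
    "uea_incl (c *\<^sub>C x) = c *\<^sub>C uea_incl x" for x y :: 'a and c
  proof -
    have "abs_presented (free_gen (UGen (x + y)))
      = abs_presented (free_gen (UGen x) + free_gen (UGen y))"
      by (rule presented_relator, unfold relators_uea_gen_def Let_def diff_diff_eq[symmetric], blast)
    then show "uea_incl (x + y) = uea_incl x + uea_incl y"
      by (simp add: uea_incl_def gen_def plus_presented.abs_eq)
    have "abs_presented (free_gen (UGen (c *\<^sub>C x))) = abs_presented (scalar c * free_gen (UGen x))"
      by (rule presented_relator, unfold relators_uea_gen_def Let_def, blast)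
    then show "uea_incl (c *\<^sub>C x) = c *\<^sub>C uea_incl x"
      by (simp add: uea_incl_def gen_def scaleC_presented.abs_eq)
  qed
  then show ?thesis by (simp add: clinear_def)
qed

text \<open>
  Only the pairs \<open>i \<noteq> j\<close> are prescribed; this determines a homomorphism because \<open>so_X i i\<close> is zero
  and the others span the Lie algebra.
\<close>

lemma hom_uea_incl:
  fixes \<phi> :: "'n::finite so uea \<Rightarrow> 'n weyl_clifford"
  assumes "algebra_hom \<phi>" "\<And>i j. i \<noteq> j \<Longrightarrow> \<phi> (uea_incl (so_X i j)) = O_elem i j"
  shows "\<phi> (uea_incl A) = so_image A"
proof -
  define F where "F A = \<phi> (uea_incl A)" for A
  have F: "clinear F"
    using algebra_hom_clinear[OF assms(1)]
    by (simp add: F_def clinear_def clinear_add[OF uea_incl_linear]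
      clinear_scale[OF uea_incl_linear])
  have diag: "so_X i i = 0" for i :: 'n
    by (simp add: Rep_so_inject[symmetric] vec_eq_iff so_X_entry zero_so.rep_eq)
  have "F (so_X i j) = so_image (so_X i j)" for i j
    using assms(2)[of i j] so_image_so_X[of i j] clinear_zero[OF F] clinear_zero[OF so_image_linear]
    by (cases "i = j") (auto simp: F_def diag)
  then have "F ((1/2) *\<^sub>C (\<Sum>i\<in>UNIV. \<Sum>j\<in>UNIV. Rep_so A $ i $ j *\<^sub>C so_X i j))
     = so_image ((1/2) *\<^sub>C (\<Sum>i\<in>UNIV. \<Sum>j\<in>UNIV. Rep_so A $ i $ j *\<^sub>C so_X i j))"
    by (simp add: clinear_scale[OF F] clinear_sum[OF F] clinear_scale[OF so_image_linear]
      clinear_sum[OF so_image_linear])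
  then show ?thesis unfolding so_X_spanning[of A, symmetric] F_def .
qed

lemma uea_hom_exists:
  "\<exists>\<phi> :: 'n::finite so uea \<Rightarrow> 'n weyl_clifford. algebra_hom \<phi> \<and> (\<forall>A. \<phi> (uea_incl A) = so_image A)"
proof -
  define g where "g x = (case x of UGen A \<Rightarrow> so_image A)" for x :: "'n so uea_gen"
  have "\<exists>\<phi>. algebra_hom \<phi> \<and> (\<forall>x. \<phi> (gen x) = g x)"
  proof (rule presented_universal)
    fix r :: "'n so uea_gen free_algebra"
    assume "r \<in> relators"
    then show "free_extension g r = 0"
      unfolding relators_uea_gen_def Let_def
      by (auto simp: free_extension_simps g_def clinear_add[OF so_image_linear]
        clinear_scale[OF so_image_linear]
          so_image_bracket comm_def mult_scaleC_left)
  qed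
  then show ?thesis unfolding uea_incl_def g_def by (metis uea_gen.case)
qed

section \<open>The even part of the total angular momentum algebra\<close>

lemma TAMA_even_closed:
  fixes a b :: "'n::finite weyl_clifford"
  shows "(1 :: 'n weyl_clifford) \<in> TAMA_even" "a \<in> TAMA_even \<Longrightarrow> b \<in> TAMA_even \<Longrightarrow> a + b \<in> TAMA_even"
  "a \<in> TAMA_even \<Longrightarrow> c *\<^sub>C a \<in> TAMA_even" "a \<in> TAMA_even \<Longrightarrow> b \<in> TAMA_even \<Longrightarrow> a * b \<in> TAMA_even"
proof -
  have assoc: "a * b * z = z * (a * b)" if "a * z = z * a"
    "b * z = z * b" for a b z :: "'n weyl_clifford"
    using that by (metis mult.assoc)
  show "(1 :: 'n weyl_clifford) \<in> TAMA_even" "a \<in> TAMA_even \<Longrightarrow> b \<in> TAMA_even \<Longrightarrow> a + b \<in> TAMA_even"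
    "a \<in> TAMA_even \<Longrightarrow> c *\<^sub>C a \<in> TAMA_even" "a \<in> TAMA_even \<Longrightarrow> b \<in> TAMA_even \<Longrightarrow> a * b \<in> TAMA_even"
    by (auto simp: TAMA_even_iff grading_one grading_mult clinear_add[OF grading_linear]
        clinear_scale[OF grading_linear]
          mult_scaleC_left mult_scaleC_right distrib_left distrib_right intro!: assoc)
qed

lemma hom_range_subset:
  fixes \<phi> :: "'n::finite so uea \<Rightarrow> 'n weyl_clifford"
  assumes "algebra_hom \<phi>" "\<And>A. \<phi> (uea_incl A) = so_image A"
  shows "\<phi> a \<in> TAMA_even"
proof (induction a rule: presented_induct)
  case (gen x a)
  obtain A where "gen x = uea_incl A" by (cases x) (auto simp: uea_incl_def)
  then show ?case using gen
    by (simp add: algebra_hom_mult[OF assms(1)] assms(2) TAMA_even_closed so_image_TAMA_even)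
qed (simp_all add: algebra_hom_one[OF assms(1)] clinear_add[OF algebra_hom_clinear[OF assms(1)]]
    clinear_scale[OF algebra_hom_clinear[OF assms(1)]] TAMA_even_closed)

text \<open>
  The range is a subalgebra, so with \<open>f\<close> it contains the averages of \<open>O\<^sub>i\<^sub>j f\<close> and \<open>f O\<^sub>i\<^sub>j\<close>; this
  is the closure property under which the even invariants are generated from \<open>1\<close>.
\<close>

lemma TAMA_even_subset_range:
  fixes \<phi> :: "'n::finite so uea \<Rightarrow> 'n weyl_clifford"
  assumes "algebra_hom \<phi>" "\<And>A. \<phi> (uea_incl A) = so_image A" "a \<in> TAMA_even"
  shows "a \<in> range \<phi>"
proof -
  note \<phi> = algebra_hom_clinear[OF assms(1)]
  have a: "grading a = a" "fock.ad_dirac a = 0" "fock.ad_vector a = 0"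
    using assms(3) dirac_commutator[of a] vector_variable_commutator[of a] by
      (simp_all add: TAMA_even_iff)
  show ?thesis
  proof (rule fock.even_invariants_generated[of "\<lambda>a. a \<in> range \<phi>", OF _ _ _ _ a])
    show "1 \<in> range \<phi>" by (metis algebra_hom_one[OF assms(1)] rangeI)
    show "f + g \<in> range \<phi>" if "f \<in> range \<phi>" "g \<in> range \<phi>" for f g
      using that by (auto simp flip: clinear_add[OF \<phi>])
    show scale: "c *\<^sub>C f \<in> range \<phi>" if "f \<in> range \<phi>" for c f
      using that by (auto simp flip: clinear_scale[OF \<phi>])
    show "fock.moment i j f + fock.moment_dual i j f \<in> range \<phi>" if ij: "i \<noteq> j" and f: "f \<in> range \<phi>" for i j f
    proof -
      obtain u where "f = \<phi> u" using f by blast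
      moreover have "O_elem i j = \<phi> (uea_incl (so_X i j))"
        using assms(2) so_image_so_X[OF ij] by simp
      ultimately have "O_elem i j * f + f * O_elem i j
          = \<phi> (uea_incl (so_X i j) * u + u * uea_incl (so_X i j))"
        by (simp add: algebra_hom_mult[OF assms(1)] clinear_add[OF \<phi>])
      then show ?thesis unfolding O_elem_average[OF ij] by (intro scale) simp
    qed
  qed
qed

theorem proposition4p5:
  shows "(\<exists>!\<phi> :: 'n::finite so uea \<Rightarrow> 'n weyl_clifford.
            algebra_hom \<phi> \<and> range \<phi> \<subseteq> TAMA \<and>
            (\<forall>i j. i \<noteq> j \<longrightarrow> \<phi> (uea_incl (so_X i j)) = O_elem i j)) \<and>
         (\<forall>\<phi> :: 'n so uea \<Rightarrow> 'n weyl_clifford.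
            algebra_hom \<phi> \<and> range \<phi> \<subseteq> TAMA \<and>
            (\<forall>i j. i \<noteq> j \<longrightarrow> \<phi> (uea_incl (so_X i j)) = O_elem i j) \<longrightarrow>
            range \<phi> = TAMA_even)"
proof (intro conjI allI impI)
  fix \<phi> :: "'n so uea \<Rightarrow> 'n weyl_clifford"
  assume "algebra_hom \<phi> \<and> range \<phi> \<subseteq> TAMA \<and> (\<forall>i j. i \<noteq> j \<longrightarrow> \<phi> (uea_incl (so_X i j)) = O_elem i j)"
  then have "algebra_hom \<phi>" "\<And>A. \<phi> (uea_incl A) = so_image A" using hom_uea_incl by blast+
  then show "range \<phi> = TAMA_even"
    using hom_range_subset TAMA_even_subset_range by blast
next
  obtain \<phi> :: "'n so uea \<Rightarrow> 'n weyl_clifford" where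
    \<phi>: "algebra_hom \<phi>" "\<And>A. \<phi> (uea_incl A) = so_image A" using uea_hom_exists by blast
  show "\<exists>!\<phi> :: 'n so uea \<Rightarrow> 'n weyl_clifford. algebra_hom \<phi> \<and> range \<phi> \<subseteq> TAMA \<and>
      (\<forall>i j. i \<noteq> j \<longrightarrow> \<phi> (uea_incl (so_X i j)) = O_elem i j)"
  proof (rule ex1I[of _ \<phi>])
    show "algebra_hom \<phi> \<and> range \<phi> \<subseteq> TAMA \<and> (\<forall>i j. i \<noteq> j \<longrightarrow> \<phi> (uea_incl (so_X i j)) = O_elem i j)"
      using \<phi> hom_range_subset[OF \<phi>] by (auto simp: so_image_so_X TAMA_even_def)
    fix \<psi> :: "'n so uea \<Rightarrow> 'n weyl_clifford"
    assume "algebra_hom \<psi> \<and> range \<psi> \<subseteq> TAMA \<and> (\<forall>i j. i \<noteq> j \<longrightarrow> \<psi> (uea_incl (so_X i j)) = O_elem i j)"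
    then have \<psi>: "algebra_hom \<psi>" "\<And>A. \<psi> (uea_incl A) = so_image A" using hom_uea_incl by blast+
    have "\<psi> a = \<phi> a" for a
    proof (induction a rule: presented_induct)
      case (gen x a)
      obtain A where "gen x = uea_incl A" by (cases x) (auto simp: uea_incl_def)
      then show ?case using gen \<phi> \<psi> by (simp add: algebra_hom_mult)
    qed (use \<phi>(1) \<psi>(1) in \<open>simp_all add: algebra_hom_def\<close>)
    then show "\<psi> = \<phi>" by blast
  qed
qed

end
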